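(* Consider the optimal reinsurance–injection problem with excess-of-loss reinsurance, with value function $V$, as defined in the context. Suppose $\delta<\mu+rN-\frac{\sigma^2}{2N}$ (a condition which always holds when $N=\infty$). Let $\kappa>0$ be a solution of $J(1/\kappa)=0$, where $$J(u)=\frac{\sigma^2(u)}{2u}-\mu(u)-ru+\delta ,$$ with $0<1/\kappa<N$, and let $\varsigma$ be the unique solution on the interval $(c/\kappa,\infty)$ of the equation $$K+\frac{c}{\kappa}\ln\frac{\varsigma\kappa}{c}+\frac{c}{\kappa}-\varsigma=0 .$$ Then the value function is $$V(x)=\varsigma e^{-\kappa x},\qquad x\ge 0 .$$ Moreover, the following policy $\pi^*$ is optimal, i.e. $V(x)=C^{\pi^*}(x)$: the reinsurance control is the constant $u^*_s\equiv\frac1\kappa$, the cash injections are the constant $$\xi_i^*\equiv\frac{1}{\kappa}\ln\frac{\varsigma\kappa}{c},\qquad i=1,2,\dots,$$ and the injection times $\tau_i^*$, $i=1,2,\dots$, are the successive ruin times of the surplus process under $\pi^*$.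
   Context: Constants: $\delta>0$ (debt liability rate), $r>0$ (discount rate), $K>0$ (fixed set-up cost), $c\ge 1$ (proportional cost rate). $F$ is the distribution function of a positive random variable (claim size) with finite second moment, and $N\le\infty$ is the upper bound of the support of $F$. Let $\{w_s\}_{s\ge0}$ be a standard Brownian motion adapted to a filtration $\{\mathcal F_s\}_{s\ge 0}$ on a probability space $(\Omega,\mathcal F,P)$. Excess-of-loss reinsurance: for $0\le u\le N$, $$\mu(u)=\int_0^u[1-F(y)]\,dy,\qquad \sigma(u)=\sqrt{\int_0^u 2y[1-F(y)]\,dy},$$ and $\mu=\mu(N)$, $\sigma^2=\sigma^2(N)$ (the first two moments of $F$). A control policy is a triple $\pi=\{u_s,\,s>0;\ (\tau_1,\tau_2,\dots);\ (\xi_1,\xi_2,\dots)\}$, where $u_s$ is a predictable process with values in $[0,N]$ (the maximal payment retained per claim), $\tau_1,\tau_2,\dots$ is an increasing sequence of stopping times with respect to $\{\mathcal F_s\}$ (times of cash injections), and each $\xi_i>0$ is an $\mathcal F_{\tau_i}$-measurable random variable (size of the $i$th injection). Given initial surplus $x\ge 0$, the surplus process under $\pi$ is $$X^\pi_t=x+\int_0^t[\mu(u_s)-\delta]\,ds+\int_0^t\sigma(u_s)\,dw_s+\sum_{\tau_i\le t}\xi_i .$$ The cost of an injection of size $\xi$ is $g(\xi)=K+c\xi$, and the cost function of $\pi$ is $$C^\pi(x)=E_x\Big[\sum_{\tau_i<\infty}e^{-r\tau_i}g(\xi_i)\Big],$$ where $E_x$ is expectation given initial surplus $x$. A policy $\pi$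 is admissible if $X^\pi_t\ge 0$ almost surely for all $t$ and $C^\pi(x)<\infty$ for all $x\ge0$; $\Pi$ is the set of admissible policies. The value function is $V(x)=\inf_{\pi\in\Pi}C^\pi(x)$, $x\ge0$. A policy $\pi^*\in\Pi$ is optimal if $C^{\pi^*}(x)=V(x)$. Ruin times of the surplus process are the successive times at which the surplus (just before injection) hits zero; if $x=0$ the first ruin time is $0$. *)

theory Defs
  imports "HOL-Probability.Probability"
begin

section \<open>Brownian motion and the Ito integral\<close>

text \<open>
  Filtrations are indexed by \<open>ennreal\<close>, so that the library's \<open>stopping_time\<close> and \<open>pre_sigma\<close>
  cover stopping times with values in \<open>[0,\<infinity>]\<close>.  The member at \<open>\<infinity>\<close> is an arbitrary sub-sigma-algebra
  containing the others; it plays no further role.  No completeness or right-continuity is assumed.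
\<close>

definition filtration_on :: "'a measure \<Rightarrow> (ennreal \<Rightarrow> 'a measure) \<Rightarrow> bool" where
  "filtration_on M F \<longleftrightarrow> filtration (space M) F \<and> (\<forall>t. subalgebra M (F t))"

definition brownian_motion ::
    "'a measure \<Rightarrow> (ennreal \<Rightarrow> 'a measure) \<Rightarrow> (real \<Rightarrow> 'a \<Rightarrow> real) \<Rightarrow> bool" where
  "brownian_motion M F w \<longleftrightarrow>
     (\<forall>t\<ge>0. w t \<in> borel_measurable (F (ennreal t))) \<and>
     (\<forall>\<omega>\<in>space M. continuous_on {0..} (\<lambda>t. w t \<omega>)) \<and>
     (AE \<omega> in M. w 0 \<omega> = 0) \<and>
     (\<forall>s t. 0 \<le> s \<and> s < t \<longrightarrow>
        distributed M lborel (\<lambda>\<omega>. w t \<omega> - w s \<omega>) (normal_density 0 (sqrt (t - s))) \<and>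
        prob_space.indep_set M (sets (F (ennreal s)))
          {(\<lambda>\<omega>. w t \<omega> - w s \<omega>) -` B \<inter> space M | B. B \<in> sets borel})"

text \<open>A simple integrand is \<open>H s = \<Sum>i<n. a i * 1(p i < s \<le> p (i+1))\<close>.\<close>

definition simple_integrand ::
    "(ennreal \<Rightarrow> 'a measure) \<Rightarrow> nat \<Rightarrow> (nat \<Rightarrow> real) \<Rightarrow> (nat \<Rightarrow> 'a \<Rightarrow> real) \<Rightarrow> bool" where
  "simple_integrand F n p a \<longleftrightarrow>
     0 \<le> p 0 \<and> (\<forall>i<n. p i \<le> p (Suc i)) \<and>
     (\<forall>i<n. a i \<in> borel_measurable (F (ennreal (p i))) \<and>
            (\<exists>B. \<forall>\<omega>\<in>space (F (ennreal (p i))). \<bar>a i \<omega>\<bar> \<le> B))"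

definition simple_value ::
    "nat \<Rightarrow> (nat \<Rightarrow> real) \<Rightarrow> (nat \<Rightarrow> 'a \<Rightarrow> real) \<Rightarrow> real \<Rightarrow> 'a \<Rightarrow> real" where
  "simple_value n p a s \<omega> = (\<Sum>i<n. a i \<omega> * indicator {p i<..p (Suc i)} s)"

definition simple_integral ::
    "(real \<Rightarrow> 'a \<Rightarrow> real) \<Rightarrow> nat \<Rightarrow> (nat \<Rightarrow> real) \<Rightarrow> (nat \<Rightarrow> 'a \<Rightarrow> real) \<Rightarrow> real \<Rightarrow> 'a \<Rightarrow> real" where
  "simple_integral w n p a t \<omega> =
     (\<Sum>i<n. a i \<omega> * (w (min (p (Suc i)) t) \<omega> - w (min (p i) t) \<omega>))"

text \<open>
  \<open>I\<close> is a continuous version of the Ito integral process \<open>\<integral>\<^sub>0\<^sup>t H dw\<close>: on every \<open>[0,t]\<close> it is the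
  \<open>L\<^sup>2\<close> limit of integrals of simple integrands converging to \<open>H\<close> in \<open>L\<^sup>2([0,t] \<times> \<Omega>)\<close>.
  This determines \<open>I\<close> up to indistinguishability; adaptedness up to null sets is automatic.
\<close>

definition is_ito_integral ::
    "'a measure \<Rightarrow> (ennreal \<Rightarrow> 'a measure) \<Rightarrow> (real \<Rightarrow> 'a \<Rightarrow> real) \<Rightarrow>
     (real \<Rightarrow> 'a \<Rightarrow> real) \<Rightarrow> (real \<Rightarrow> 'a \<Rightarrow> real) \<Rightarrow> bool" where
  "is_ito_integral M F w H I \<longleftrightarrow>
     (\<forall>t\<ge>0. I t \<in> borel_measurable M) \<and>
     (\<forall>\<omega>\<in>space M. continuous_on {0..} (\<lambda>t. I t \<omega>)) \<and>
     (\<exists>n p a.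
        (\<forall>k::nat. simple_integrand F (n k) (p k) (a k)) \<and>
        (\<forall>t\<ge>0. (\<lambda>k. \<integral>\<^sup>+\<omega>. (\<integral>\<^sup>+s\<in>{0..t}.
                  ennreal ((H s \<omega> - simple_value (n k) (p k) (a k) s \<omega>)\<^sup>2) \<partial>lborel) \<partial>M)
                \<longlonglongrightarrow> 0) \<and>
        (\<forall>t\<ge>0. (\<lambda>k. \<integral>\<^sup>+\<omega>.
                  ennreal ((I t \<omega> - simple_integral w (n k) (p k) (a k) t \<omega>)\<^sup>2) \<partial>M)
                \<longlonglongrightarrow> 0))"

definition predictable_sigma :: "'a measure \<Rightarrow> (ennreal \<Rightarrow> 'a measure) \<Rightarrow> (real \<times> 'a) measure" where
  "predictable_sigma M F =
     sigma ({0<..} \<times> space M)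
       {{s<..t} \<times> A | s t A. 0 \<le> s \<and> s \<le> t \<and> A \<in> sets (F (ennreal s))}"


section \<open>Excess-of-loss reinsurance\<close>

text \<open>The claim size enters through its law \<open>D\<close>; its distribution function is \<open>cdf D\<close>.\<close>

definition claim_law :: "real measure \<Rightarrow> bool" where
  "claim_law D \<longleftrightarrow> real_distribution D \<and> (AE y in D. 0 < y) \<and> integrable D (\<lambda>y. y\<^sup>2)"

definition support_bound :: "real measure \<Rightarrow> ereal" where
  "support_bound D = (SUP y\<in>{y. \<forall>e>0. measure D (ball y e) > 0}. ereal y)"

definition mu :: "real measure \<Rightarrow> ereal \<Rightarrow> real" where
  "mu D u = (LBINT y=0..u. 1 - cdf D y)"

definition sig :: "real measure \<Rightarrow> ereal \<Rightarrow> real" where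
  "sig D u = sqrt (LBINT y=0..u. 2 * y * (1 - cdf D y))"

definition J :: "real measure \<Rightarrow> real \<Rightarrow> real \<Rightarrow> real \<Rightarrow> real" where
  "J D \<delta> r u = (sig D (ereal u))\<^sup>2 / (2 * u) - mu D (ereal u) - r * u + \<delta>"


section \<open>Controls, surplus and cost\<close>

record 'a control =
  retention :: "real \<Rightarrow> 'a \<Rightarrow> ereal"
  inj_time :: "nat \<Rightarrow> 'a \<Rightarrow> ennreal"
  inj_size :: "nat \<Rightarrow> 'a \<Rightarrow> real"

text \<open>
  Injections are numbered from 0, and \<open>inj_time p i \<omega> = \<infinity>\<close> means that the injection does not occur.
\<close>

definition is_control ::
    "'a measure \<Rightarrow> (ennreal \<Rightarrow> 'a measure) \<Rightarrow> real measure \<Rightarrow> 'a control \<Rightarrow> bool" where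
  "is_control M F D p \<longleftrightarrow>
     (\<lambda>(s, \<omega>). retention p s \<omega>) \<in> borel_measurable (predictable_sigma M F) \<and>
     (\<forall>s>0. \<forall>\<omega>\<in>space M. retention p s \<omega> \<in> {0..support_bound D}) \<and>
     (\<forall>i. stopping_time F (inj_time p i)) \<and>
     (\<forall>i. \<forall>\<omega>\<in>space M. inj_time p i \<omega> \<le> inj_time p (Suc i) \<omega>) \<and>
     (\<forall>i. inj_size p i \<in> borel_measurable (filtration.pre_sigma (space M) F (inj_time p i))) \<and>
     (\<forall>i. \<forall>\<omega>\<in>space M. 0 < inj_size p i \<omega>)"

text \<open>\<open>Z\<close> is a continuous version of \<open>x + \<integral>\<^sub>0\<^sup>t (\<mu>(u\<^sub>s) - \<delta>) ds + \<integral>\<^sub>0\<^sup>t \<sigma>(u\<^sub>s) dw\<^sub>s\<close>.\<close>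

definition diffusion_part ::
    "'a measure \<Rightarrow> (ennreal \<Rightarrow> 'a measure) \<Rightarrow> (real \<Rightarrow> 'a \<Rightarrow> real) \<Rightarrow> real measure \<Rightarrow> real \<Rightarrow>
     real \<Rightarrow> 'a control \<Rightarrow> (real \<Rightarrow> 'a \<Rightarrow> real) \<Rightarrow> bool" where
  "diffusion_part M F w D \<delta> x p Z \<longleftrightarrow>
     (\<exists>I. is_ito_integral M F w (\<lambda>s \<omega>. sig D (retention p s \<omega>)) I \<and>
          (\<forall>t\<ge>0. \<forall>\<omega>\<in>space M.
             Z t \<omega> = x + (LBINT s=0..ereal t. mu D (retention p s \<omega>) - \<delta>) + I t \<omega>))"

text \<open>
  The surplus is extended-real valued: infinitely many injections up to time \<open>t\<close> may add up to
  \<open>\<infinity>\<close> (with finite cost this happens with probability 0 only).  Its value just before the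
  injections at time \<open>t\<close> is the left limit for \<open>t > 0\<close>, and \<open>Z 0\<close> (almost surely the initial
  surplus) for \<open>t = 0\<close>.
\<close>

definition surplus :: "'a control \<Rightarrow> (real \<Rightarrow> 'a \<Rightarrow> real) \<Rightarrow> real \<Rightarrow> 'a \<Rightarrow> ereal" where
  "surplus p Z t \<omega> =
     ereal (Z t \<omega>) + (\<Sum>i. if inj_time p i \<omega> \<le> ennreal t then ereal (inj_size p i \<omega>) else 0)"

definition surplus_before :: "'a control \<Rightarrow> (real \<Rightarrow> 'a \<Rightarrow> real) \<Rightarrow> real \<Rightarrow> 'a \<Rightarrow> ereal" where
  "surplus_before p Z t \<omega> =
     ereal (Z t \<omega>) + (\<Sum>i. if inj_time p i \<omega> < ennreal t then ereal (inj_size p i \<omega>) else 0)"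

definition cost :: "'a measure \<Rightarrow> real \<Rightarrow> real \<Rightarrow> real \<Rightarrow> 'a control \<Rightarrow> ennreal" where
  "cost M r K c p =
     (\<integral>\<^sup>+\<omega>. (\<Sum>i. if inj_time p i \<omega> < \<infinity>
        then ennreal (exp (- r * enn2real (inj_time p i \<omega>)) * (K + c * inj_size p i \<omega>))
        else 0) \<partial>M)"


section \<open>Policies, value function and optimality\<close>

text \<open>
  A policy prescribes a control for each initial surplus \<open>x \<ge> 0\<close>: injection times such as ruin
  times depend on \<open>x\<close>, and admissibility and optimality are required for all \<open>x\<close>.
\<close>

definition admissible ::
    "'a measure \<Rightarrow> (ennreal \<Rightarrow> 'a measure) \<Rightarrow> (real \<Rightarrow> 'a \<Rightarrow> real) \<Rightarrow> real measure \<Rightarrow>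
     real \<Rightarrow> real \<Rightarrow> real \<Rightarrow> real \<Rightarrow> (real \<Rightarrow> 'a control) \<Rightarrow> bool" where
  "admissible M F w D \<delta> r K c \<pi> \<longleftrightarrow>
     (\<forall>x\<ge>0. is_control M F D (\<pi> x) \<and>
        (\<exists>Z. diffusion_part M F w D \<delta> x (\<pi> x) Z \<and>
             (\<forall>t\<ge>0. AE \<omega> in M. 0 \<le> surplus (\<pi> x) Z t \<omega>)) \<and>
        cost M r K c (\<pi> x) < \<infinity>)"

definition value_function ::
    "'a measure \<Rightarrow> (ennreal \<Rightarrow> 'a measure) \<Rightarrow> (real \<Rightarrow> 'a \<Rightarrow> real) \<Rightarrow> real measure \<Rightarrow>
     real \<Rightarrow> real \<Rightarrow> real \<Rightarrow> real \<Rightarrow> real \<Rightarrow> ennreal" where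
  "value_function M F w D \<delta> r K c x =
     (INF \<pi>\<in>{\<pi>. admissible M F w D \<delta> r K c \<pi>}. cost M r K c (\<pi> x))"

definition optimal ::
    "'a measure \<Rightarrow> (ennreal \<Rightarrow> 'a measure) \<Rightarrow> (real \<Rightarrow> 'a \<Rightarrow> real) \<Rightarrow> real measure \<Rightarrow>
     real \<Rightarrow> real \<Rightarrow> real \<Rightarrow> real \<Rightarrow> (real \<Rightarrow> 'a control) \<Rightarrow> bool" where
  "optimal M F w D \<delta> r K c \<pi> \<longleftrightarrow>
     admissible M F w D \<delta> r K c \<pi> \<and>
     (\<forall>x\<ge>0. cost M r K c (\<pi> x) = value_function M F w D \<delta> r K c x)"

text \<open>
  The injection times are the successive times at which the surplus just before injection hits 0
  (\<open>\<infinity>\<close> if it does not do so again).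
\<close>

definition injects_at_ruin :: "'a control \<Rightarrow> (real \<Rightarrow> 'a \<Rightarrow> real) \<Rightarrow> 'a \<Rightarrow> bool" where
  "injects_at_ruin p Z \<omega> \<longleftrightarrow>
     inj_time p 0 \<omega> = Inf {ennreal t | t. 0 \<le> t \<and> surplus_before p Z t \<omega> = 0} \<and>
     (\<forall>i. inj_time p (Suc i) \<omega> =
        Inf {ennreal t | t. 0 \<le> t \<and> inj_time p i \<omega> < ennreal t \<and> surplus_before p Z t \<omega> = 0})"

definition constant_ruin_policy ::
    "'a measure \<Rightarrow> (ennreal \<Rightarrow> 'a measure) \<Rightarrow> (real \<Rightarrow> 'a \<Rightarrow> real) \<Rightarrow> real measure \<Rightarrow>
     real \<Rightarrow> real \<Rightarrow> real \<Rightarrow> (real \<Rightarrow> 'a control) \<Rightarrow> bool" where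
  "constant_ruin_policy M F w D \<delta> u \<xi> \<pi> \<longleftrightarrow>
     (\<forall>x\<ge>0. is_control M F D (\<pi> x) \<and>
        (\<forall>s>0. \<forall>\<omega>\<in>space M. retention (\<pi> x) s \<omega> = ereal u) \<and>
        (\<forall>i. \<forall>\<omega>\<in>space M. inj_size (\<pi> x) i \<omega> = \<xi>) \<and>
        (\<exists>Z. diffusion_part M F w D \<delta> x (\<pi> x) Z \<and> (AE \<omega> in M. injects_at_ruin (\<pi> x) Z \<omega>)))"

definition injection_equation :: "real \<Rightarrow> real \<Rightarrow> real \<Rightarrow> real \<Rightarrow> bool" where
  "injection_equation K c \<kappa> \<zeta> \<longleftrightarrow>
     c / \<kappa> < \<zeta> \<and> K + c / \<kappa> * ln (\<zeta> * \<kappa> / c) + c / \<kappa> - \<zeta> = 0"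

end

theory Submission
  imports Defs
begin

text \<open>
  Write \<open>v z = \<zeta> exp (- \<kappa> z)\<close>.  The integrand \<open>(\<kappa> y - 1) (1 - F y)\<close> changes sign at \<open>y = 1 / \<kappa>\<close>, so the
  drift of \<open>exp (- r t) v\<close> along the uncontrolled surplus is nonnegative for every retention level and
  vanishes for the level \<open>1 / \<kappa>\<close>.  Hence \<open>Y t = exp (- r t - \<kappa> Z t)\<close>, with \<open>Z\<close> the diffusion part of the
  surplus, is an exponential martingale times a nondecreasing adapted factor.  The equation for \<open>\<zeta>\<close>
  says that \<open>v z - v (z + y) \<le> K + c y\<close> for all \<open>z \<ge> 0\<close>, \<open>y > 0\<close>, with equality at ruin for the optimal size.
  Integrating \<open>Y\<close> by parts against the nonincreasing factor \<open>exp (- \<kappa> S)\<close>, \<open>S\<close> the injected amount, bounds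
  every cost below by \<open>v x\<close>.  Conversely the constant policy injects when \<open>Z\<close> reaches
  \<open>0, - \<xi>, - 2 \<xi>, \<dots>\<close>, and optional stopping of \<open>Y\<close> bounds its cost above by a geometric series with
  sum \<open>v x\<close>.
\<close>

text \<open>The Ito integral is given only as an \<open>L^2\<close> limit, is measurable merely for
  \<open>M\<close>, and nonnegativity of the surplus holds almost surely at each fixed time; this
  shapes the proof. Martingale properties are identities between expectations weighted by bounded
  \<open>G\<close> that are measurable for the past. A random time is rounded up to a grid, because
  the event that it falls into a given cell is then such a weight. Refining the grid exchanges a
  limit with an expectation; the uniform integrability comes from second moments, and these from the
  exponential martingale with parameter \<open>2 * \<kappa>\<close>. The lower bound takes three
  limits in turn: the mesh, the number of injections, the horizon. Finite cost enters at the second: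
  as \<open>K > 0\<close>, almost surely only finitely many injections occur up to a given time. For
  the upper bound the definition of ruin times is implicit, since the surplus before an injection
  refers to all injection times; on each path it is shown to have the hitting times of the levels as
  its only solution.\<close>

section \<open>Limits of expectations under second-moment bounds\<close>

text \<open>A second-moment bound replaces the dominating function of the reverse Fatou lemma:
  truncation at \<open>R\<close> loses at most \<open>f^2 / R\<close> pointwise, hence at most
  \<open>B / R\<close> in the mean, and the truncated functions are dominated by a constant.\<close>

lemma nn_integral_limsup_le_L2:
  fixes f :: "nat \<Rightarrow> 'a \<Rightarrow> real" and h :: "'a \<Rightarrow> ennreal"
  assumes "finite_measure M"
    and meas [measurable]: "\<And>n. f n \<in> borel_measurable M"
    and B: "\<And>n. (\<integral>\<^sup>+x. ennreal ((f n x)\<^sup>2) \<partial>M) \<le> ennreal B"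
    and lim: "AE x in M. limsup (\<lambda>n. ennreal (f n x)) \<le> h x"
  shows "limsup (\<lambda>n. \<integral>\<^sup>+x. ennreal (f n x) \<partial>M) \<le> (\<integral>\<^sup>+x. h x \<partial>M)"
proof (rule ennreal_le_epsilon)
  interpret finite_measure M by fact
  fix e :: real assume "0 < e"
  \<comment> \<open>\<open>B / e\<close> makes the truncation error at most \<open>e\<close>; the
    maximum with 1 keeps \<open>R\<close> positive when \<open>B\<close> is not.\<close>
  define R where "R = max 1 (B / e)"
  have R: "0 < R" "B / R \<le> e"
    using \<open>0 < e\<close> by (auto simp: R_def field_simps max_def)
  have trunc: "ennreal y \<le> min (ennreal y) (ennreal R) + ennreal (1 / R) * ennreal (y\<^sup>2)" for y
  proof (cases "y \<le> R")
    case True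
    then show ?thesis by (simp add: min_absorb1 ennreal_leI)
  next
    case False
    then have "y * R \<le> y\<^sup>2"
      using R(1) by (simp add: power2_eq_square mult_left_mono)
    then have "y \<le> 1 / R * y\<^sup>2"
      using R(1) by (simp add: field_simps)
    then have "ennreal y \<le> ennreal (1 / R) * ennreal (y\<^sup>2)"
      using R(1) by (simp flip: ennreal_mult'' add: ennreal_leI)
    then show ?thesis
      by (rule order_trans) simp
  qed
  have "(\<integral>\<^sup>+x. ennreal (f n x) \<partial>M) \<le> (\<integral>\<^sup>+x. min (ennreal (f n x)) (ennreal R) \<partial>M) + ennreal e" for n
  proof -
    have "(\<integral>\<^sup>+x. ennreal (f n x) \<partial>M)
        \<le> (\<integral>\<^sup>+x. min (ennreal (f n x)) (ennreal R) + ennreal (1 / R) * ennreal ((f n x)\<^sup>2) \<partial>M)"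
      by (intro nn_integral_mono trunc)
    also have "\<dots> = (\<integral>\<^sup>+x. min (ennreal (f n x)) (ennreal R) \<partial>M)
        + ennreal (1 / R) * (\<integral>\<^sup>+x. ennreal ((f n x)\<^sup>2) \<partial>M)"
      by (subst nn_integral_add) (auto simp: nn_integral_cmult)
    also have "ennreal (1 / R) * (\<integral>\<^sup>+x. ennreal ((f n x)\<^sup>2) \<partial>M) \<le> ennreal (1 / R) * ennreal B"
      by (intro mult_left_mono B) simp
    also have "\<dots> = ennreal (B / R)"
      using R(1) by (subst ennreal_mult'[symmetric]) auto
    also have "\<dots> \<le> ennreal e"
      using R(2) by (rule ennreal_leI)
    finally show ?thesis by (simp add: add_mono)
  qed
  then have "limsup (\<lambda>n. \<integral>\<^sup>+x. ennreal (f n x) \<partial>M)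
      \<le> limsup (\<lambda>n. (\<integral>\<^sup>+x. min (ennreal (f n x)) (ennreal R) \<partial>M) + ennreal e)"
    by (intro Limsup_mono always_eventually allI)
  also have "\<dots> = limsup (\<lambda>n. \<integral>\<^sup>+x. min (ennreal (f n x)) (ennreal R) \<partial>M) + ennreal e"
    by (subst (1 2) add.commute) (simp add: Limsup_const_add)
  also have "limsup (\<lambda>n. \<integral>\<^sup>+x. min (ennreal (f n x)) (ennreal R) \<partial>M)
      \<le> (\<integral>\<^sup>+x. limsup (\<lambda>n. min (ennreal (f n x)) (ennreal R)) \<partial>M)"
    by (rule nn_integral_limsup[where w="\<lambda>_. ennreal R"]) (auto simp: emeasure_eq_measure ennreal_mult_less_top)
  also have "\<dots> \<le> (\<integral>\<^sup>+x. h x \<partial>M)"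
  proof (rule nn_integral_mono_AE)
    show "AE x in M. limsup (\<lambda>n. min (ennreal (f n x)) (ennreal R)) \<le> h x"
      using lim by eventually_elim (rule order_trans[OF Limsup_mono], auto)
  qed
  finally show "limsup (\<lambda>n. \<integral>\<^sup>+x. ennreal (f n x) \<partial>M) \<le> (\<integral>\<^sup>+x. h x \<partial>M) + ennreal e"
    by (simp add: add_mono)
qed

text \<open>Convergence of means under uniform integrability: the lower half is Fatou's lemma, the
  upper half its reverse under the second-moment bound.\<close>

lemma nn_integral_tendsto_L2:
  fixes f :: "nat \<Rightarrow> 'a \<Rightarrow> real"
  assumes "finite_measure M"
    and meas [measurable]: "\<And>n. f n \<in> borel_measurable M"
    and B: "\<And>n. (\<integral>\<^sup>+x. ennreal ((f n x)\<^sup>2) \<partial>M) \<le> ennreal B"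
    and lim: "AE x in M. (\<lambda>n. f n x) \<longlonglongrightarrow> g x"
  shows "(\<lambda>n. \<integral>\<^sup>+x. ennreal (f n x) \<partial>M) \<longlonglongrightarrow> (\<integral>\<^sup>+x. ennreal (g x) \<partial>M)"
proof -
  have lim': "AE x in M. (\<lambda>n. ennreal (f n x)) \<longlonglongrightarrow> ennreal (g x)"
    using lim by eventually_elim (rule tendsto_ennrealI)
  have "AE x in M. limsup (\<lambda>n. ennreal (f n x)) \<le> ennreal (g x)"
    using lim' by eventually_elim (simp add: lim_imp_Limsup)
  from nn_integral_limsup_le_L2[OF assms(1) meas B this]
  have up: "limsup (\<lambda>n. \<integral>\<^sup>+x. ennreal (f n x) \<partial>M) \<le> (\<integral>\<^sup>+x. ennreal (g x) \<partial>M)" .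
  have "AE x in M. ennreal (g x) \<le> liminf (\<lambda>n. ennreal (f n x))"
    using lim' by eventually_elim (simp add: lim_imp_Liminf)
  then have "(\<integral>\<^sup>+x. ennreal (g x) \<partial>M) \<le> (\<integral>\<^sup>+x. liminf (\<lambda>n. ennreal (f n x)) \<partial>M)"
    by (rule nn_integral_mono_AE)
  also have "\<dots> \<le> liminf (\<lambda>n. \<integral>\<^sup>+x. ennreal (f n x) \<partial>M)"
    by (rule nn_integral_liminf) simp
  finally have lo: "(\<integral>\<^sup>+x. ennreal (g x) \<partial>M) \<le> liminf (\<lambda>n. \<integral>\<^sup>+x. ennreal (f n x) \<partial>M)" .
  have "liminf (\<lambda>n. \<integral>\<^sup>+x. ennreal (f n x) \<partial>M) \<le> limsup (\<lambda>n. \<integral>\<^sup>+x. ennreal (f n x) \<partial>M)"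
    by (rule Liminf_le_Limsup) simp
  then show ?thesis
    using up lo by (intro Liminf_eq_Limsup) (auto intro: antisym order_trans)
qed

section \<open>Gaussian integrals and almost sure subsequences\<close>

text \<open>Completing the square: tilting the centred Gaussian density by this exponential yields
  the density with mean \<open>- \<beta> * v\<close>, of total mass 1. This is one step of the
  exponential martingale.\<close>

lemma nn_integral_normal_density_exp:
  assumes "0 < v"
  shows "(\<integral>\<^sup>+y. ennreal (exp (- \<beta> * y - \<beta>\<^sup>2 / 2 * v)) * ennreal (normal_density 0 (sqrt v) y) \<partial>lborel) = 1"
proof -
  have "exp (- \<beta> * y - \<beta>\<^sup>2 / 2 * v) * normal_density 0 (sqrt v) y = normal_density (- \<beta> * v) (sqrt v) y" for y
  proof -
    have "- \<beta> * y - \<beta>\<^sup>2 / 2 * v + - (y - 0)\<^sup>2 / (2 * (sqrt v)\<^sup>2) = - (y - (- \<beta> * v))\<^sup>2 / (2 * (sqrt v)\<^sup>2)"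
      using assms by (simp add: field_simps power2_eq_square)
    then show ?thesis
      unfolding normal_density_def by (simp flip: exp_add)
  qed
  then have "(\<integral>\<^sup>+y. ennreal (exp (- \<beta> * y - \<beta>\<^sup>2 / 2 * v)) * ennreal (normal_density 0 (sqrt v) y) \<partial>lborel)
      = (\<integral>\<^sup>+y. ennreal (normal_density (- \<beta> * v) (sqrt v) y) \<partial>lborel)"
    by (intro nn_integral_cong) (simp flip: ennreal_mult)
  also have "\<dots> = 1"
    using assms by (subst nn_integral_eq_integral) auto
  finally show ?thesis .
qed

text \<open>The cross term is an odd moment and vanishes. This is one step of the Ito isometry, with
  \<open>S\<close> the sum over the earlier increments.\<close>

lemma nn_integral_normal_density_square:
  assumes "0 < v"
  shows "(\<integral>\<^sup>+y. ennreal ((S + a * y)\<^sup>2) * ennreal (normal_density 0 (sqrt v) y) \<partial>lborel) = ennreal (S\<^sup>2 + a\<^sup>2 * v)"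
proof -
  have sv: "0 < sqrt v" using assms by simp
  let ?N = "normal_density 0 (sqrt v)"
  \<comment> \<open>The exponents stay unevaluated so as to match the formulas for odd and even
    moments.\<close>
  have eq: "(S + a * y)\<^sup>2 * ?N y = S\<^sup>2 * ?N y + 2 * S * a * (?N y * (y - 0) ^ (2 * 0 + 1)) + a\<^sup>2 * (?N y * (y - 0) ^ (2 * 1))" for y
    by (simp add: power2_eq_square algebra_simps)
  have "has_bochner_integral lborel (\<lambda>y. S\<^sup>2 * ?N y + 2 * S * a * (?N y * (y - 0) ^ (2 * 0 + 1)) + a\<^sup>2 * (?N y * (y - 0) ^ (2 * 1)))
     (S\<^sup>2 * 1 + 2 * S * a * 0 + a\<^sup>2 * (fact (2 * 1) / ((2 / (sqrt v)\<^sup>2)^1 * fact 1)))"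
    by (intro has_bochner_integral_add has_bochner_integral_mult_right normal_moment_even normal_moment_odd sv)
      (use sv in \<open>simp add: has_bochner_integral_iff\<close>)
  then have hb: "has_bochner_integral lborel (\<lambda>y. (S + a * y)\<^sup>2 * ?N y) (S\<^sup>2 + a\<^sup>2 * v)"
    using assms unfolding eq by (simp add: fact_numeral)
  have "(\<integral>\<^sup>+y. ennreal ((S + a * y)\<^sup>2) * ennreal (?N y) \<partial>lborel) = (\<integral>\<^sup>+y. ennreal ((S + a * y)\<^sup>2 * ?N y) \<partial>lborel)"
    by (intro nn_integral_cong) (simp flip: ennreal_mult)
  also have "\<dots> = ennreal (S\<^sup>2 + a\<^sup>2 * v)"
    using hb by (subst nn_integral_eq_integral) (auto simp: has_bochner_integral_iff)
  finally show ?thesis .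
qed

text \<open>Indices with mean below \<open>(1/2) ^ k\<close> make the sum over \<open>k\<close>
  integrable, hence almost everywhere finite, so its terms vanish. The indices may repeat; only
  limits along them are taken.\<close>

lemma AE_subseq_tendsto_0:
  fixes g :: "nat \<Rightarrow> 'a \<Rightarrow> ennreal"
  assumes [measurable]: "\<And>k. g k \<in> borel_measurable M"
    and lim: "(\<lambda>k. \<integral>\<^sup>+x. g k x \<partial>M) \<longlonglongrightarrow> 0"
  obtains \<rho> :: "nat \<Rightarrow> nat" where "AE x in M. (\<lambda>k. g (\<rho> k) x) \<longlonglongrightarrow> 0"
proof -
  have "\<exists>n. (\<integral>\<^sup>+x. g n x \<partial>M) < ennreal ((1/2) ^ k)" for k :: nat
    using order_tendstoD(2)[OF lim, of "ennreal ((1/2)^k)"] by (auto simp: eventually_sequentially)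
  then obtain \<rho> where \<rho>: "\<And>k. (\<integral>\<^sup>+x. g (\<rho> k) x \<partial>M) < ennreal ((1/2) ^ k)"
    by metis
  have "(\<integral>\<^sup>+x. (\<Sum>k. g (\<rho> k) x) \<partial>M) = (\<Sum>k. \<integral>\<^sup>+x. g (\<rho> k) x \<partial>M)"
    by (rule nn_integral_suminf) simp
  also have "\<dots> \<le> (\<Sum>k. ennreal ((1/2) ^ k))"
    using \<rho> by (intro suminf_le) (auto intro: less_imp_le)
  also have "\<dots> = ennreal (\<Sum>k. (1/2) ^ k)"
    by (rule suminf_ennreal2) (auto intro: summable_geometric)
  finally have "(\<integral>\<^sup>+x. (\<Sum>k. g (\<rho> k) x) \<partial>M) \<noteq> \<infinity>"
    by (auto simp: top_unique)
  then have "AE x in M. (\<Sum>k. g (\<rho> k) x) \<noteq> \<infinity>"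
    by (intro nn_integral_noteq_infinite) auto
  then have "AE x in M. (\<lambda>k. g (\<rho> k) x) \<longlonglongrightarrow> 0"
  proof eventually_elim
    case (elim x)
    have fin: "g (\<rho> k) x \<noteq> \<infinity>" for k
      using elim ennreal_suminf_lessD[of "\<lambda>k. g (\<rho> k) x" top k] by (auto simp: less_top)
    define a where "a k = enn2real (g (\<rho> k) x)" for k
    have ga: "g (\<rho> k) x = ennreal (a k)" for k
      using fin by (simp add: a_def less_top)
    have "summable a"
      using elim by (intro summable_suminf_not_top) (auto simp: a_def ga[unfolded a_def, symmetric])
    from tendsto_ennrealI[OF summable_LIMSEQ_zero[OF this]] show ?case
      by (simp add: ga)
  qed
  then show ?thesis by (rule that)
qed

section \<open>Ito integrals and exponential martingales\<close>

locale filtered_brownian_motion = prob_space M for M :: "'a measure" +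
  fixes F :: "ennreal \<Rightarrow> 'a measure" and w :: "real \<Rightarrow> 'a \<Rightarrow> real"
  assumes filt: "filtration_on M F" and bm: "brownian_motion M F w"
begin

lemma filtration_F: "filtration (space M) F"
  using filt by (simp add: filtration_on_def)

lemma space_F [simp]: "space (F t) = space M"
  using filtration.space_F[OF filtration_F] .

lemma F_mono: "s \<le> t \<Longrightarrow> f \<in> measurable (F s) N \<Longrightarrow> f \<in> measurable (F t) N"
  using filtration.sets_F_mono[OF filtration_F, of s t]
  by (auto simp: measurable_def)

lemma sets_F_le: "sets (F t) \<subseteq> sets M"
  using filt by (simp add: filtration_on_def subalgebra_def)

lemma F_imp_M: "f \<in> measurable (F t) N \<Longrightarrow> f \<in> measurable M N"
  using sets_F_le[of t] by (auto simp: measurable_def)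

lemma measurable_w_F: "0 \<le> s \<Longrightarrow> ennreal s \<le> t \<Longrightarrow> w s \<in> borel_measurable (F t)"
  using bm by (auto simp: brownian_motion_def intro: F_mono)

lemma measurable_w: "0 \<le> s \<Longrightarrow> w s \<in> borel_measurable M"
  by (rule F_imp_M[OF measurable_w_F[OF _ order_refl]])

lemma continuous_w: "\<omega> \<in> space M \<Longrightarrow> continuous_on {0..} (\<lambda>t. w t \<omega>)"
  using bm by (auto simp: brownian_motion_def)

text \<open>The increment over \<open>{s<..t}\<close> is independent of the past, so its law can be integrated out
  with the past frozen.\<close>

lemma nn_integral_increment:
  assumes "0 \<le> s" "s < t" and h: "h \<in> borel_measurable (F (ennreal s) \<Otimes>\<^sub>M borel)"
  shows "(\<integral>\<^sup>+\<omega>. h (\<omega>, w t \<omega> - w s \<omega>) \<partial>M)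
    = (\<integral>\<^sup>+\<omega>. (\<integral>\<^sup>+y. h (\<omega>, y) * ennreal (normal_density 0 (sqrt (t - s)) y) \<partial>lborel) \<partial>M)"
proof -
  define \<Delta> where "\<Delta> \<omega> = w t \<omega> - w s \<omega>" for \<omega>
  have dist: "distributed M lborel \<Delta> (normal_density 0 (sqrt (t - s)))"
    and ind: "indep_set (sets (F (ennreal s))) {\<Delta> -` B \<inter> space M | B. B \<in> sets borel}"
    using bm assms(1,2) unfolding brownian_motion_def \<Delta>_def[abs_def] by auto
  have \<Delta> [measurable]: "\<Delta> \<in> borel_measurable M"
    using distributed_measurable[OF dist] by simp
  have idF: "(\<lambda>\<omega>. \<omega>) \<in> measurable M (F (ennreal s))"
    using sets_F_le by (auto simp: measurable_def)
  interpret D: prob_space "distr M borel \<Delta>"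
    by (rule prob_space_distr) simp
  interpret P: prob_space "distr M (F (ennreal s)) (\<lambda>\<omega>. \<omega>)"
    by (rule prob_space_distr[OF idF])
  have pair: "(\<lambda>\<omega>. (\<omega>, \<Delta> \<omega>)) \<in> measurable M (F (ennreal s) \<Otimes>\<^sub>M borel)"
    by (intro measurable_Pair idF \<Delta>)
  \<comment> \<open>The sample point itself is treated as a random variable with values in
    \<open>F s\<close>; independence then says that the joint law of
    \<open>(\<omega>, \<Delta> \<omega>)\<close> is a product, which is checked on
    rectangles.\<close>
  have eq: "distr M (F (ennreal s)) (\<lambda>\<omega>. \<omega>) \<Otimes>\<^sub>M distr M borel \<Delta>
      = distr M (F (ennreal s) \<Otimes>\<^sub>M borel) (\<lambda>\<omega>. (\<omega>, \<Delta> \<omega>))"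
  proof (rule pair_measure_eqI)
    fix A B assume "A \<in> sets (distr M (F (ennreal s)) (\<lambda>\<omega>. \<omega>))" "B \<in> sets (distr M borel \<Delta>)"
    then have A: "A \<in> sets (F (ennreal s))" and B: "B \<in> sets borel" by auto
    have "A \<inter> space M = A"
      using sets.sets_into_space[OF A] by auto
    moreover have "(\<lambda>\<omega>. (\<omega>, \<Delta> \<omega>)) -` (A \<times> B) \<inter> space M = A \<inter> (\<Delta> -` B \<inter> space M)"
      using sets.sets_into_space[OF A] by auto
    moreover have "prob (A \<inter> (\<Delta> -` B \<inter> space M)) = prob A * prob (\<Delta> -` B \<inter> space M)"
      using B by (intro indep_setD[OF ind A]) auto
    ultimately show "emeasure (distr M (F (ennreal s)) (\<lambda>\<omega>. \<omega>)) A * emeasure (distr M borel \<Delta>) B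
        = emeasure (distr M (F (ennreal s) \<Otimes>\<^sub>M borel) (\<lambda>\<omega>. (\<omega>, \<Delta> \<omega>))) (A \<times> B)"
      using A B pair idF by (simp add: emeasure_distr emeasure_eq_measure ennreal_mult)
  qed (auto intro: P.sigma_finite_measure_axioms D.sigma_finite_measure_axioms cong: sets_pair_measure_cong)
  have dd: "distr M borel \<Delta> = density lborel (normal_density 0 (sqrt (t - s)))"
    using distributed_distr_eq_density[OF dist] by (simp cong: distr_cong)
  note h [measurable]
  have "(\<integral>\<^sup>+\<omega>. h (\<omega>, \<Delta> \<omega>) \<partial>M) = (\<integral>\<^sup>+z. h z \<partial>distr M (F (ennreal s) \<Otimes>\<^sub>M borel) (\<lambda>\<omega>. (\<omega>, \<Delta> \<omega>)))"
    by (simp add: nn_integral_distr[OF pair] h)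
  also have "\<dots> = (\<integral>\<^sup>+\<omega>. (\<integral>\<^sup>+y. h (\<omega>, y) \<partial>distr M borel \<Delta>) \<partial>distr M (F (ennreal s)) (\<lambda>\<omega>. \<omega>))"
    unfolding eq[symmetric]
    by (subst D.nn_integral_fst[symmetric]) (auto simp: cong: measurable_cong_sets)
  also have "\<dots> = (\<integral>\<^sup>+\<omega>. (\<integral>\<^sup>+y. h (\<omega>, y) \<partial>distr M borel \<Delta>) \<partial>M)"
    by (rule nn_integral_distr[OF idF]) (auto intro!: D.borel_measurable_nn_integral_fst)
  also have "\<dots> = (\<integral>\<^sup>+\<omega>. (\<integral>\<^sup>+y. h (\<omega>, y) * ennreal (normal_density 0 (sqrt (t - s)) y) \<partial>lborel) \<partial>M)"
    unfolding dd
    by (intro nn_integral_cong, subst nn_integral_density) (auto simp: mult.commute)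
  finally show ?thesis unfolding \<Delta>_def .
qed

section \<open>Exponentials and squares of sums over a partition\<close>

context
  fixes n :: nat and q :: "nat \<Rightarrow> real" and b :: "nat \<Rightarrow> 'a \<Rightarrow> real"
  assumes q0: "0 \<le> q 0" and q_mono: "\<And>i. i < n \<Longrightarrow> q i \<le> q (Suc i)"
    and b: "\<And>i. i < n \<Longrightarrow> q i < q (Suc i) \<Longrightarrow> b i \<in> borel_measurable (F (ennreal (q i)))"
begin

lemma partition_le: "i \<le> j \<Longrightarrow> j \<le> n \<Longrightarrow> q i \<le> q j"
proof (induction j rule: dec_induct)
  case (step j)
  then show ?case using q_mono[of j] by simp
qed simp

lemma partition_nonneg: "i \<le> n \<Longrightarrow> 0 \<le> q i"
  using partition_le[of 0 i] q0 by simp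

text \<open>The coefficient of a cell of length 0 may be unknown at that time, because a grid
  clipped at a time still carries the later coefficients. Such a term has to vanish by itself, which
  is what \<open>zero\<close> provides.\<close>

lemma measurable_partition_term:
  fixes \<phi> :: "real \<times> real \<Rightarrow> real"
  assumes "i < j" "j \<le> n" and [measurable]: "\<phi> \<in> borel_measurable (borel \<Otimes>\<^sub>M borel)"
    and zero: "\<And>x. q (Suc i) = q i \<Longrightarrow> \<phi> (x, 0) = 0"
  shows "(\<lambda>\<omega>. \<phi> (b i \<omega>, w (q (Suc i)) \<omega> - w (q i) \<omega>)) \<in> borel_measurable (F (ennreal (q j)))"
proof (cases "q i < q (Suc i)")
  case True
  have [measurable]: "b i \<in> borel_measurable (F (ennreal (q j)))"
    using assms True by (intro F_mono[OF _ b]) (auto intro: ennreal_leI partition_le less_imp_le)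
  have [measurable]: "w (q (Suc i)) \<in> borel_measurable (F (ennreal (q j)))"
      "w (q i) \<in> borel_measurable (F (ennreal (q j)))"
    using assms by (intro measurable_w_F ennreal_leI partition_le partition_nonneg; simp)+
  show ?thesis by measurable
next
  case False
  then have "q (Suc i) = q i" using assms q_mono[of i] by auto
  then show ?thesis by (simp add: zero)
qed

text \<open>Induction on the number of cells: given the past of its left end, the last factor has
  mean 1. The weight \<open>P\<close> collects everything known at the start of the grid.\<close>

lemma nn_integral_exp_grid:
  assumes P: "P \<in> borel_measurable (F (ennreal (q 0)))"
  shows "(\<integral>\<^sup>+\<omega>. P \<omega> * ennreal (exp (\<Sum>i<n. - b i \<omega> * (w (q (Suc i)) \<omega> - w (q i) \<omega>)
      - (b i \<omega>)\<^sup>2 / 2 * (q (Suc i) - q i))) \<partial>M) = (\<integral>\<^sup>+\<omega>. P \<omega> \<partial>M)"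
proof -
  define e where "e i \<omega> = - b i \<omega> * (w (q (Suc i)) \<omega> - w (q i) \<omega>) - (b i \<omega>)\<^sup>2 / 2 * (q (Suc i) - q i)" for i \<omega>
  have e_meas: "e i \<in> borel_measurable (F (ennreal (q j)))" if "i < j" "j \<le> n" for i j
    using measurable_partition_term[OF that, of "\<lambda>(x, y). - x * y - x\<^sup>2 / 2 * (q (Suc i) - q i)"]
    by (simp add: e_def[abs_def])
  have "(\<integral>\<^sup>+\<omega>. P \<omega> * ennreal (exp (\<Sum>i<j. e i \<omega>)) \<partial>M) = (\<integral>\<^sup>+\<omega>. P \<omega> \<partial>M)" if "j \<le> n" for j
    using that
  proof (induction j)
    case (Suc j)
    show ?case
    proof (cases "q j < q (Suc j)")
      case True
      \<comment> \<open>Past and increment are separated: the first argument carries the weight and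
        the earlier factors, \<open>y\<close> stands for the last increment.\<close>
      define h where "h = (\<lambda>(\<omega>, y). P \<omega> * ennreal (exp (\<Sum>i<j. e i \<omega>)) *
        ennreal (exp (- b j \<omega> * y - (b j \<omega>)\<^sup>2 / 2 * (q (Suc j) - q j))))"
      have [measurable]: "P \<in> borel_measurable (F (ennreal (q j)))"
        using Suc.prems by (intro F_mono[OF ennreal_leI P] partition_le) auto
      have [measurable]: "b j \<in> borel_measurable (F (ennreal (q j)))"
        using Suc.prems True by (intro b) auto
      have [measurable]: "i < j \<Longrightarrow> e i \<in> borel_measurable (F (ennreal (q j)))" for i
        using Suc.prems by (intro e_meas) auto
      have sm [measurable]: "(\<lambda>\<omega>. \<Sum>i<j. e i \<omega>) \<in> borel_measurable (F (ennreal (q j)))"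
        by (intro borel_measurable_sum) auto
      have h: "h \<in> borel_measurable (F (ennreal (q j)) \<Otimes>\<^sub>M borel)"
        unfolding h_def by measurable
      have "(\<integral>\<^sup>+\<omega>. P \<omega> * ennreal (exp (\<Sum>i<Suc j. e i \<omega>)) \<partial>M) = (\<integral>\<^sup>+\<omega>. h (\<omega>, w (q (Suc j)) \<omega> - w (q j) \<omega>) \<partial>M)"
        by (simp add: h_def exp_add ennreal_mult mult.assoc e_def[of j])
      also have "\<dots> = (\<integral>\<^sup>+\<omega>. (\<integral>\<^sup>+y. h (\<omega>, y) * ennreal (normal_density 0 (sqrt (q (Suc j) - q j)) y) \<partial>lborel) \<partial>M)"
        using Suc.prems by (intro nn_integral_increment partition_nonneg True h) auto
      also have "\<dots> = (\<integral>\<^sup>+\<omega>. P \<omega> * ennreal (exp (\<Sum>i<j. e i \<omega>)) \<partial>M)"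
      proof (rule nn_integral_cong)
        fix \<omega>
        have "(\<integral>\<^sup>+y. h (\<omega>, y) * ennreal (normal_density 0 (sqrt (q (Suc j) - q j)) y) \<partial>lborel)
            = (\<integral>\<^sup>+y. (P \<omega> * ennreal (exp (\<Sum>i<j. e i \<omega>))) *
                (ennreal (exp (- b j \<omega> * y - (b j \<omega>)\<^sup>2 / 2 * (q (Suc j) - q j)))
                 * ennreal (normal_density 0 (sqrt (q (Suc j) - q j)) y)) \<partial>lborel)"
          by (simp add: h_def mult.assoc)
        also have "\<dots> = P \<omega> * ennreal (exp (\<Sum>i<j. e i \<omega>)) * 1"
          using True by (subst nn_integral_cmult, simp, subst nn_integral_normal_density_exp) auto
        finally show "(\<integral>\<^sup>+y. h (\<omega>, y) * ennreal (normal_density 0 (sqrt (q (Suc j) - q j)) y) \<partial>lborel)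
            = P \<omega> * ennreal (exp (\<Sum>i<j. e i \<omega>))" by simp
      qed
      finally show ?thesis using Suc by simp
    next
      case False
      then have "q (Suc j) = q j" using Suc.prems q_mono[of j] by auto
      then have "e j \<omega> = 0" for \<omega> by (simp add: e_def)
      then show ?thesis using Suc by simp
    qed
  qed simp
  from this[of n] show ?thesis by (simp add: e_def)
qed

text \<open>The Ito isometry on a partition: given the past, the last increment has mean 0 and its
  variance is the cell length, so the cross terms disappear.\<close>

lemma nn_integral_grid_square:
  "(\<integral>\<^sup>+\<omega>. ennreal ((\<Sum>i<n. b i \<omega> * (w (q (Suc i)) \<omega> - w (q i) \<omega>))\<^sup>2) \<partial>M)
    = (\<integral>\<^sup>+\<omega>. ennreal (\<Sum>i<n. (b i \<omega>)\<^sup>2 * (q (Suc i) - q i)) \<partial>M)"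
proof -
  define e where "e i \<omega> = b i \<omega> * (w (q (Suc i)) \<omega> - w (q i) \<omega>)" for i \<omega>
  define d where "d i \<omega> = (b i \<omega>)\<^sup>2 * (q (Suc i) - q i)" for i \<omega>
  have ed_meas: "e i \<in> borel_measurable (F (ennreal (q j)))" "d i \<in> borel_measurable (F (ennreal (q j)))"
    if "i < j" "j \<le> n" for i j
    using measurable_partition_term[OF that, of "\<lambda>(x, y). x * y"]
      measurable_partition_term[OF that, of "\<lambda>(x, y). x\<^sup>2 * (q (Suc i) - q i)"]
    by (simp_all add: e_def[abs_def] d_def[abs_def])
  have d_nonneg: "i < n \<Longrightarrow> 0 \<le> d i \<omega>" for i \<omega>
    using q_mono[of i] by (simp add: d_def)
  have "(\<integral>\<^sup>+\<omega>. ennreal ((\<Sum>i<j. e i \<omega>)\<^sup>2) \<partial>M) = (\<integral>\<^sup>+\<omega>. ennreal (\<Sum>i<j. d i \<omega>) \<partial>M)" if "j \<le> n" for j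
    using that
  proof (induction j)
    case (Suc j)
    show ?case
    proof (cases "q j < q (Suc j)")
      case True
      define S where "S \<omega> = (\<Sum>i<j. e i \<omega>)" for \<omega>
      define h where "h = (\<lambda>(\<omega>, y). ennreal ((S \<omega> + b j \<omega> * y)\<^sup>2))"
      have [measurable]: "b j \<in> borel_measurable (F (ennreal (q j)))"
        using Suc.prems True by (intro b) auto
      have S [measurable]: "S \<in> borel_measurable (F (ennreal (q j)))"
        unfolding S_def[abs_def] using Suc.prems by (intro borel_measurable_sum ed_meas) auto
      have h: "h \<in> borel_measurable (F (ennreal (q j)) \<Otimes>\<^sub>M borel)"
        unfolding h_def by measurable
      have [measurable]: "S \<in> borel_measurable M" "d j \<in> borel_measurable M"
        "(\<lambda>\<omega>. \<Sum>i<j. d i \<omega>) \<in> borel_measurable M"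
        using F_imp_M[OF S] F_imp_M[OF ed_meas(2)[of _ "Suc j"]] Suc.prems by (auto intro!: borel_measurable_sum)
      have "(\<integral>\<^sup>+\<omega>. ennreal ((\<Sum>i<Suc j. e i \<omega>)\<^sup>2) \<partial>M) = (\<integral>\<^sup>+\<omega>. h (\<omega>, w (q (Suc j)) \<omega> - w (q j) \<omega>) \<partial>M)"
        by (simp add: h_def S_def e_def[of j])
      also have "\<dots> = (\<integral>\<^sup>+\<omega>. (\<integral>\<^sup>+y. h (\<omega>, y) * ennreal (normal_density 0 (sqrt (q (Suc j) - q j)) y) \<partial>lborel) \<partial>M)"
        using Suc.prems by (intro nn_integral_increment partition_nonneg True h) auto
      also have "\<dots> = (\<integral>\<^sup>+\<omega>. ennreal ((S \<omega>)\<^sup>2) + ennreal (d j \<omega>) \<partial>M)"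
        using True d_nonneg[of j] Suc.prems
        by (intro nn_integral_cong) (simp add: h_def nn_integral_normal_density_square d_def flip: ennreal_plus)
      also have "\<dots> = (\<integral>\<^sup>+\<omega>. ennreal (\<Sum>i<j. d i \<omega>) \<partial>M) + (\<integral>\<^sup>+\<omega>. ennreal (d j \<omega>) \<partial>M)"
        using Suc by (subst nn_integral_add) (auto simp flip: S_def)
      also have "\<dots> = (\<integral>\<^sup>+\<omega>. ennreal (\<Sum>i<Suc j. d i \<omega>) \<partial>M)"
        using d_nonneg Suc.prems
        by (subst nn_integral_add[symmetric]) (auto intro!: nn_integral_cong ennreal_plus[symmetric] sum_nonneg)
      finally show ?thesis .
    next
      case False
      then have "q (Suc j) = q j" using Suc.prems q_mono[of j] by auto
      then have "e j \<omega> = 0" "d j \<omega> = 0" for \<omega> by (auto simp: e_def d_def)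
      then show ?thesis using Suc by simp
    qed
  qed simp
  from this[of n] show ?thesis by (simp add: e_def d_def)
qed

end

end

section \<open>Pathwise time integrals and simple integrands\<close>

text \<open>The interval is \<open>(0, t]\<close>: controls are predictable and constrained at
  positive times only, so the value of \<open>f\<close> at 0 must not enter.\<close>

definition time_integral :: "(real \<Rightarrow> 'a \<Rightarrow> real) \<Rightarrow> real \<Rightarrow> 'a \<Rightarrow> real" where
  "time_integral f t \<omega> = (\<integral>s. (if 0 < s \<and> s \<le> t then f s \<omega> else 0) \<partial>lborel)"

lemma time_integral_cong:
  "(\<And>s. 0 < s \<Longrightarrow> s \<le> t \<Longrightarrow> f s \<omega> = g s \<omega>) \<Longrightarrow> time_integral f t \<omega> = time_integral g t \<omega>"
  unfolding time_integral_def by (intro Bochner_Integration.integral_cong) auto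

lemma indicator_min_interval:
  "indicator {min a u<..min b u} r = (if r \<le> u then indicator {a<..b} r else (0::real))" for r :: real
  by (auto simp: indicator_def)

text \<open>The cells are disjoint, so at most one term of the sum survives, and
  \<open>\<phi> 0 = 0\<close> covers times outside all cells. Truncating or squaring the
  coefficients thus truncates or squares the integrand.\<close>

lemma simple_value_comp:
  fixes p :: "nat \<Rightarrow> real"
  assumes mono: "\<And>i. i < n \<Longrightarrow> p i \<le> p (Suc i)" and "\<phi> 0 = (0::real)"
  shows "simple_value n p (\<lambda>i \<omega>. \<phi> (a i \<omega>)) r \<omega> = \<phi> (simple_value n p a r \<omega>)"
proof (cases "\<exists>i<n. r \<in> {p i<..p (Suc i)}")
  case True
  then obtain i where i: "i < n" "r \<in> {p i<..p (Suc i)}" by auto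
  have le: "p j \<le> p k" if "j \<le> k" "k \<le> n" for j k
    using that
  proof (induction k rule: dec_induct)
    case (step k)
    then show ?case using mono[of k] by simp
  qed simp
  have zero: "indicator {p j<..p (Suc j)} r = (0::real)" if "j < n" "j \<noteq> i" for j
    using i le[of "Suc j" i] le[of "Suc i" j] that by (cases "j < i") (auto simp: indicator_def)
  have "(\<Sum>j<n. c j * indicator {p j<..p (Suc j)} r) = c i" for c :: "nat \<Rightarrow> real"
  proof -
    have "(\<Sum>j<n. c j * indicator {p j<..p (Suc j)} r) = (\<Sum>j<n. if j = i then c j else 0)"
      using zero i by (intro sum.cong) (auto simp: indicator_def)
    also have "\<dots> = c i" using i by simp
    finally show ?thesis .
  qed
  then show ?thesis by (simp add: simple_value_def)
next
  case False
  then have "(\<Sum>j<n. c j * indicator {p j<..p (Suc j)} r) = 0" for c :: "nat \<Rightarrow> real"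
    by (intro sum.neutral) (auto simp: indicator_def)
  then show ?thesis by (simp add: simple_value_def assms(2))
qed

lemma has_bochner_integral_simple_value:
  assumes p0: "0 \<le> p 0" and mono: "\<And>i. i < n \<Longrightarrow> p i \<le> p (Suc i)" and "0 \<le> u"
  shows "has_bochner_integral lborel (\<lambda>s. if 0 < s \<and> s \<le> u then simple_value n p c s \<omega> else 0)
    (\<Sum>i<n. c i \<omega> * (min (p (Suc i)) u - min (p i) u))"
proof -
  have pos: "0 \<le> p i" if "i \<le> n" for i
    using that
  proof (induction i)
    case (Suc i)
    then show ?case using mono[of i] by simp
  qed (rule p0)
  have eq: "(if 0 < s \<and> s \<le> u then simple_value n p c s \<omega> else 0)
      = (\<Sum>i<n. c i \<omega> * indicator {min (p i) u<..min (p (Suc i)) u} s)" for s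
  proof (cases "0 < s")
    case True
    then show ?thesis
      by (simp add: simple_value_def indicator_min_interval)
  next
    case False
    have "indicator {min (p i) u<..min (p (Suc i)) u} s = (0::real)" if "i < n" for i
      using False pos[of i] that \<open>0 \<le> u\<close> by (auto simp: indicator_def)
    then show ?thesis using False by (auto intro!: sum.neutral)
  qed
  show ?thesis
    unfolding eq
  proof (intro has_bochner_integral_sum has_bochner_integral_mult_right)
    fix i assume "i \<in> {..<n}"
    then have "min (p i) u \<le> min (p (Suc i)) u"
      using mono[of i] by auto
    then show "has_bochner_integral lborel (indicator {min (p i) u<..min (p (Suc i)) u})
        (min (p (Suc i)) u - min (p i) u)"
      by (simp add: has_bochner_integral_iff)
  qed
qed

section \<open>Progressive measurability\<close>

context filtered_brownian_motion
begin

text \<open>Joint measurability for each \<open>F t\<close> separately is what makes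
  \<open>time_integral f t\<close> measurable for \<open>F t\<close> rather than only for
  \<open>M\<close>.\<close>

definition progressive :: "(real \<Rightarrow> 'a \<Rightarrow> real) \<Rightarrow> bool" where
  "progressive f \<longleftrightarrow> (\<forall>t\<ge>0. (\<lambda>(s, \<omega>). if 0 < s \<and> s \<le> t then f s \<omega> else 0)
     \<in> borel_measurable (lborel \<Otimes>\<^sub>M F (ennreal t)))"

lemma progressiveD:
  "progressive f \<Longrightarrow> 0 \<le> t \<Longrightarrow>
    (\<lambda>(s, \<omega>). if 0 < s \<and> s \<le> t then f s \<omega> else 0) \<in> borel_measurable (lborel \<Otimes>\<^sub>M F (ennreal t))"
  by (simp add: progressive_def)

lemma progressive_M:
  assumes "progressive f" "0 \<le> t"
  shows "(\<lambda>(s, \<omega>). if 0 < s \<and> s \<le> t then f s \<omega> else 0) \<in> borel_measurable (lborel \<Otimes>\<^sub>M M)"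
proof -
  have [measurable]: "(\<lambda>\<omega>. \<omega>) \<in> measurable M (F (ennreal t))"
    using sets_F_le by (auto simp: measurable_def)
  have "(\<lambda>z. (fst z, snd z)) \<in> measurable (lborel \<Otimes>\<^sub>M M) (lborel \<Otimes>\<^sub>M F (ennreal t))"
    by (rule measurable_Pair) (auto intro: measurable_compose[OF measurable_snd])
  from measurable_compose[OF this progressiveD[OF assms]] show ?thesis
    by (simp add: case_prod_beta')
qed

lemma progressive_section:
  assumes "progressive f" "0 \<le> t" "\<omega> \<in> space M"
  shows "(\<lambda>s. if 0 < s \<and> s \<le> t then f s \<omega> else 0) \<in> borel_measurable lborel"
proof -
  have "(\<lambda>s. (s, \<omega>)) \<in> measurable lborel (lborel \<Otimes>\<^sub>M F (ennreal t))"
    using assms(3) by (intro measurable_Pair) auto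
  from measurable_compose[OF this progressiveD[OF assms(1,2)]] show ?thesis by simp
qed

lemma progressive_compose:
  assumes "progressive f" and [measurable]: "\<phi> \<in> borel_measurable borel"
  shows "progressive (\<lambda>s \<omega>. \<phi> (f s \<omega>))"
  unfolding progressive_def
proof (intro allI impI)
  fix t :: real assume "0 \<le> t"
  note [measurable] = progressiveD[OF assms(1) this, unfolded case_prod_beta']
  \<comment> \<open>The inner \<open>if\<close> presents \<open>f\<close> through its cut-off
    version, the one known to be measurable; the outer \<open>if\<close> restores the value 0 off
    the interval, where \<open>\<phi> 0\<close> may be different.\<close>
  have "(\<lambda>z. if 0 < fst z \<and> fst z \<le> t then \<phi> (if 0 < fst z \<and> fst z \<le> t then f (fst z) (snd z) else 0) else 0)
      \<in> borel_measurable (lborel \<Otimes>\<^sub>M F (ennreal t))"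
    by measurable
  then show "(\<lambda>(s, \<omega>). if 0 < s \<and> s \<le> t then \<phi> (f s \<omega>) else 0) \<in> borel_measurable (lborel \<Otimes>\<^sub>M F (ennreal t))"
    by (rule measurable_cong[THEN iffD1, rotated]) auto
qed

lemma integrable_time:
  assumes "progressive f" "0 \<le> t" "\<omega> \<in> space M" and C: "\<And>s. 0 < s \<Longrightarrow> \<bar>f s \<omega>\<bar> \<le> C"
  shows "integrable lborel (\<lambda>s. if 0 < s \<and> s \<le> t then f s \<omega> else 0)"
proof (rule Bochner_Integration.integrable_bound)
  show "integrable lborel (\<lambda>s. C * indicator {0<..t} s)"
    using assms(2) by (intro integrable_mult_right) auto
  show "AE s in lborel. norm (if 0 < s \<and> s \<le> t then f s \<omega> else 0) \<le> norm (C * indicator {0<..t} s :: real)"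
  proof (rule AE_I2)
    fix s
    show "norm (if 0 < s \<and> s \<le> t then f s \<omega> else 0) \<le> norm (C * indicator {0<..t} s :: real)"
      using C[of s] by (auto simp: indicator_def)
  qed
qed (rule progressive_section[OF assms(1-3)])

lemma measurable_time_integral:
  assumes "progressive f" "0 \<le> t"
  shows "time_integral f t \<in> borel_measurable (F (ennreal t))"
  unfolding time_integral_def[abs_def]
  using measurable_pair_swap[OF progressiveD[OF assms]]
  by (intro lborel.borel_measurable_lebesgue_integral) (simp add: case_prod_beta' cong: if_cong)

lemma time_integral_lipschitz:
  assumes "progressive f" "\<omega> \<in> space M" and C: "\<And>s. 0 < s \<Longrightarrow> \<bar>f s \<omega>\<bar> \<le> C" and "0 \<le> s" "s \<le> t"
  shows "\<bar>time_integral f t \<omega> - time_integral f s \<omega>\<bar> \<le> C * (t - s)"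
proof -
  have int: "integrable lborel (\<lambda>r. if 0 < r \<and> r \<le> u then f r \<omega> else 0)" if "0 \<le> u" for u
    using assms that by (intro integrable_time)
  have "time_integral f t \<omega> - time_integral f s \<omega>
      = (\<integral>r. (if 0 < r \<and> r \<le> t then f r \<omega> else 0) - (if 0 < r \<and> r \<le> s then f r \<omega> else 0) \<partial>lborel)"
    using assms unfolding time_integral_def by (intro Bochner_Integration.integral_diff[symmetric] int) auto
  also have "\<bar>\<dots>\<bar> \<le> (\<integral>r. C * indicator {s<..t} r \<partial>lborel)"
    unfolding real_norm_def[symmetric]
  proof (rule Bochner_Integration.integral_norm_bound_integral)
    show "integrable lborel (\<lambda>r. (if 0 < r \<and> r \<le> t then f r \<omega> else 0) - (if 0 < r \<and> r \<le> s then f r \<omega> else 0))"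
      using assms by (intro Bochner_Integration.integrable_diff int) auto
    show "integrable lborel (\<lambda>r. C * indicator {s<..t} r)"
      using assms(5) by (intro integrable_mult_right) auto
  qed (use assms in \<open>auto simp: indicator_def\<close>)
  also have "\<dots> = C * (t - s)" using assms(5) by simp
  finally show ?thesis .
qed

lemma continuous_time_integral:
  assumes "progressive f" "\<omega> \<in> space M" and C: "\<And>s. 0 < s \<Longrightarrow> \<bar>f s \<omega>\<bar> \<le> C"
  shows "continuous_on {0..} (\<lambda>t. time_integral f t \<omega>)"
proof (rule lipschitz_on_continuous_on)
  show "C-lipschitz_on {0..} (\<lambda>t. time_integral f t \<omega>)"
  proof (rule lipschitz_onI)
    fix s t :: real assume "s \<in> {0..}" "t \<in> {0..}"
    then show "dist (time_integral f s \<omega>) (time_integral f t \<omega>) \<le> C * dist s t"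
      using time_integral_lipschitz[OF assms, of s t] time_integral_lipschitz[OF assms, of t s]
      by (cases "s \<le> t") (auto simp: dist_real_def abs_minus_commute)
  qed (use C[of 1] in simp)
qed

lemma measurable_simple_value:
  assumes "simple_integrand F n p a"
  shows "(\<lambda>(s, \<omega>). simple_value n p a s \<omega>) \<in> borel_measurable (lborel \<Otimes>\<^sub>M M)"
proof -
  have [measurable]: "i < n \<Longrightarrow> a i \<in> borel_measurable M" for i
    using assms by (auto simp: simple_integrand_def intro: F_imp_M)
  have [measurable]: "(\<lambda>s. indicator {p i<..p (Suc i)} s :: real) \<in> borel_measurable borel" for i
    by measurable
  have "(\<lambda>z. \<Sum>i<n. a i (snd z) * indicator {p i<..p (Suc i)} (fst z)) \<in> borel_measurable (lborel \<Otimes>\<^sub>M M)"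
    by (intro borel_measurable_sum borel_measurable_times) measurable
  then show ?thesis by (simp add: simple_value_def case_prod_beta')
qed

end

section \<open>Exponential martingales of simple integrals\<close>

text \<open>The quadratic variation of \<open>simple_integral\<close>.\<close>

definition simple_variation ::
  "nat \<Rightarrow> (nat \<Rightarrow> real) \<Rightarrow> (nat \<Rightarrow> 'a \<Rightarrow> real) \<Rightarrow> real \<Rightarrow> 'a \<Rightarrow> real" where
  "simple_variation n p a t \<omega> = (\<Sum>i<n. (a i \<omega>)\<^sup>2 * (min (p (Suc i)) t - min (p i) t))"

lemma simple_integrandD:
  assumes "simple_integrand F n p a"
  shows "0 \<le> p 0" "\<And>i. i < n \<Longrightarrow> p i \<le> p (Suc i)"
    "\<And>i. i < n \<Longrightarrow> a i \<in> borel_measurable (F (ennreal (p i)))"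
  using assms by (auto simp: simple_integrand_def)

lemma simple_integrand_grid_nonneg:
  assumes "simple_integrand F n p a"
  shows "i \<le> n \<Longrightarrow> 0 \<le> p i"
proof (induction i)
  case (Suc i)
  then show ?case using simple_integrandD(2)[OF assms, of i] by simp
qed (use simple_integrandD(1)[OF assms] in simp)

lemma simple_variation_le:
  assumes "simple_integrand F n p a" "0 \<le> u" and C: "\<And>i. i < n \<Longrightarrow> 0 \<le> a i \<omega> \<and> a i \<omega> \<le> C"
  shows "simple_variation n p a u \<omega> \<le> C\<^sup>2 * u"
proof -
  have "simple_variation n p a u \<omega> \<le> (\<Sum>i<n. C\<^sup>2 * (min (p (Suc i)) u - min (p i) u))"
    unfolding simple_variation_def
  proof (rule sum_mono)
    fix i assume "i \<in> {..<n}"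
    then have i: "i < n" by simp
    have "p i \<le> p (Suc i)" using simple_integrandD(2)[OF assms(1) i] .
    moreover have "(a i \<omega>)\<^sup>2 \<le> C\<^sup>2" using C[OF i] by (auto intro: power_mono)
    ultimately show "(a i \<omega>)\<^sup>2 * (min (p (Suc i)) u - min (p i) u) \<le> C\<^sup>2 * (min (p (Suc i)) u - min (p i) u)"
      by (intro mult_right_mono) auto
  qed
  also have "\<dots> = C\<^sup>2 * (min (p n) u - min (p 0) u)"
    by (simp add: sum_distrib_left[symmetric] sum_lessThan_telescope[of "\<lambda>i. min (p i) u"])
  also have "\<dots> \<le> C\<^sup>2 * u"
    using simple_integrandD(1)[OF assms(1)] assms(2) by (intro mult_left_mono) auto
  finally show ?thesis .
qed

context filtered_brownian_motion
begin

lemma measurable_simple: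
  assumes "simple_integrand F n p a" "0 \<le> u"
  shows "simple_integral w n p a u \<in> borel_measurable (F (ennreal u))"
    and "simple_variation n p a u \<in> borel_measurable (F (ennreal u))"
proof -
  have "(\<lambda>\<omega>. a i \<omega> * (w (min (p (Suc i)) u) \<omega> - w (min (p i) u) \<omega>)) \<in> borel_measurable (F (ennreal u)) \<and>
      (\<lambda>\<omega>. (a i \<omega>)\<^sup>2 * (min (p (Suc i)) u - min (p i) u)) \<in> borel_measurable (F (ennreal u))"
    if i: "i < n" for i
  proof (cases "p i \<le> u")
    case True
    have [measurable]: "a i \<in> borel_measurable (F (ennreal u))"
      using True by (intro F_mono[OF _ simple_integrandD(3)[OF assms(1) i]] ennreal_leI)
    have [measurable]: "w (min (p j) u) \<in> borel_measurable (F (ennreal u))" if "j \<le> n" for j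
      using simple_integrand_grid_nonneg[OF assms(1) that] assms(2)
      by (intro measurable_w_F ennreal_leI) auto
    have [measurable]: "w (min (p i) u) \<in> borel_measurable (F (ennreal u))"
      "w (min (p (Suc i)) u) \<in> borel_measurable (F (ennreal u))" using i by auto
    show ?thesis by simp
  next
    case False
    \<comment> \<open>A cell starting after \<open>u\<close> has a coefficient that may be unknown
      at \<open>u\<close>, but both clipped ends equal \<open>u\<close> and the term is 0.\<close>
    then have "min (p i) u = u" "min (p (Suc i)) u = u"
      using simple_integrandD(2)[OF assms(1) i] by auto
    then show ?thesis by simp
  qed
  then show "simple_integral w n p a u \<in> borel_measurable (F (ennreal u))"
    "simple_variation n p a u \<in> borel_measurable (F (ennreal u))"
    unfolding simple_integral_def[abs_def] simple_variation_def[abs_def]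
    by (auto intro!: borel_measurable_sum)
qed

text \<open>The exponential at \<open>t\<close> factors into the one at \<open>s\<close>, which
  joins the weight \<open>P\<close>, and a product over the grid clipped to \<open>[s, t]\<close>,
  which has mean 1 given the past.\<close>

lemma simple_exp_martingale:
  assumes sa: "simple_integrand F n p a" and st: "0 \<le> s" "s \<le> t"
    and P: "P \<in> borel_measurable (F (ennreal s))"
  shows "(\<integral>\<^sup>+\<omega>. P \<omega> * ennreal (exp (- \<theta> * simple_integral w n p a t \<omega> - \<theta>\<^sup>2 / 2 * simple_variation n p a t \<omega>)) \<partial>M)
    = (\<integral>\<^sup>+\<omega>. P \<omega> * ennreal (exp (- \<theta> * simple_integral w n p a s \<omega> - \<theta>\<^sup>2 / 2 * simple_variation n p a s \<omega>)) \<partial>M)"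
proof -
  define E where "E u \<omega> = exp (- \<theta> * simple_integral w n p a u \<omega> - \<theta>\<^sup>2 / 2 * simple_variation n p a u \<omega>)" for u \<omega>
  define q where "q i = max s (min (p i) t)" for i
  \<comment> \<open>Clipping at \<open>t\<close> splits into clipping at \<open>s\<close> and the
    increment along the grid clipped to \<open>[s, t]\<close>, wherever \<open>x\<close>
    lies.\<close>
  have incr: "f (min x t) = f (min x s) + (f (max s (min x t)) - f s)" for f :: "real \<Rightarrow> real" and x
    using st by (cases "x \<le> s") (auto simp: min_def max_def)
  have E: "E t \<omega> = E s \<omega> * exp (\<Sum>i<n. - (\<theta> * a i \<omega>) * (w (q (Suc i)) \<omega> - w (q i) \<omega>)
      - (\<theta> * a i \<omega>)\<^sup>2 / 2 * (q (Suc i) - q i))" for \<omega>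
  proof -
    have "simple_integral w n p a t \<omega> = simple_integral w n p a s \<omega>
        + (\<Sum>i<n. a i \<omega> * (w (q (Suc i)) \<omega> - w (q i) \<omega>))"
      unfolding simple_integral_def sum.distrib[symmetric] q_def
      by (intro sum.cong refl, subst (1 2) incr[of "\<lambda>u. w u \<omega>"]) (simp add: algebra_simps)
    moreover have "simple_variation n p a t \<omega> = simple_variation n p a s \<omega>
        + (\<Sum>i<n. (a i \<omega>)\<^sup>2 * (q (Suc i) - q i))"
      unfolding simple_variation_def sum.distrib[symmetric] q_def
      by (intro sum.cong refl, subst (1 2) incr[of "\<lambda>u. u"]) (simp add: algebra_simps)
    moreover have "(\<Sum>i<n. - (\<theta> * a i \<omega>) * (w (q (Suc i)) \<omega> - w (q i) \<omega>) - (\<theta> * a i \<omega>)\<^sup>2 / 2 * (q (Suc i) - q i))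
        = - \<theta> * (\<Sum>i<n. a i \<omega> * (w (q (Suc i)) \<omega> - w (q i) \<omega>)) - \<theta>\<^sup>2 / 2 * (\<Sum>i<n. (a i \<omega>)\<^sup>2 * (q (Suc i) - q i))"
      unfolding sum_distrib_left sum_subtractf[symmetric]
      by (intro sum.cong) (simp_all add: power_mult_distrib field_simps)
    ultimately show ?thesis
      unfolding E_def by (simp only: exp_add[symmetric]) (simp add: algebra_simps)
  qed
  have "(\<integral>\<^sup>+\<omega>. P \<omega> * ennreal (E t \<omega>) \<partial>M) = (\<integral>\<^sup>+\<omega>. (P \<omega> * ennreal (E s \<omega>)) *
      ennreal (exp (\<Sum>i<n. - (\<theta> * a i \<omega>) * (w (q (Suc i)) \<omega> - w (q i) \<omega>)
      - (\<theta> * a i \<omega>)\<^sup>2 / 2 * (q (Suc i) - q i))) \<partial>M)"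
    unfolding E by (simp add: ennreal_mult mult.assoc E_def)
  also have "\<dots> = (\<integral>\<^sup>+\<omega>. P \<omega> * ennreal (E s \<omega>) \<partial>M)"
  proof (rule nn_integral_exp_grid)
    show "0 \<le> q 0" using st by (auto simp: q_def)
    show "q i \<le> q (Suc i)" if "i < n" for i
      using simple_integrandD(2)[OF sa that] by (auto simp: q_def)
    show "(\<lambda>\<omega>. \<theta> * a i \<omega>) \<in> borel_measurable (F (ennreal (q i)))" if "i < n" "q i < q (Suc i)" for i
    proof -
      \<comment> \<open>A clipped cell of positive length has \<open>p i < t\<close>, so its left
        end is not before \<open>p i\<close> and \<open>a i\<close> is known there.\<close>
      have "p i \<le> q i"
        using that(2) by (auto simp: q_def min_def max_def split: if_splits)
      then have [measurable]: "a i \<in> borel_measurable (F (ennreal (q i)))"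
        by (intro F_mono[OF _ simple_integrandD(3)[OF sa that(1)]] ennreal_leI)
      show ?thesis by simp
    qed
    have [measurable]: "simple_integral w n p a s \<in> borel_measurable (F (ennreal s))"
      "simple_variation n p a s \<in> borel_measurable (F (ennreal s))" "P \<in> borel_measurable (F (ennreal s))"
      using measurable_simple[OF sa st(1)] P by auto
    have "(\<lambda>\<omega>. P \<omega> * ennreal (E s \<omega>)) \<in> borel_measurable (F (ennreal s))"
      unfolding E_def by measurable
    then show "(\<lambda>\<omega>. P \<omega> * ennreal (E s \<omega>)) \<in> borel_measurable (F (ennreal (q 0)))"
      by (rule F_mono[rotated]) (auto intro: ennreal_leI simp: q_def)
  qed
  finally show ?thesis by (simp add: E_def)
qed

text \<open>The square is the exponential with parameter \<open>2 * \<theta>\<close> times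
  \<open>exp (\<theta>^2 V)\<close>, with \<open>V\<close> the variation, and \<open>V\<close> is at
  most \<open>C^2 u\<close> for coefficients in \<open>[0, C]\<close>. The bound is the same for all
  such integrands, as the passage to the limit requires.\<close>

lemma nn_integral_simple_exp_square_le:
  assumes sa: "simple_integrand F n p a" and C: "\<And>i \<omega>. i < n \<Longrightarrow> 0 \<le> a i \<omega> \<and> a i \<omega> \<le> C" and "0 \<le> u"
  shows "(\<integral>\<^sup>+\<omega>. ennreal ((exp (- \<theta> * simple_integral w n p a u \<omega> - \<theta>\<^sup>2 / 2 * simple_variation n p a u \<omega>))\<^sup>2) \<partial>M)
    \<le> ennreal (exp (\<theta>\<^sup>2 * C\<^sup>2 * u))"
proof -
  let ?X = "simple_integral w n p a" and ?V = "simple_variation n p a"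
  have [measurable]: "?X u \<in> borel_measurable M" "?V u \<in> borel_measurable M"
    using measurable_simple[OF sa \<open>0 \<le> u\<close>] by (auto intro: F_imp_M)
  have zero: "?X 0 \<omega> = 0" "?V 0 \<omega> = 0" for \<omega>
    using simple_integrand_grid_nonneg[OF sa]
    by (auto simp: simple_integral_def simple_variation_def min_absorb2 intro!: sum.neutral)
  have "(exp (- \<theta> * ?X u \<omega> - \<theta>\<^sup>2 / 2 * ?V u \<omega>))\<^sup>2
      \<le> exp (- (2 * \<theta>) * ?X u \<omega> - (2 * \<theta>)\<^sup>2 / 2 * ?V u \<omega>) * exp (\<theta>\<^sup>2 * C\<^sup>2 * u)" for \<omega>
  proof -
    have "\<theta>\<^sup>2 * ?V u \<omega> \<le> \<theta>\<^sup>2 * (C\<^sup>2 * u)"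
      using C by (intro mult_left_mono simple_variation_le[OF sa \<open>0 \<le> u\<close>]) auto
    then show ?thesis
      by (simp flip: exp_add exp_of_nat_mult add: power2_eq_square exp_double[symmetric] algebra_simps)
  qed
  then have "(\<integral>\<^sup>+\<omega>. ennreal ((exp (- \<theta> * ?X u \<omega> - \<theta>\<^sup>2 / 2 * ?V u \<omega>))\<^sup>2) \<partial>M)
      \<le> (\<integral>\<^sup>+\<omega>. ennreal (exp (- (2 * \<theta>) * ?X u \<omega> - (2 * \<theta>)\<^sup>2 / 2 * ?V u \<omega>)) * ennreal (exp (\<theta>\<^sup>2 * C\<^sup>2 * u)) \<partial>M)"
    by (intro nn_integral_mono) (simp add: ennreal_mult[symmetric] ennreal_leI)
  also have "\<dots> = (\<integral>\<^sup>+\<omega>. 1 * ennreal (exp (- (2 * \<theta>) * ?X u \<omega> - (2 * \<theta>)\<^sup>2 / 2 * ?V u \<omega>)) \<partial>M) * ennreal (exp (\<theta>\<^sup>2 * C\<^sup>2 * u))"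
    by (subst nn_integral_multc) auto
  also have "(\<integral>\<^sup>+\<omega>. 1 * ennreal (exp (- (2 * \<theta>) * ?X u \<omega> - (2 * \<theta>)\<^sup>2 / 2 * ?V u \<omega>)) \<partial>M)
      = (\<integral>\<^sup>+\<omega>. 1 * ennreal (exp (- (2 * \<theta>) * ?X 0 \<omega> - (2 * \<theta>)\<^sup>2 / 2 * ?V 0 \<omega>)) \<partial>M)"
    using \<open>0 \<le> u\<close> by (intro simple_exp_martingale[OF sa]) auto
  also have "\<dots> = 1"
    by (simp add: zero emeasure_space_1)
  finally show ?thesis by simp
qed

end

section \<open>From simple integrands to the Ito integral\<close>

context filtered_brownian_motion
begin

context
  fixes H I :: "real \<Rightarrow> 'a \<Rightarrow> real" and C :: real
  assumes ito: "is_ito_integral M F w H I" and prog: "progressive H"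
    and bnd: "\<And>s \<omega>. 0 < s \<Longrightarrow> \<omega> \<in> space M \<Longrightarrow> 0 \<le> H s \<omega> \<and> H s \<omega> \<le> C"
begin

text \<open>The approximating integrands of an Ito integral may be truncated to the range of the
  integrand; this makes exponential moments uniformly bounded.\<close>

lemma ito_integral_bounded_approx:
  assumes st: "0 \<le> s" "0 \<le> t"
  shows "\<exists>n p b. (\<forall>k::nat. simple_integrand F (n k) (p k) (b k)) \<and>
    (\<forall>k i \<omega>. 0 \<le> b k i \<omega> \<and> b k i \<omega> \<le> C) \<and>
    (\<forall>u\<in>{s, t}. AE \<omega> in M. (\<lambda>k. simple_integral w (n k) (p k) (b k) u \<omega>) \<longlonglongrightarrow> I u \<omega>) \<and>
    (\<forall>u\<in>{s, t}. AE \<omega> in M. (\<lambda>k. simple_variation (n k) (p k) (b k) u \<omega>)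
      \<longlonglongrightarrow> time_integral (\<lambda>r \<omega>. (H r \<omega>)\<^sup>2) u \<omega>)"
proof -
  have C: "0 \<le> C" using bnd[of 1] not_empty by force
  \<comment> \<open>Projection onto \<open>[0, C]\<close>, which contains the values of
    \<open>H\<close>: no value is moved away from \<open>H\<close>, and none is moved by more than
    its distance to \<open>H\<close>.\<close>
  define cl where "cl x = min C (max 0 x)" for x :: real
  have cl: "0 \<le> cl x" "cl x \<le> C" "cl 0 = 0" for x using C by (auto simp: cl_def)
  have cl_near: "\<bar>cl x - y\<bar> \<le> \<bar>x - y\<bar>" "\<bar>x - cl x\<bar> \<le> \<bar>x - y\<bar>" if "0 \<le> y" "y \<le> C" for x y
    using that by (auto simp: cl_def)
  from ito obtain n p a where sa: "\<And>k::nat. simple_integrand F (n k) (p k) (a k)"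
    and conv_H: "\<And>t. 0 \<le> t \<Longrightarrow> (\<lambda>k. \<integral>\<^sup>+\<omega>. (\<integral>\<^sup>+s\<in>{0..t}. ennreal ((H s \<omega> - simple_value (n k) (p k) (a k) s \<omega>)\<^sup>2) \<partial>lborel) \<partial>M) \<longlonglongrightarrow> 0"
    and conv_I: "\<And>t. 0 \<le> t \<Longrightarrow> (\<lambda>k. \<integral>\<^sup>+\<omega>. ennreal ((I t \<omega> - simple_integral w (n k) (p k) (a k) t \<omega>)\<^sup>2) \<partial>M) \<longlonglongrightarrow> 0"
    and I_meas: "\<And>t. 0 \<le> t \<Longrightarrow> I t \<in> borel_measurable M"
    unfolding is_ito_integral_def by blast
  define b where "b k i \<omega> = cl (a k i \<omega>)" for k i \<omega>
  define sv where "sv k r \<omega> = simple_value (n k) (p k) (a k) r \<omega>" for k r \<omega>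
  define S where "S k = simple_integral w (n k) (p k) (a k)" for k
  define S' where "S' k = simple_integral w (n k) (p k) (b k)" for k
  define V' where "V' k = simple_variation (n k) (p k) (b k)" for k
  define V where "V = time_integral (\<lambda>r \<omega>. (H r \<omega>)\<^sup>2)"
  define D where "D k u \<omega> = (\<integral>\<^sup>+r. ennreal (if 0 < r \<and> r \<le> u then (H r \<omega> - sv k r \<omega>)\<^sup>2 else 0) \<partial>lborel)" for k u \<omega>
  note grid = simple_integrandD(1,2)[OF sa]
  have cl_meas [measurable]: "cl \<in> borel_measurable borel"
    unfolding cl_def[abs_def] by measurable
  have sb: "simple_integrand F (n k) (p k) (b k)" for k
    unfolding simple_integrand_def
  proof (intro conjI allI impI)
    fix i assume "i < n k"
    note [measurable] = simple_integrandD(3)[OF sa this]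
    show "b k i \<in> borel_measurable (F (ennreal (p k i)))" unfolding b_def[abs_def] by measurable
    show "\<exists>B. \<forall>\<omega>\<in>space (F (ennreal (p k i))). \<bar>b k i \<omega>\<bar> \<le> B"
      using cl by (intro exI[of _ C]) (auto simp: b_def)
  qed (use grid in auto)
  have S_meas: "S k u \<in> borel_measurable M" and S'_meas: "S' k u \<in> borel_measurable M" if "0 \<le> u" for k u
    using measurable_simple(1)[OF sa that] measurable_simple(1)[OF sb that]
    by (auto simp: S_def S'_def intro: F_imp_M)
  have D_eq: "(\<integral>\<^sup>+s\<in>{0..u}. ennreal ((H s \<omega> - simple_value (n k) (p k) (a k) s \<omega>)\<^sup>2) \<partial>lborel) = D k u \<omega>" for k u \<omega>
    unfolding D_def sv_def
  proof (rule nn_integral_cong_AE)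
    have "AE r in lborel. r \<noteq> (0::real)" by (rule AE_lborel_singleton)
    then show "AE r in lborel. ennreal ((H r \<omega> - simple_value (n k) (p k) (a k) r \<omega>)\<^sup>2) * indicator {0..u} r
        = ennreal (if 0 < r \<and> r \<le> u then (H r \<omega> - simple_value (n k) (p k) (a k) r \<omega>)\<^sup>2 else 0)"
      by eventually_elim (auto simp: indicator_def)
  qed
  have sec: "(\<lambda>(r, \<omega>). if 0 < r \<and> r \<le> u then (H r \<omega> - sv k r \<omega>)\<^sup>2 else 0) \<in> borel_measurable (lborel \<Otimes>\<^sub>M M)"
    if "0 \<le> u" for k u
  proof -
    note [measurable] = progressive_M[OF prog that, unfolded case_prod_beta']
      measurable_simple_value[OF sa[of k], unfolded case_prod_beta']
    have "(\<lambda>z. if 0 < fst z \<and> fst z \<le> u then ((if 0 < fst z \<and> fst z \<le> u then H (fst z) (snd z) else 0) - sv k (fst z) (snd z))\<^sup>2 else 0)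
        \<in> borel_measurable (lborel \<Otimes>\<^sub>M M)"
      unfolding sv_def by measurable
    then show ?thesis
      by (rule measurable_cong[THEN iffD1, rotated]) auto
  qed
  have sec_r: "(\<lambda>r. if 0 < r \<and> r \<le> u then (H r \<omega> - sv k r \<omega>)\<^sup>2 else 0) \<in> borel_measurable lborel"
    if "0 \<le> u" "\<omega> \<in> space M" for k u \<omega>
  proof -
    have "(\<lambda>r. (r, \<omega>)) \<in> measurable lborel (lborel \<Otimes>\<^sub>M M)"
      using that(2) by (intro measurable_Pair) auto
    from measurable_compose[OF this sec[OF that(1), of k]] show ?thesis by simp
  qed
  have D_meas: "D k u \<in> borel_measurable M" if "0 \<le> u" for k u
    unfolding D_def[abs_def]
    using measurable_pair_swap[OF sec[OF that, of k]]
    by (intro lborel.borel_measurable_nn_integral) (simp add: case_prod_beta' cong: if_cong)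
  \<comment> \<open>By the isometry the effect of truncation is the mean square of
    \<open>a - cl a\<close>, which is at most that of \<open>H - a\<close> and so tends to
    0.\<close>
  have SS': "(\<integral>\<^sup>+\<omega>. ennreal ((S k u \<omega> - S' k u \<omega>)\<^sup>2) \<partial>M) \<le> (\<integral>\<^sup>+\<omega>. D k u \<omega> \<partial>M)" if u: "0 \<le> u" for k u
  proof -
    define d where "d i \<omega> = a k i \<omega> - cl (a k i \<omega>)" for i \<omega>
    let ?q = "\<lambda>i. min (p k i) u"
    have "(\<integral>\<^sup>+\<omega>. ennreal ((S k u \<omega> - S' k u \<omega>)\<^sup>2) \<partial>M)
        = (\<integral>\<^sup>+\<omega>. ennreal ((\<Sum>i<n k. d i \<omega> * (w (?q (Suc i)) \<omega> - w (?q i) \<omega>))\<^sup>2) \<partial>M)"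
      by (simp add: S_def S'_def simple_integral_def b_def d_def sum_subtractf[symmetric] left_diff_distrib)
    also have "\<dots> = (\<integral>\<^sup>+\<omega>. ennreal (\<Sum>i<n k. (d i \<omega>)\<^sup>2 * (?q (Suc i) - ?q i)) \<partial>M)"
    proof (rule nn_integral_grid_square)
      show "0 \<le> ?q 0" using grid u by simp
      show "?q i \<le> ?q (Suc i)" if "i < n k" for i using grid(2)[OF that] by auto
      show "d i \<in> borel_measurable (F (ennreal (?q i)))" if "i < n k" "?q i < ?q (Suc i)" for i
      proof -
        have "?q i = p k i" using that(2) by auto
        with simple_integrandD(3)[OF sa that(1)] have [measurable]: "a k i \<in> borel_measurable (F (ennreal (?q i)))"
          by simp
        show ?thesis unfolding d_def[abs_def] by measurable
      qed
    qed
    also have "\<dots> \<le> (\<integral>\<^sup>+\<omega>. D k u \<omega> \<partial>M)"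
    proof (rule nn_integral_mono)
      fix \<omega> assume \<omega>: "\<omega> \<in> space M"
      have hb: "has_bochner_integral lborel (\<lambda>r. if 0 < r \<and> r \<le> u then simple_value (n k) (p k) (\<lambda>i \<omega>. (d i \<omega>)\<^sup>2) r \<omega> else 0)
          (\<Sum>i<n k. (d i \<omega>)\<^sup>2 * (?q (Suc i) - ?q i))"
        using grid u by (intro has_bochner_integral_simple_value)
      \<comment> \<open>The squared displacement \<open>(x - cl x)^2\<close> vanishes at 0, so it
        may be applied to the integrand instead of its coefficients.\<close>
      have svd: "simple_value (n k) (p k) (\<lambda>i \<omega>. (d i \<omega>)\<^sup>2) r \<omega> = (sv k r \<omega> - cl (sv k r \<omega>))\<^sup>2" for r
        unfolding d_def sv_def
        using simple_value_comp[of "n k" "p k" "\<lambda>x. (x - cl x)\<^sup>2" "a k" r \<omega>] grid cl by simp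
      have "ennreal (\<Sum>i<n k. (d i \<omega>)\<^sup>2 * (?q (Suc i) - ?q i))
          = (\<integral>\<^sup>+r. ennreal (if 0 < r \<and> r \<le> u then (sv k r \<omega> - cl (sv k r \<omega>))\<^sup>2 else 0) \<partial>lborel)"
        using hb unfolding svd
        by (subst nn_integral_eq_integral) (auto simp: has_bochner_integral_iff)
      also have "\<dots> \<le> D k u \<omega>"
        unfolding D_def
      proof (intro nn_integral_mono ennreal_leI)
        fix r
        show "(if 0 < r \<and> r \<le> u then (sv k r \<omega> - cl (sv k r \<omega>))\<^sup>2 else 0) \<le> (if 0 < r \<and> r \<le> u then (H r \<omega> - sv k r \<omega>)\<^sup>2 else 0)"
          using cl_near(2)[of "H r \<omega>" "sv k r \<omega>"] bnd[of r \<omega>] \<omega>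
          by (auto simp: abs_le_square_iff[symmetric] abs_minus_commute)
      qed
      finally show "ennreal (\<Sum>i<n k. (d i \<omega>)\<^sup>2 * (?q (Suc i) - ?q i)) \<le> D k u \<omega>" .
    qed
    finally show ?thesis .
  qed
  \<comment> \<open>All errors at both times are added up, so that a single subsequence serves them
    all.\<close>
  define g where "g k \<omega> = (\<Sum>u\<in>{s, t}. D k u \<omega> + ennreal ((I u \<omega> - S k u \<omega>)\<^sup>2) + ennreal ((S k u \<omega> - S' k u \<omega>)\<^sup>2))" for k \<omega>
  have st': "u \<in> {s, t} \<Longrightarrow> 0 \<le> u" for u using st by auto
  have summand: "(\<lambda>\<omega>. D k u \<omega> + ennreal ((I u \<omega> - S k u \<omega>)\<^sup>2) + ennreal ((S k u \<omega> - S' k u \<omega>)\<^sup>2)) \<in> borel_measurable M"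
    "(\<integral>\<^sup>+\<omega>. D k u \<omega> + ennreal ((I u \<omega> - S k u \<omega>)\<^sup>2) + ennreal ((S k u \<omega> - S' k u \<omega>)\<^sup>2) \<partial>M)
      = (\<integral>\<^sup>+\<omega>. D k u \<omega> \<partial>M) + (\<integral>\<^sup>+\<omega>. ennreal ((I u \<omega> - S k u \<omega>)\<^sup>2) \<partial>M)
        + (\<integral>\<^sup>+\<omega>. ennreal ((S k u \<omega> - S' k u \<omega>)\<^sup>2) \<partial>M)" if u: "u \<in> {s, t}" for k u
  proof -
    note [measurable] = D_meas[OF st'[OF u]] S_meas[OF st'[OF u]] S'_meas[OF st'[OF u]] I_meas[OF st'[OF u]]
    show "(\<lambda>\<omega>. D k u \<omega> + ennreal ((I u \<omega> - S k u \<omega>)\<^sup>2) + ennreal ((S k u \<omega> - S' k u \<omega>)\<^sup>2)) \<in> borel_measurable M"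
      by measurable
    show "(\<integral>\<^sup>+\<omega>. D k u \<omega> + ennreal ((I u \<omega> - S k u \<omega>)\<^sup>2) + ennreal ((S k u \<omega> - S' k u \<omega>)\<^sup>2) \<partial>M)
      = (\<integral>\<^sup>+\<omega>. D k u \<omega> \<partial>M) + (\<integral>\<^sup>+\<omega>. ennreal ((I u \<omega> - S k u \<omega>)\<^sup>2) \<partial>M)
        + (\<integral>\<^sup>+\<omega>. ennreal ((S k u \<omega> - S' k u \<omega>)\<^sup>2) \<partial>M)"
      by (subst nn_integral_add, measurable, subst nn_integral_add, measurable)
  qed
  have g_meas: "g k \<in> borel_measurable M" for k
    unfolding g_def[abs_def] by (intro borel_measurable_sum summand)
  have g_int: "(\<integral>\<^sup>+\<omega>. g k \<omega> \<partial>M) = (\<Sum>u\<in>{s, t}. (\<integral>\<^sup>+\<omega>. D k u \<omega> \<partial>M) + (\<integral>\<^sup>+\<omega>. ennreal ((I u \<omega> - S k u \<omega>)\<^sup>2) \<partial>M)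
      + (\<integral>\<^sup>+\<omega>. ennreal ((S k u \<omega> - S' k u \<omega>)\<^sup>2) \<partial>M))" for k
    unfolding g_def by (subst nn_integral_sum) (simp_all only: summand cong: sum.cong)
  have D_lim: "(\<lambda>k. \<integral>\<^sup>+\<omega>. D k u \<omega> \<partial>M) \<longlonglongrightarrow> 0" if "0 \<le> u" for u
    using conv_H[OF that] by (simp add: D_eq)
  have "(\<lambda>k. \<integral>\<^sup>+\<omega>. g k \<omega> \<partial>M) \<longlonglongrightarrow> (\<Sum>u\<in>{s, t}. 0 + 0 + 0)"
    unfolding g_int
  proof (intro tendsto_sum tendsto_add)
    fix u assume "u \<in> {s, t}"
    then have u: "0 \<le> u" by (rule st')
    show "(\<lambda>k. \<integral>\<^sup>+\<omega>. D k u \<omega> \<partial>M) \<longlonglongrightarrow> 0" by (rule D_lim[OF u])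
    show "(\<lambda>k. \<integral>\<^sup>+\<omega>. ennreal ((I u \<omega> - S k u \<omega>)\<^sup>2) \<partial>M) \<longlonglongrightarrow> 0" using conv_I[OF u] by (simp add: S_def)
    show "(\<lambda>k. \<integral>\<^sup>+\<omega>. ennreal ((S k u \<omega> - S' k u \<omega>)\<^sup>2) \<partial>M) \<longlonglongrightarrow> 0"
      by (rule tendsto_sandwich[OF _ _ tendsto_const D_lim[OF u]]) (use SS'[OF u] in \<open>simp_all add: always_eventually\<close>)
  qed
  then have "(\<lambda>k. \<integral>\<^sup>+\<omega>. g k \<omega> \<partial>M) \<longlonglongrightarrow> 0" by simp
  with g_meas obtain \<rho> where \<rho>: "AE \<omega> in M. (\<lambda>k. g (\<rho> k) \<omega>) \<longlonglongrightarrow> 0"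
    using AE_subseq_tendsto_0[of g M] by blast
  have parts: "(\<lambda>k. D (\<rho> k) u \<omega>) \<longlonglongrightarrow> 0" "(\<lambda>k. S' (\<rho> k) u \<omega>) \<longlonglongrightarrow> I u \<omega>"
    if g0: "(\<lambda>k. g (\<rho> k) \<omega>) \<longlonglongrightarrow> 0" and u: "u \<in> {s, t}" for \<omega> u
  proof -
    have le: "D k u \<omega> + ennreal ((I u \<omega> - S k u \<omega>)\<^sup>2) + ennreal ((S k u \<omega> - S' k u \<omega>)\<^sup>2) \<le> g k \<omega>" for k
      unfolding g_def using u by (intro member_le_sum) auto
    have le3: "D k u \<omega> \<le> g k \<omega>" "ennreal ((I u \<omega> - S k u \<omega>)\<^sup>2) \<le> g k \<omega>" "ennreal ((S k u \<omega> - S' k u \<omega>)\<^sup>2) \<le> g k \<omega>" for k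
      by (rule order_trans[OF _ le[of k]], intro add_increasing2 add_increasing order_refl zero_le)+
    have sq: "(\<lambda>k. y k) \<longlonglongrightarrow> 0" if "\<And>k. ennreal ((y k)\<^sup>2) \<le> g (\<rho> k) \<omega>" for y :: "nat \<Rightarrow> real"
    proof -
      have "(\<lambda>k. ennreal ((y k)\<^sup>2)) \<longlonglongrightarrow> ennreal 0"
        using tendsto_sandwich[OF _ _ tendsto_const g0, of "\<lambda>k. ennreal ((y k)\<^sup>2)"] that by auto
      then have "(\<lambda>k. (y k)\<^sup>2) \<longlonglongrightarrow> 0"
        by (rule tendsto_ennrealD) auto
      then show ?thesis by simp
    qed
    show "(\<lambda>k. D (\<rho> k) u \<omega>) \<longlonglongrightarrow> 0"
      by (rule tendsto_sandwich[OF _ _ tendsto_const g0]) (simp_all add: le3 always_eventually)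
    have "(\<lambda>k. I u \<omega> - S (\<rho> k) u \<omega>) \<longlonglongrightarrow> 0" "(\<lambda>k. S (\<rho> k) u \<omega> - S' (\<rho> k) u \<omega>) \<longlonglongrightarrow> 0"
      by (rule sq; rule le3)+
    from tendsto_diff[OF tendsto_const[of "I u \<omega>"] tendsto_add[OF this]]
    show "(\<lambda>k. S' (\<rho> k) u \<omega>) \<longlonglongrightarrow> I u \<omega>" by simp
  qed
  \<comment> \<open>\<open>D\<close> measures squares, whereas the variations differ by a first
    power of the distance; \<open>x \<le> \<epsilon> + x^2 / \<epsilon>\<close> trades one for the
    other at the price of the small first summand.\<close>
  have V_near: "ennreal \<bar>V' k u \<omega> - V u \<omega>\<bar> \<le> ennreal (2 * C * \<epsilon> * u) + ennreal (2 * C / \<epsilon>) * D k u \<omega>"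
    if u: "0 \<le> u" and \<omega>: "\<omega> \<in> space M" and \<epsilon>: "0 < \<epsilon>" for k u \<omega> \<epsilon>
  proof -
    have b2: "simple_value (n k) (p k) (\<lambda>i \<omega>. (b k i \<omega>)\<^sup>2) r \<omega> = (cl (sv k r \<omega>))\<^sup>2" for r
      unfolding b_def sv_def
      using simple_value_comp[of "n k" "p k" "\<lambda>x. (cl x)\<^sup>2" "a k" r \<omega>] grid cl by simp
    have hb: "has_bochner_integral lborel (\<lambda>r. if 0 < r \<and> r \<le> u then (cl (sv k r \<omega>))\<^sup>2 else 0) (V' k u \<omega>)"
      unfolding b2[symmetric] V'_def simple_variation_def
      using grid u by (intro has_bochner_integral_simple_value)
    have H2: "integrable lborel (\<lambda>r. if 0 < r \<and> r \<le> u then (H r \<omega>)\<^sup>2 else 0)"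
    proof (rule integrable_time)
      show "progressive (\<lambda>r \<omega>. (H r \<omega>)\<^sup>2)" by (rule progressive_compose[OF prog]) simp
      show "\<bar>(H r \<omega>)\<^sup>2\<bar> \<le> C\<^sup>2" if "0 < r" for r
        using bnd[OF that \<omega>] by (auto intro: power_mono)
    qed (use u \<omega> in auto)
    have diff: "V' k u \<omega> - V u \<omega> = (\<integral>r. (if 0 < r \<and> r \<le> u then (cl (sv k r \<omega>))\<^sup>2 else 0) - (if 0 < r \<and> r \<le> u then (H r \<omega>)\<^sup>2 else 0) \<partial>lborel)"
      unfolding V_def time_integral_def using hb H2
      by (subst Bochner_Integration.integral_diff) (auto simp: has_bochner_integral_iff)
    have "ennreal \<bar>V' k u \<omega> - V u \<omega>\<bar> \<le> (\<integral>\<^sup>+r. ennreal \<bar>(if 0 < r \<and> r \<le> u then (cl (sv k r \<omega>))\<^sup>2 else 0) - (if 0 < r \<and> r \<le> u then (H r \<omega>)\<^sup>2 else 0)\<bar> \<partial>lborel)"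
      unfolding diff real_norm_def[symmetric] using hb H2
      by (intro integral_norm_bound_ennreal) (auto simp: has_bochner_integral_iff)
    also have "\<dots> \<le> (\<integral>\<^sup>+r. ennreal (2 * C * \<epsilon>) * indicator {0<..u} r
        + ennreal (2 * C / \<epsilon>) * ennreal (if 0 < r \<and> r \<le> u then (H r \<omega> - sv k r \<omega>)\<^sup>2 else 0) \<partial>lborel)"
    proof (rule nn_integral_mono)
      fix r
      let ?c = "cl (sv k r \<omega>)" and ?h = "H r \<omega>" and ?x = "\<bar>H r \<omega> - sv k r \<omega>\<bar>"
      have "\<bar>?c\<^sup>2 - ?h\<^sup>2\<bar> \<le> 2 * C * \<epsilon> + 2 * C / \<epsilon> * ?x\<^sup>2" if r: "0 < r"
      proof -
        have h: "0 \<le> ?h" "?h \<le> C" using bnd[OF r \<omega>] by auto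
        have "?c\<^sup>2 - ?h\<^sup>2 = (?c - ?h) * (?c + ?h)" by (simp add: power2_eq_square algebra_simps)
        then have "\<bar>?c\<^sup>2 - ?h\<^sup>2\<bar> = \<bar>?c - ?h\<bar> * \<bar>?c + ?h\<bar>" by (simp add: abs_mult)
        also have "\<dots> \<le> ?x * (2 * C)"
          using cl_near(1)[OF h, of "sv k r \<omega>"] cl(1,2)[of "sv k r \<omega>"] h
          by (intro mult_mono) (auto simp: abs_minus_commute)
        also have "?x \<le> \<epsilon> + ?x\<^sup>2 / \<epsilon>"
        proof (cases "?x \<le> \<epsilon>")
          case True
          then show ?thesis using \<epsilon> by (simp add: add_increasing2)
        next
          case False
          then have "?x * \<epsilon> \<le> ?x\<^sup>2" by (simp add: power2_eq_square mult_left_mono del: abs_mult_self_eq power2_abs)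
          then show ?thesis using \<epsilon> by (simp add: field_simps) (smt (verit) zero_le_power2 mult_nonneg_nonneg)
        qed
        then have "?x * (2 * C) \<le> (\<epsilon> + ?x\<^sup>2 / \<epsilon>) * (2 * C)"
          using C by (intro mult_right_mono) auto
        also have "\<dots> = 2 * C * \<epsilon> + 2 * C / \<epsilon> * ?x\<^sup>2" by (simp add: algebra_simps)
        finally show ?thesis by simp
      qed
      then show "ennreal \<bar>(if 0 < r \<and> r \<le> u then ?c\<^sup>2 else 0) - (if 0 < r \<and> r \<le> u then ?h\<^sup>2 else 0)\<bar>
          \<le> ennreal (2 * C * \<epsilon>) * indicator {0<..u} r
            + ennreal (2 * C / \<epsilon>) * ennreal (if 0 < r \<and> r \<le> u then (H r \<omega> - sv k r \<omega>)\<^sup>2 else 0)"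
        using C \<epsilon> by (auto simp: indicator_def ennreal_mult[symmetric] ennreal_plus[symmetric] simp del: ennreal_plus intro!: ennreal_leI)
    qed
    also have "\<dots> = ennreal (2 * C * \<epsilon>) * emeasure lborel {0<..u} + ennreal (2 * C / \<epsilon>) * D k u \<omega>"
      unfolding D_def using sec_r[OF u \<omega>, of k]
      by (subst nn_integral_add) (auto simp: nn_integral_cmult nn_integral_cmult_indicator)
    also have "\<dots> = ennreal (2 * C * \<epsilon> * u) + ennreal (2 * C / \<epsilon>) * D k u \<omega>"
      using u C \<epsilon> by (simp add: ennreal_mult)
    finally show ?thesis .
  qed
  have V_lim: "(\<lambda>k. V' (\<rho> k) u \<omega>) \<longlonglongrightarrow> V u \<omega>"
    if "(\<lambda>k. D (\<rho> k) u \<omega>) \<longlonglongrightarrow> 0" and u: "0 \<le> u" and \<omega>: "\<omega> \<in> space M" for \<omega> u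
  proof (rule LIMSEQ_I)
    fix e :: real assume e: "0 < e"
    \<comment> \<open>Chosen so that the first summand of \<open>V_near\<close> is at most
      \<open>e / 2\<close>; adding 1 keeps the denominator positive when \<open>C * u\<close> is
      0.\<close>
    define \<epsilon> where "\<epsilon> = e / (2 * (2 * C * u + 1))"
    have pos: "0 < 2 * C * u + 1" using C u by (simp add: add_nonneg_pos)
    have \<epsilon>: "0 < \<epsilon>" using e pos by (simp add: \<epsilon>_def)
    have half: "2 * C * \<epsilon> * u \<le> e / 2"
      using e pos by (simp add: \<epsilon>_def field_simps)
    have "(\<lambda>k. ennreal (2 * C / \<epsilon>) * D (\<rho> k) u \<omega>) \<longlonglongrightarrow> ennreal (2 * C / \<epsilon>) * 0"
      using that(1) by (intro ennreal_tendsto_cmult) auto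
    then have "eventually (\<lambda>k. ennreal (2 * C / \<epsilon>) * D (\<rho> k) u \<omega> < ennreal (e / 2)) sequentially"
      using e by (intro order_tendstoD(2)) auto
    then have "eventually (\<lambda>k. ennreal \<bar>V' (\<rho> k) u \<omega> - V u \<omega>\<bar> < ennreal e) sequentially"
    proof eventually_elim
      case (elim k)
      have "ennreal \<bar>V' (\<rho> k) u \<omega> - V u \<omega>\<bar> \<le> ennreal (2 * C * \<epsilon> * u) + ennreal (2 * C / \<epsilon>) * D (\<rho> k) u \<omega>"
        by (rule V_near[OF u \<omega> \<epsilon>])
      also have "\<dots> \<le> ennreal (e / 2) + ennreal (2 * C / \<epsilon>) * D (\<rho> k) u \<omega>"
        using half by (intro add_right_mono ennreal_leI)
      also have "\<dots> < ennreal (e / 2) + ennreal (e / 2)"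
        using elim by (intro ennreal_add_left_cancel_less[THEN iffD2]) auto
      also have "\<dots> = ennreal e" using e by (simp flip: ennreal_plus)
      finally show ?case .
    qed
    then show "\<exists>no. \<forall>k\<ge>no. norm (V' (\<rho> k) u \<omega> - V u \<omega>) < e"
      using e by (auto simp: eventually_sequentially ennreal_less_iff)
  qed
  show ?thesis
  proof (intro exI[of _ "\<lambda>k. n (\<rho> k)"] exI[of _ "\<lambda>k. p (\<rho> k)"] exI[of _ "\<lambda>k. b (\<rho> k)"] conjI allI ballI)
    show "simple_integrand F (n (\<rho> k)) (p (\<rho> k)) (b (\<rho> k))" for k by (rule sb)
    show "0 \<le> b (\<rho> k) i \<omega>" "b (\<rho> k) i \<omega> \<le> C" for k i \<omega> using cl by (simp_all add: b_def)
    fix u assume u: "u \<in> {s, t}"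
    show "AE \<omega> in M. (\<lambda>k. simple_integral w (n (\<rho> k)) (p (\<rho> k)) (b (\<rho> k)) u \<omega>) \<longlonglongrightarrow> I u \<omega>"
      using \<rho> by eventually_elim (rule parts(2)[OF _ u, unfolded S'_def])
    show "AE \<omega> in M. (\<lambda>k. simple_variation (n (\<rho> k)) (p (\<rho> k)) (b (\<rho> k)) u \<omega>) \<longlonglongrightarrow> time_integral (\<lambda>r \<omega>. (H r \<omega>)\<^sup>2) u \<omega>"
      using \<rho> AE_space by eventually_elim (rule V_lim[OF parts(1)[OF _ u] st'[OF u], unfolded V'_def V_def])
  qed
qed

text \<open>The simple integrals all vanish at time 0; since they determine \<open>I\<close> only
  through limits, its starting value is known almost surely.\<close>

lemma ito_integral_0: "AE \<omega> in M. I 0 \<omega> = 0"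
proof -
  obtain n p b where sa: "\<And>k::nat. simple_integrand F (n k) (p k) (b k)"
    and lim: "AE \<omega> in M. (\<lambda>k. simple_integral w (n k) (p k) (b k) 0 \<omega>) \<longlonglongrightarrow> I 0 \<omega>"
    using ito_integral_bounded_approx[OF order_refl order_refl] by blast
  have "simple_integral w (n k) (p k) (b k) 0 \<omega> = 0" for k \<omega>
    using simple_integrand_grid_nonneg[OF sa[of k]]
    by (auto simp: simple_integral_def min_absorb2 intro!: sum.neutral)
  then show ?thesis using lim by (simp add: LIMSEQ_const_iff)
qed

text \<open>The identity holds for the truncated simple integrands. Their exponentials converge
  almost surely at both times and have second moments bounded independently of \<open>k\<close>, so
  the weighted means converge too.\<close>

lemma ito_exp_martingale:
  assumes st: "0 \<le> s" "s \<le> t" and G: "G \<in> borel_measurable (F (ennreal s))"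
    and GB: "\<And>\<omega>. \<omega> \<in> space M \<Longrightarrow> 0 \<le> G \<omega> \<and> G \<omega> \<le> B"
  defines "V \<equiv> time_integral (\<lambda>r \<omega>. (H r \<omega>)\<^sup>2)"
  shows "(\<integral>\<^sup>+\<omega>. ennreal (G \<omega> * exp (- \<theta> * I t \<omega> - \<theta>\<^sup>2 / 2 * V t \<omega>)) \<partial>M)
    = (\<integral>\<^sup>+\<omega>. ennreal (G \<omega> * exp (- \<theta> * I s \<omega> - \<theta>\<^sup>2 / 2 * V s \<omega>)) \<partial>M)"
proof -
  have st0: "0 \<le> s" "0 \<le> t" using st by auto
  obtain n p b where sb: "\<And>k::nat. simple_integrand F (n k) (p k) (b k)"
    and bC: "\<And>k i \<omega>. 0 \<le> b k i \<omega> \<and> b k i \<omega> \<le> C"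
    and limI: "\<And>u. u \<in> {s, t} \<Longrightarrow> AE \<omega> in M. (\<lambda>k. simple_integral w (n k) (p k) (b k) u \<omega>) \<longlonglongrightarrow> I u \<omega>"
    and limV: "\<And>u. u \<in> {s, t} \<Longrightarrow> AE \<omega> in M. (\<lambda>k. simple_variation (n k) (p k) (b k) u \<omega>) \<longlonglongrightarrow> V u \<omega>"
    using ito_integral_bounded_approx[OF st0] unfolding V_def by blast
  define E where "E k u \<omega> = exp (- \<theta> * simple_integral w (n k) (p k) (b k) u \<omega> - \<theta>\<^sup>2 / 2 * simple_variation (n k) (p k) (b k) u \<omega>)" for k u \<omega>
  have G_M [measurable]: "G \<in> borel_measurable M" by (rule F_imp_M[OF G])
  have E_meas [measurable]: "E k u \<in> borel_measurable M" if "0 \<le> u" for k u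
  proof -
    note [measurable] = measurable_simple[OF sb that, THEN F_imp_M]
    show ?thesis unfolding E_def[abs_def] by measurable
  qed
  have lim: "(\<lambda>k. \<integral>\<^sup>+\<omega>. ennreal (G \<omega> * E k u \<omega>) \<partial>M)
      \<longlonglongrightarrow> (\<integral>\<^sup>+\<omega>. ennreal (G \<omega> * exp (- \<theta> * I u \<omega> - \<theta>\<^sup>2 / 2 * V u \<omega>)) \<partial>M)" if u: "u \<in> {s, t}" for u
  proof (rule nn_integral_tendsto_L2)
    have u0: "0 \<le> u" using u st by auto
    show "finite_measure M" by unfold_locales
    show "(\<lambda>\<omega>. G \<omega> * E k u \<omega>) \<in> borel_measurable M" for k using u0 by measurable
    show "AE \<omega> in M. (\<lambda>k. G \<omega> * E k u \<omega>) \<longlonglongrightarrow> G \<omega> * exp (- \<theta> * I u \<omega> - \<theta>\<^sup>2 / 2 * V u \<omega>)"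
      using limI[OF u] limV[OF u] by eventually_elim (auto simp: E_def intro!: tendsto_intros)
    show "(\<integral>\<^sup>+\<omega>. ennreal ((G \<omega> * E k u \<omega>)\<^sup>2) \<partial>M) \<le> ennreal (B\<^sup>2 * exp (\<theta>\<^sup>2 * C\<^sup>2 * u))" for k
    proof -
      have "(\<integral>\<^sup>+\<omega>. ennreal ((G \<omega> * E k u \<omega>)\<^sup>2) \<partial>M) \<le> (\<integral>\<^sup>+\<omega>. ennreal (B\<^sup>2) * ennreal ((E k u \<omega>)\<^sup>2) \<partial>M)"
        using GB by (intro nn_integral_mono)
          (auto simp: power_mult_distrib ennreal_mult[symmetric] intro!: ennreal_leI mult_right_mono power_mono)
      also have "\<dots> = ennreal (B\<^sup>2) * (\<integral>\<^sup>+\<omega>. ennreal ((E k u \<omega>)\<^sup>2) \<partial>M)"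
        using u0 by (intro nn_integral_cmult) measurable
      also have "\<dots> \<le> ennreal (B\<^sup>2) * ennreal (exp (\<theta>\<^sup>2 * C\<^sup>2 * u))"
        unfolding E_def using bC by (intro mult_left_mono nn_integral_simple_exp_square_le[OF sb] u0) auto
      finally show ?thesis by (simp add: ennreal_mult)
    qed
  qed
  have "(\<integral>\<^sup>+\<omega>. ennreal (G \<omega> * E k t \<omega>) \<partial>M) = (\<integral>\<^sup>+\<omega>. ennreal (G \<omega> * E k s \<omega>) \<partial>M)" for k
  proof -
    have eq: "(\<integral>\<^sup>+\<omega>. ennreal (G \<omega> * E k u \<omega>) \<partial>M) = (\<integral>\<^sup>+\<omega>. ennreal (G \<omega>) * ennreal (E k u \<omega>) \<partial>M)" for u
      using GB by (intro nn_integral_cong ennreal_mult) (auto simp: E_def)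
    have "(\<lambda>\<omega>. ennreal (G \<omega>)) \<in> borel_measurable (F (ennreal s))" using G by measurable
    from simple_exp_martingale[OF sb st this, of \<theta> k] show ?thesis
      unfolding eq by (simp add: E_def)
  qed
  with lim[of t] lim[of s] show ?thesis
    by (auto intro: LIMSEQ_unique)
qed

end

end

section \<open>The reinsurance rates\<close>

context
  fixes D :: "real measure"
  assumes D: "claim_law D"
begin

interpretation D: real_distribution D
  using D by (simp add: claim_law_def)

lemma cdf_measurable: "cdf D \<in> borel_measurable borel"
  by (rule borel_measurable_mono) (auto simp: mono_def intro: D.cdf_nondecreasing)

lemma tail_eq: "1 - cdf D y = measure D {y<..}"
proof -
  have "{y<..} = space D - {..y}" by auto
  then show ?thesis using D.prob_compl[of "{..y}"] by (simp add: cdf_def)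
qed

lemma tail_bounds: "0 \<le> 1 - cdf D y" "1 - cdf D y \<le> 1"
  unfolding tail_eq by (auto intro: D.prob_le_1)

text \<open>Fubini applied to \<open>2 * y\<close> on the region \<open>0 < y < z\<close> bounds the
  tail moment by a multiple of the second moment of the claim size.\<close>

lemma integrable_tail_moment: "integrable lborel (\<lambda>y. indicator {0<..} y * (2 * y * (1 - cdf D y)))"
proof (rule integrableI_nonneg)
  note cdf_measurable [measurable]
  show "(\<lambda>y. indicator {0<..} y * (2 * y * (1 - cdf D y))) \<in> borel_measurable lborel" by measurable
  show "AE y in lborel. 0 \<le> indicator {0<..} y * (2 * y * (1 - cdf D y))"
    using tail_bounds by (intro AE_I2) (auto simp: indicator_def)
  interpret pair_sigma_finite D lborel ..
  have "(\<integral>\<^sup>+y. ennreal (indicator {0<..} y * (2 * y * (1 - cdf D y))) \<partial>lborel)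
      = (\<integral>\<^sup>+y. (\<integral>\<^sup>+z. (if 0 < y \<and> y < z then ennreal (2 * y) else 0) \<partial>D) \<partial>lborel)"
  proof (rule nn_integral_cong)
    fix y :: real
    have "(\<integral>\<^sup>+z. (if 0 < y \<and> y < z then ennreal (2 * y) else 0) \<partial>D)
        = (\<integral>\<^sup>+z. ennreal (indicator {0<..} y * (2 * y)) * indicator {y<..} z \<partial>D)"
      by (intro nn_integral_cong) (auto simp: indicator_def)
    also have "\<dots> = ennreal (indicator {0<..} y * (2 * y)) * ennreal (1 - cdf D y)"
      unfolding tail_eq by (simp add: nn_integral_cmult_indicator D.emeasure_eq_measure)
    also have "\<dots> = ennreal (indicator {0<..} y * (2 * y * (1 - cdf D y)))"
      using tail_bounds[of y] by (simp add: ennreal_mult[symmetric] indicator_def)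
    finally show "ennreal (indicator {0<..} y * (2 * y * (1 - cdf D y)))
      = (\<integral>\<^sup>+z. (if 0 < y \<and> y < z then ennreal (2 * y) else 0) \<partial>D)" ..
  qed
  also have "\<dots> = (\<integral>\<^sup>+z. (\<integral>\<^sup>+y. (if 0 < y \<and> y < z then ennreal (2 * y) else 0) \<partial>lborel) \<partial>D)"
    by (rule Fubini') measurable
  also have "\<dots> \<le> (\<integral>\<^sup>+z. ennreal (2 * z\<^sup>2) \<partial>D)"
  proof (rule nn_integral_mono)
    fix z :: real
    \<comment> \<open>For positive \<open>z\<close> the exact value is \<open>z^2\<close>; height
      times length gives twice that, which suffices for finiteness.\<close>
    have "(\<integral>\<^sup>+y. (if 0 < y \<and> y < z then ennreal (2 * y) else 0) \<partial>lborel)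
        \<le> (\<integral>\<^sup>+y. ennreal (2 * \<bar>z\<bar>) * indicator {0<..<\<bar>z\<bar>} y \<partial>lborel)"
      by (intro nn_integral_mono) (auto simp: indicator_def intro!: ennreal_leI)
    also have "\<dots> = ennreal (2 * z\<^sup>2)"
      by (simp add: nn_integral_cmult_indicator ennreal_mult[symmetric] power2_eq_square)
    finally show "(\<integral>\<^sup>+y. (if 0 < y \<and> y < z then ennreal (2 * y) else 0) \<partial>lborel) \<le> ennreal (2 * z\<^sup>2)" .
  qed
  also have "\<dots> < \<infinity>"
  proof -
    have "integrable D (\<lambda>z. 2 * z\<^sup>2)" using D by (auto simp: claim_law_def)
    from integrableD(2)[OF this] show ?thesis by (simp add: top.not_eq_extremum less_top)
  qed
  finally show "(\<integral>\<^sup>+y. ennreal (indicator {0<..} y * (2 * y * (1 - cdf D y))) \<partial>lborel) < \<infinity>" .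
qed

text \<open>Up to 1 the tail is at most 1, and beyond 1 it is at most its multiple by
  \<open>2 * y\<close>.\<close>

lemma integrable_tail: "integrable lborel (\<lambda>y. indicator {0<..} y * (1 - cdf D y))"
proof (rule Bochner_Integration.integrable_bound)
  note cdf_measurable [measurable]
  show "(\<lambda>y. indicator {0<..} y * (1 - cdf D y)) \<in> borel_measurable lborel" by measurable
  show "integrable lborel (\<lambda>y. indicator {0<..1} y + indicator {0<..} y * (2 * y * (1 - cdf D y)) :: real)"
    by (intro Bochner_Integration.integrable_add integrable_tail_moment) simp
  show "AE y in lborel. norm (indicator {0<..} y * (1 - cdf D y))
      \<le> norm (indicator {0<..1} y + indicator {0<..} y * (2 * y * (1 - cdf D y)))"
  proof (rule AE_I2)
    fix y :: real
    note b = tail_bounds[of y]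
    show "norm (indicator {0<..} y * (1 - cdf D y)) \<le> norm (indicator {0<..1} y + indicator {0<..} y * (2 * y * (1 - cdf D y)))"
    proof (cases "0 < y")
      case True
      show ?thesis
      proof (cases "y \<le> 1")
        case True
        define X where "X = 2 * y * (1 - cdf D y)"
        have "0 \<le> X" using \<open>0 < y\<close> b by (simp add: X_def)
        then show ?thesis using \<open>0 < y\<close> True b unfolding X_def[symmetric] by simp
      next
        case False
        have "1 * (1 - cdf D y) \<le> (2 * y) * (1 - cdf D y)" using False b by (intro mult_right_mono) auto
        then show ?thesis using \<open>0 < y\<close> False b by simp
      qed
    qed simp
  qed
qed

lemma integrable_tail_interval:
  "integrable lborel (\<lambda>y. indicator (einterval 0 u) y * (1 - cdf D y))"
  "integrable lborel (\<lambda>y. indicator (einterval 0 u) y * (2 * y * (1 - cdf D y)))"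
proof -
  have [simp]: "indicator (einterval 0 u) y * (indicator {0<..} y * z) = indicator (einterval 0 u) y * z" for y z :: real
    by (auto simp: indicator_def einterval_iff)
  show "integrable lborel (\<lambda>y. indicator (einterval 0 u) y * (1 - cdf D y))"
    using integrable_mult_indicator[OF _ integrable_tail, of "einterval 0 u"] by simp
  show "integrable lborel (\<lambda>y. indicator (einterval 0 u) y * (2 * y * (1 - cdf D y)))"
    using integrable_mult_indicator[OF _ integrable_tail_moment, of "einterval 0 u"] by simp
qed

lemma mu_eq: "0 \<le> u \<Longrightarrow> mu D u = (\<integral>y. indicator (einterval 0 u) y * (1 - cdf D y) \<partial>lborel)"
  by (simp add: mu_def interval_lebesgue_integral_def set_lebesgue_integral_def)

lemma second_moment_nonneg: "0 \<le> (\<integral>y. indicator (einterval 0 u) y * (2 * y * (1 - cdf D y)) \<partial>lborel)"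
  using tail_bounds by (intro integral_nonneg_AE AE_I2) (auto simp: indicator_def einterval_iff)

lemma sig_eq: "0 \<le> u \<Longrightarrow> sig D u = sqrt (\<integral>y. indicator (einterval 0 u) y * (2 * y * (1 - cdf D y)) \<partial>lborel)"
  by (simp add: sig_def interval_lebesgue_integral_def set_lebesgue_integral_def)

lemma sig_sq: "0 \<le> u \<Longrightarrow> (sig D u)\<^sup>2 = (\<integral>y. indicator (einterval 0 u) y * (2 * y * (1 - cdf D y)) \<partial>lborel)"
  using second_moment_nonneg[of u] by (simp add: sig_eq)

lemma mu_bounds: "0 \<le> u \<Longrightarrow> 0 \<le> mu D u" "0 \<le> u \<Longrightarrow> mu D u \<le> mu D \<infinity>"
proof -
  assume u: "0 \<le> u"
  show "0 \<le> mu D u" unfolding mu_eq[OF u]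
    using tail_bounds by (intro integral_nonneg_AE AE_I2) (auto simp: indicator_def)
  show "mu D u \<le> mu D \<infinity>"
    using u tail_bounds by (simp add: mu_eq, intro integral_mono integrable_tail_interval)
      (auto simp: indicator_def einterval_iff)
qed

lemma sig_bounds: "0 \<le> u \<Longrightarrow> 0 \<le> sig D u" "0 \<le> u \<Longrightarrow> sig D u \<le> sig D \<infinity>"
proof -
  assume u: "0 \<le> u"
  show "0 \<le> sig D u" using second_moment_nonneg by (simp add: sig_eq[OF u])
  show "sig D u \<le> sig D \<infinity>"
    using u tail_bounds by (simp add: sig_eq, intro integral_mono integrable_tail_interval)
      (auto simp: indicator_def einterval_iff)
qed

text \<open>The integrand \<open>\<kappa> (\<kappa> y - 1) (1 - F y)\<close> is negative below \<open>1 / \<kappa>\<close> and positive above, so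
  integrating it up to \<open>1 / \<kappa>\<close> gives the minimum.\<close>

lemma generator_min:
  assumes "0 < \<kappa>" "0 \<le> u"
  shows "\<kappa>\<^sup>2 / 2 * (sig D (ereal (1 / \<kappa>)))\<^sup>2 - \<kappa> * mu D (ereal (1 / \<kappa>)) \<le> \<kappa>\<^sup>2 / 2 * (sig D u)\<^sup>2 - \<kappa> * mu D u"
proof -
  have eq: "\<kappa>\<^sup>2 / 2 * (sig D v)\<^sup>2 - \<kappa> * mu D v
      = (\<integral>y. \<kappa>\<^sup>2 / 2 * (indicator (einterval 0 v) y * (2 * y * (1 - cdf D y)))
          - \<kappa> * (indicator (einterval 0 v) y * (1 - cdf D y)) \<partial>lborel)" if "0 \<le> v" for v
    unfolding sig_sq[OF that] mu_eq[OF that]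
    by (subst Bochner_Integration.integral_diff)
      (intro integrable_mult_right integrable_tail_interval, intro integrable_mult_right integrable_tail_interval,
        simp only: integral_mult_right_zero)
  have v: "0 \<le> ereal (1 / \<kappa>)" using assms by simp
  show ?thesis
    unfolding eq[OF v] eq[OF assms(2)]
  proof (intro integral_mono Bochner_Integration.integrable_diff integrable_mult_right integrable_tail_interval)
    fix y :: real
    have g: "\<kappa>\<^sup>2 / 2 * (indicator E y * (2 * y * (1 - cdf D y))) - \<kappa> * (indicator E y * (1 - cdf D y))
        = indicator E y * (\<kappa> * (1 - cdf D y) * (\<kappa> * y - 1))" for E
      by (simp add: algebra_simps power2_eq_square)
    have t: "0 \<le> \<kappa> * (1 - cdf D y)" using assms tail_bounds by simp
    show "\<kappa>\<^sup>2 / 2 * (indicator (einterval 0 (ereal (1 / \<kappa>))) y * (2 * y * (1 - cdf D y))) - \<kappa> * (indicator (einterval 0 (ereal (1 / \<kappa>))) y * (1 - cdf D y))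
      \<le> \<kappa>\<^sup>2 / 2 * (indicator (einterval 0 u) y * (2 * y * (1 - cdf D y))) - \<kappa> * (indicator (einterval 0 u) y * (1 - cdf D y))"
      unfolding g
    proof (cases "y < 1 / \<kappa>")
      case True
      then have "\<kappa> * (1 - cdf D y) * (\<kappa> * y - 1) \<le> 0"
        using t assms by (intro mult_nonneg_nonpos) (auto simp: field_simps)
      then show "indicator (einterval 0 (ereal (1 / \<kappa>))) y * (\<kappa> * (1 - cdf D y) * (\<kappa> * y - 1))
        \<le> indicator (einterval 0 u) y * (\<kappa> * (1 - cdf D y) * (\<kappa> * y - 1))"
        using True by (auto simp: indicator_def einterval_iff)
    next
      case False
      then have "0 \<le> \<kappa> * (1 - cdf D y) * (\<kappa> * y - 1)"
        using t assms by (intro mult_nonneg_nonneg) (auto simp: field_simps)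
      then show "indicator (einterval 0 (ereal (1 / \<kappa>))) y * (\<kappa> * (1 - cdf D y) * (\<kappa> * y - 1))
        \<le> indicator (einterval 0 u) y * (\<kappa> * (1 - cdf D y) * (\<kappa> * y - 1))"
        using False by (auto simp: indicator_def einterval_iff)
    qed
  qed
qed

text \<open>The interval integral reverses its orientation for negative \<open>u\<close>, so both
  intervals are treated before the case distinction.\<close>

lemma measurable_mu_sig: "mu D \<in> borel_measurable borel" "sig D \<in> borel_measurable borel"
proof -
  note cdf_measurable [measurable]
  have [measurable]: "Measurable.pred (borel \<Otimes>\<^sub>M lborel) (\<lambda>z. snd z \<in> einterval 0 (fst z))"
    "Measurable.pred (borel \<Otimes>\<^sub>M lborel) (\<lambda>z. snd z \<in> einterval (fst z) 0)"
    unfolding einterval_iff by measurable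
  have *: "(\<lambda>u. \<integral>y. indicator (einterval 0 u) y * f y \<partial>lborel) \<in> borel_measurable borel"
    "(\<lambda>u. \<integral>y. indicator (einterval u 0) y * f y \<partial>lborel) \<in> borel_measurable borel"
    if [measurable]: "f \<in> borel_measurable borel" for f :: "real \<Rightarrow> real"
    by (intro lborel.borel_measurable_lebesgue_integral; simp add: case_prod_beta' indicator_def; measurable)+
  note ** = *[of "\<lambda>y. 1 - cdf D y"] *[of "\<lambda>y. 2 * y * (1 - cdf D y)"]
  have [measurable]: "(\<lambda>u. \<integral>y. indicator (einterval 0 u) y * (1 - cdf D y) \<partial>lborel) \<in> borel_measurable borel"
    "(\<lambda>u. \<integral>y. indicator (einterval u 0) y * (1 - cdf D y) \<partial>lborel) \<in> borel_measurable borel"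
    "(\<lambda>u. \<integral>y. indicator (einterval 0 u) y * (2 * y * (1 - cdf D y)) \<partial>lborel) \<in> borel_measurable borel"
    "(\<lambda>u. \<integral>y. indicator (einterval u 0) y * (2 * y * (1 - cdf D y)) \<partial>lborel) \<in> borel_measurable borel"
    by (intro **; measurable)+
  show "mu D \<in> borel_measurable borel"
    unfolding mu_def[abs_def] interval_lebesgue_integral_def set_lebesgue_integral_def real_scaleR_def
    by measurable
  show "sig D \<in> borel_measurable borel"
    unfolding sig_def[abs_def] interval_lebesgue_integral_def set_lebesgue_integral_def real_scaleR_def
    by measurable
qed

end

section \<open>Controls as progressive processes\<close>

lemma interval_integral_eq_time_integral:
  assumes "0 \<le> t"
  shows "(LBINT s=0..ereal t. f s \<omega>) = time_integral f t \<omega>"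
proof -
  have "(LBINT s=ereal 0..ereal t. f s \<omega>) = (LBINT s:{0<..t}. f s \<omega>)"
    using assms by (rule interval_integral_Ioc)
  also have "\<dots> = time_integral f t \<omega>"
    unfolding set_lebesgue_integral_def time_integral_def
    by (intro Bochner_Integration.integral_cong) (auto simp: indicator_def)
  finally show ?thesis by (simp add: zero_ereal_def)
qed

text \<open>It suffices to test the generators \<open>{s<..v} \<times> A\<close>: cut at
  \<open>t\<close>, such a rectangle is empty unless \<open>s < t\<close>, and then \<open>A\<close>
  already belongs to \<open>F t\<close>.\<close>

lemma (in filtered_brownian_motion) predictable_imp_progressive:
  fixes f :: "real \<Rightarrow> 'a \<Rightarrow> real"
  assumes f: "(\<lambda>(s, \<omega>). f s \<omega>) \<in> borel_measurable (predictable_sigma M F)"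
  shows "progressive f"
  unfolding progressive_def
proof (intro allI impI)
  fix t :: real assume t: "0 \<le> t"
  let ?N = "lborel \<Otimes>\<^sub>M F (ennreal t)"
  let ?R = "{z. 0 < fst z \<and> fst z \<le> t} :: (real \<times> 'a) set"
  have gen: "{{s<..t} \<times> A | s t A. 0 \<le> s \<and> s \<le> t \<and> A \<in> sets (F (ennreal s))} \<subseteq> Pow ({0<..} \<times> space M)"
    using sets.sets_into_space by fastforce
  have R: "?R \<inter> space ?N \<in> sets ?N" by measurable
  have "(\<lambda>z. z) \<in> measurable (restrict_space ?N ?R) (predictable_sigma M F)"
    unfolding predictable_sigma_def
  proof (rule measurable_measure_of[OF gen])
    show "(\<lambda>z. z) \<in> space (restrict_space ?N ?R) \<rightarrow> {0<..} \<times> space M"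
      by (auto simp: space_restrict_space space_pair_measure)
    fix B assume "B \<in> {{s<..t} \<times> A | s t A. 0 \<le> s \<and> s \<le> t \<and> A \<in> sets (F (ennreal s))}"
    then obtain s v A where B: "B = {s<..v} \<times> A" "0 \<le> s" "A \<in> sets (F (ennreal s))" by auto
    have A: "A \<subseteq> space M" using sets.sets_into_space[OF B(3)] by simp
    have "(\<lambda>z. z) -` B \<inter> space (restrict_space ?N ?R) = (if s < t then {s<..min v t} \<times> A else {})"
      using B(1,2) A by (auto simp: space_restrict_space space_pair_measure)
    moreover have "{s<..min v t} \<times> A \<in> sets ?N" if "s < t"
    proof -
      have "A \<in> sets (F (ennreal t))"
        using filtration.sets_F_mono[OF filtration_F, of "ennreal s" "ennreal t"] B(3) that
        by (auto simp: ennreal_leI subset_iff)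
      then show ?thesis by auto
    qed
    moreover have "{s<..min v t} \<times> A \<subseteq> ?R" using B(2) by auto
    ultimately show "(\<lambda>z. z) -` B \<inter> space (restrict_space ?N ?R) \<in> sets (restrict_space ?N ?R)"
      using R by (auto simp: sets_restrict_space_iff)
  qed
  from measurable_compose[OF this f]
  have "(\<lambda>z. f (fst z) (snd z)) \<in> borel_measurable (restrict_space ?N ?R)"
    by (simp add: case_prod_beta')
  then have "(\<lambda>z. if 0 < fst z \<and> fst z \<le> t then f (fst z) (snd z) else 0) \<in> borel_measurable ?N"
    using R by (subst measurable_If_restrict_space_iff) (auto simp: Collect_conj_eq Int_commute inf_commute)
  then show "(\<lambda>(s, \<omega>). if 0 < s \<and> s \<le> t then f s \<omega> else 0) \<in> borel_measurable ?N"
    by (simp add: case_prod_beta')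
qed

section \<open>The controlled surplus\<close>

text \<open>A domination of \<open>Y\<^sup>2\<close> against past weights; it takes the place of a maximal inequality.\<close>

definition (in filtered_brownian_motion) square_dominated ::
    "(real \<Rightarrow> 'a \<Rightarrow> real) \<Rightarrow> real \<Rightarrow> real \<Rightarrow> ('a \<Rightarrow> ennreal) \<Rightarrow> bool" where
  "square_dominated Y T K U \<longleftrightarrow> U \<in> borel_measurable M \<and> (\<integral>\<^sup>+\<omega>. U \<omega> \<partial>M) \<le> 1 \<and>
    (\<forall>t G. 0 \<le> t \<longrightarrow> t \<le> T \<longrightarrow> G \<in> borel_measurable (F (ennreal t)) \<longrightarrow> (\<forall>\<omega>\<in>space M. 0 \<le> G \<omega> \<and> G \<omega> \<le> 1) \<longrightarrow>
      (\<integral>\<^sup>+\<omega>. ennreal (G \<omega> * (Y t \<omega>)\<^sup>2) \<partial>M) \<le> ennreal K * (\<integral>\<^sup>+\<omega>. ennreal (G \<omega>) * U \<omega> \<partial>M))"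

text \<open>What the verification argument uses of the diffusion, freed from its coefficients.
  \<open>Z\<close> is measurable for \<open>M\<close> only, because the Ito integral is adapted
  merely up to null sets; the past enters through the weights \<open>G\<close>.\<close>

locale exp_surplus = filtered_brownian_motion M F w
  for M :: "'a measure" and F :: "ennreal \<Rightarrow> 'a measure" and w :: "real \<Rightarrow> 'a \<Rightarrow> real" +
  fixes Z :: "real \<Rightarrow> 'a \<Rightarrow> real" and x \<kappa> r :: real and Y :: "real \<Rightarrow> 'a \<Rightarrow> real"
  defines "Y \<equiv> \<lambda>t \<omega>. exp (- r * t - \<kappa> * Z t \<omega>)"
  assumes \<kappa>_pos: "0 < \<kappa>" and r_pos: "0 < r"
    and Z_cont: "\<And>\<omega>. \<omega> \<in> space M \<Longrightarrow> continuous_on {0..} (\<lambda>t. Z t \<omega>)"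
    and Z_meas: "\<And>t. 0 \<le> t \<Longrightarrow> Z t \<in> borel_measurable M"
    and Z_0: "AE \<omega> in M. Z 0 \<omega> = x"
    and Y_submartingale: "\<And>s t G. 0 \<le> s \<Longrightarrow> s \<le> t \<Longrightarrow> G \<in> borel_measurable (F (ennreal s)) \<Longrightarrow>
      (\<And>\<omega>. \<omega> \<in> space M \<Longrightarrow> 0 \<le> G \<omega> \<and> G \<omega> \<le> 1) \<Longrightarrow>
      (\<integral>\<^sup>+\<omega>. ennreal (G \<omega> * Y s \<omega>) \<partial>M) \<le> (\<integral>\<^sup>+\<omega>. ennreal (G \<omega> * Y t \<omega>) \<partial>M)"
    and Y_square: "\<And>T. 0 \<le> T \<Longrightarrow> \<exists>K U. square_dominated Y T K U"

text \<open>The coefficient of \<open>ds\<close> in the relative increment of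
  \<open>exp (- r * s - \<kappa> * Z s)\<close> under retention \<open>u\<close>.\<close>

definition rate :: "real measure \<Rightarrow> real \<Rightarrow> real \<Rightarrow> real \<Rightarrow> ereal \<Rightarrow> real" where
  "rate D \<delta> r \<kappa> u = \<kappa>\<^sup>2 / 2 * (sig D u)\<^sup>2 - \<kappa> * (mu D u - \<delta>) - r"

locale controlled_diffusion = filtered_brownian_motion M F w
  for M :: "'a measure" and F :: "ennreal \<Rightarrow> 'a measure" and w :: "real \<Rightarrow> 'a \<Rightarrow> real" +
  fixes D :: "real measure" and \<delta> r \<kappa> x :: real and p :: "'a control" and Z I :: "real \<Rightarrow> 'a \<Rightarrow> real"
  assumes D: "claim_law D" and ctrl: "is_control M F D p"
    and ito: "is_ito_integral M F w (\<lambda>s \<omega>. sig D (retention p s \<omega>)) I"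
    and Z: "\<And>t \<omega>. 0 \<le> t \<Longrightarrow> \<omega> \<in> space M \<Longrightarrow>
      Z t \<omega> = x + (LBINT s=0..ereal t. mu D (retention p s \<omega>) - \<delta>) + I t \<omega>"
    and \<kappa>: "0 < \<kappa>" and r: "0 < r" and J0: "J D \<delta> r (1 / \<kappa>) = 0"
begin

definition "H s \<omega> = sig D (retention p s \<omega>)"
definition "C = sig D \<infinity>"
definition "V = time_integral (\<lambda>s \<omega>. (H s \<omega>)\<^sup>2)"
definition "\<rho> s \<omega> = rate D \<delta> r \<kappa> (retention p s \<omega>)"
definition "A t \<omega> = exp (time_integral \<rho> t \<omega>)"
definition "L = \<kappa>\<^sup>2 / 2 * C\<^sup>2 + \<kappa> * (mu D \<infinity> + \<bar>\<delta>\<bar>) + r"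
definition "Y t \<omega> = exp (- r * t - \<kappa> * Z t \<omega>)"

text \<open>At \<open>1 / \<kappa>\<close> the rate is \<open>\<kappa>\<close> times
  \<open>J\<close>; this is how the equation for \<open>\<kappa>\<close> enters.\<close>

lemma rate_min: "rate D \<delta> r \<kappa> (ereal (1 / \<kappa>)) = 0"
proof -
  have "rate D \<delta> r \<kappa> (ereal (1 / \<kappa>)) = \<kappa> * J D \<delta> r (1 / \<kappa>)"
    using \<kappa> by (simp add: J_def rate_def field_simps power2_eq_square)
  then show ?thesis using J0 by simp
qed

lemma rate_nonneg: "0 \<le> u \<Longrightarrow> 0 \<le> rate D \<delta> r \<kappa> u"
  using generator_min[OF D \<kappa>, of u] rate_min by (simp add: rate_def algebra_simps)

lemma retention_nonneg: "0 < s \<Longrightarrow> \<omega> \<in> space M \<Longrightarrow> 0 \<le> retention p s \<omega>"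
  using ctrl by (auto simp: is_control_def)

lemma progressive_retention:
  fixes \<phi> :: "ereal \<Rightarrow> real"
  assumes "\<phi> \<in> borel_measurable borel"
  shows "progressive (\<lambda>s \<omega>. \<phi> (retention p s \<omega>))"
proof (rule predictable_imp_progressive)
  have "(\<lambda>(s, \<omega>). retention p s \<omega>) \<in> borel_measurable (predictable_sigma M F)"
    using ctrl by (simp add: is_control_def)
  from measurable_compose[OF this assms]
  show "(\<lambda>(s, \<omega>). \<phi> (retention p s \<omega>)) \<in> borel_measurable (predictable_sigma M F)"
    by (simp add: case_prod_beta')
qed

lemma progressive_H: "progressive H"
  unfolding H_def[abs_def] by (rule progressive_retention[OF measurable_mu_sig(2)[OF D]])

lemma H_bounds: "0 < s \<Longrightarrow> \<omega> \<in> space M \<Longrightarrow> 0 \<le> H s \<omega> \<and> H s \<omega> \<le> C"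
  unfolding H_def C_def using sig_bounds[OF D retention_nonneg] by blast

lemma mu_inf_nonneg: "0 \<le> mu D \<infinity>" by (rule mu_bounds(1)[OF D]) simp

lemma L_nonneg: "0 \<le> L"
  using mu_inf_nonneg \<kappa> r by (simp add: L_def)

lemma progressive_\<rho>: "progressive \<rho>"
proof -
  note [measurable] = measurable_mu_sig[OF D]
  have "rate D \<delta> r \<kappa> \<in> borel_measurable borel" unfolding rate_def[abs_def] by measurable
  then show ?thesis unfolding \<rho>_def[abs_def] by (rule progressive_retention)
qed

lemma progressive_drift: "progressive (\<lambda>s \<omega>. mu D (retention p s \<omega>) - \<delta>)"
proof -
  note [measurable] = measurable_mu_sig[OF D]
  have "(\<lambda>u. mu D u - \<delta>) \<in> borel_measurable borel" by measurable
  then show ?thesis by (rule progressive_retention)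
qed

lemma drift_bound:
  assumes "0 < s" "\<omega> \<in> space M"
  shows "\<bar>mu D (retention p s \<omega>) - \<delta>\<bar> \<le> mu D \<infinity> + \<bar>\<delta>\<bar>"
  using mu_bounds[OF D retention_nonneg[OF assms]] by linarith

lemma \<rho>_bounds:
  assumes "0 < s" "\<omega> \<in> space M"
  shows "0 \<le> \<rho> s \<omega>" "\<rho> s \<omega> \<le> L"
proof -
  show "0 \<le> \<rho> s \<omega>" unfolding \<rho>_def by (rule rate_nonneg[OF retention_nonneg[OF assms]])
  have "\<kappa>\<^sup>2 / 2 * (H s \<omega>)\<^sup>2 \<le> \<kappa>\<^sup>2 / 2 * C\<^sup>2"
    using H_bounds[OF assms] by (intro mult_left_mono power_mono) auto
  moreover have "\<kappa> * - (mu D (retention p s \<omega>) - \<delta>) \<le> \<kappa> * (mu D \<infinity> + \<bar>\<delta>\<bar>)"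
    using drift_bound[OF assms] \<kappa> by (intro mult_left_mono) auto
  ultimately show "\<rho> s \<omega> \<le> L" unfolding \<rho>_def rate_def L_def H_def using r by linarith
qed

lemma \<rho>_abs: "0 < s \<Longrightarrow> \<omega> \<in> space M \<Longrightarrow> \<bar>\<rho> s \<omega>\<bar> \<le> L"
  using \<rho>_bounds by fastforce

lemma H_sq_abs: "0 < s \<Longrightarrow> \<omega> \<in> space M \<Longrightarrow> \<bar>(H s \<omega>)\<^sup>2\<bar> \<le> C\<^sup>2"
  using H_bounds by (auto intro: power_mono)

lemma progressive_H_sq: "progressive (\<lambda>s \<omega>. (H s \<omega>)\<^sup>2)"
  by (rule progressive_compose[OF progressive_H]) simp

lemma A_meas: "0 \<le> t \<Longrightarrow> A t \<in> borel_measurable (F (ennreal t))"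
  unfolding A_def[abs_def] using measurable_time_integral[OF progressive_\<rho>] by measurable

lemma time_integral_0: "time_integral f 0 \<omega> = 0"
proof -
  have "(if 0 < s \<and> s \<le> 0 then f s \<omega> else 0) = 0" for s by auto
  then show ?thesis by (simp only: time_integral_def) simp
qed

lemma time_integral_mono_nonneg:
  assumes "progressive f" "\<omega> \<in> space M" "\<And>s. 0 < s \<Longrightarrow> 0 \<le> f s \<omega> \<and> f s \<omega> \<le> B" "0 \<le> s" "s \<le> t"
  shows "time_integral f s \<omega> \<le> time_integral f t \<omega>"
  unfolding time_integral_def
proof (rule integral_mono)
  have B: "\<bar>f s \<omega>\<bar> \<le> B" if "0 < s" for s using assms(3)[OF that] by simp
  show "integrable lborel (\<lambda>r. if 0 < r \<and> r \<le> s then f r \<omega> else 0)"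
    by (rule integrable_time[OF assms(1,4,2) B])
  show "integrable lborel (\<lambda>r. if 0 < r \<and> r \<le> t then f r \<omega> else 0)"
    using assms(4,5) by (intro integrable_time[OF assms(1) _ assms(2) B]) auto
  show "(if 0 < r \<and> r \<le> s then f r \<omega> else 0) \<le> (if 0 < r \<and> r \<le> t then f r \<omega> else 0)" for r
    using assms(3)[of r] assms(5) by auto
qed

lemma A_mono: "0 \<le> s \<Longrightarrow> s \<le> t \<Longrightarrow> \<omega> \<in> space M \<Longrightarrow> A s \<omega> \<le> A t \<omega>"
  unfolding A_def using \<rho>_bounds by (auto intro!: time_integral_mono_nonneg[OF progressive_\<rho>])

lemma A_bounds:
  assumes "0 \<le> t" "\<omega> \<in> space M"
  shows "1 \<le> A t \<omega>" "A t \<omega> \<le> exp (L * t)"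
  using A_mono[of 0 t \<omega>] time_integral_lipschitz[OF progressive_\<rho> assms(2) \<rho>_abs[OF _ assms(2)], of 0 t] assms
  by (auto simp: A_def time_integral_0)

lemma V_bounds:
  assumes "0 \<le> t" "\<omega> \<in> space M"
  shows "0 \<le> V t \<omega>" "V t \<omega> \<le> C\<^sup>2 * t"
proof -
  have "time_integral (\<lambda>s \<omega>. (H s \<omega>)\<^sup>2) 0 \<omega> \<le> V t \<omega>"
    unfolding V_def using assms H_sq_abs[OF _ assms(2)]
    by (intro time_integral_mono_nonneg[OF progressive_H_sq]) auto
  then show "0 \<le> V t \<omega>" by (simp add: time_integral_0)
  show "V t \<omega> \<le> C\<^sup>2 * t"
    using time_integral_lipschitz[OF progressive_H_sq assms(2) H_sq_abs[OF _ assms(2)], of 0 t] assms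
    by (simp add: time_integral_0 V_def)
qed

lemma V_meas: "0 \<le> t \<Longrightarrow> V t \<in> borel_measurable M"
  unfolding V_def by (rule F_imp_M[OF measurable_time_integral[OF progressive_H_sq]])

lemma I_meas: "0 \<le> t \<Longrightarrow> I t \<in> borel_measurable M"
  using ito by (simp add: is_ito_integral_def)

lemma Z_eq: "0 \<le> t \<Longrightarrow> \<omega> \<in> space M \<Longrightarrow>
    Z t \<omega> = x + time_integral (\<lambda>s \<omega>. mu D (retention p s \<omega>) - \<delta>) t \<omega> + I t \<omega>"
  unfolding Z by (subst interval_integral_eq_time_integral) auto

text \<open>The accumulated rate is what remains of the exponent of \<open>Y\<close>, apart from the
  initial value, once the exponential martingale with its compensator
  \<open>\<kappa>^2 / 2 * V\<close> is split off.\<close>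

lemma time_integral_\<rho>:
  assumes "0 \<le> t" "\<omega> \<in> space M"
  shows "time_integral \<rho> t \<omega>
    = \<kappa>\<^sup>2 / 2 * V t \<omega> - \<kappa> * time_integral (\<lambda>s \<omega>. mu D (retention p s \<omega>) - \<delta>) t \<omega> - r * t"
proof -
  let ?v = "\<lambda>s. if 0 < s \<and> s \<le> t then (H s \<omega>)\<^sup>2 else 0"
  let ?m = "\<lambda>s. if 0 < s \<and> s \<le> t then mu D (retention p s \<omega>) - \<delta> else 0"
  have int: "integrable lborel ?v" "integrable lborel ?m" "integrable lborel (indicator {0<..t} :: real \<Rightarrow> real)"
    using assms integrable_time[OF progressive_H_sq assms H_sq_abs[OF _ assms(2)]]
      integrable_time[OF progressive_drift assms drift_bound[OF _ assms(2)]] by auto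
  have "time_integral \<rho> t \<omega> = (\<integral>s. \<kappa>\<^sup>2 / 2 * ?v s - \<kappa> * ?m s - r * indicator {0<..t} s \<partial>lborel)"
    unfolding time_integral_def
    by (intro Bochner_Integration.integral_cong) (auto simp: \<rho>_def rate_def H_def indicator_def)
  also have "\<dots> = \<kappa>\<^sup>2 / 2 * (\<integral>s. ?v s \<partial>lborel) - \<kappa> * (\<integral>s. ?m s \<partial>lborel) - r * t"
    using int assms(1) by (simp del: integral_mult_right_zero integral_divide_zero add: integral_mult_right)
  finally show ?thesis by (simp add: V_def time_integral_def)
qed

lemma Y_eq:
  assumes "0 \<le> t" "\<omega> \<in> space M"
  shows "Y t \<omega> = exp (- \<kappa> * x) * (A t \<omega> * exp (- \<kappa> * I t \<omega> - \<kappa>\<^sup>2 / 2 * V t \<omega>))"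
  unfolding Y_def A_def time_integral_\<rho>[OF assms] Z_eq[OF assms] exp_add[symmetric]
  by (simp add: algebra_simps)

lemmas exp_martingale = ito_exp_martingale[OF ito[folded H_def] progressive_H H_bounds, folded V_def]

lemma Y_weighted:
  assumes G: "G \<in> borel_measurable M" and "0 \<le> t" "\<And>\<omega>. \<omega> \<in> space M \<Longrightarrow> 0 \<le> G \<omega>"
  shows "(\<integral>\<^sup>+\<omega>. ennreal (G \<omega> * Y t \<omega>) \<partial>M)
    = ennreal (exp (- \<kappa> * x)) * (\<integral>\<^sup>+\<omega>. ennreal ((G \<omega> * A t \<omega>) * exp (- \<kappa> * I t \<omega> - \<kappa>\<^sup>2 / 2 * V t \<omega>)) \<partial>M)"
proof -
  note [measurable] = G I_meas[OF assms(2)] V_meas[OF assms(2)] F_imp_M[OF A_meas[OF assms(2)]]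
  have "(\<integral>\<^sup>+\<omega>. ennreal (G \<omega> * Y t \<omega>) \<partial>M)
      = (\<integral>\<^sup>+\<omega>. ennreal (exp (- \<kappa> * x)) * ennreal ((G \<omega> * A t \<omega>) * exp (- \<kappa> * I t \<omega> - \<kappa>\<^sup>2 / 2 * V t \<omega>)) \<partial>M)"
    using assms by (intro nn_integral_cong) (simp add: Y_eq ennreal_mult[symmetric] A_def mult_ac)
  also have "\<dots> = ennreal (exp (- \<kappa> * x)) * (\<integral>\<^sup>+\<omega>. ennreal ((G \<omega> * A t \<omega>) * exp (- \<kappa> * I t \<omega> - \<kappa>\<^sup>2 / 2 * V t \<omega>)) \<partial>M)"
    by (rule nn_integral_cmult) measurable
  finally show ?thesis .
qed

text \<open>The factor \<open>A s\<close> is known at \<open>s\<close> and joins the weight; the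
  martingale identity moves the exponential to \<open>t\<close>, and then \<open>A s\<close> is
  enlarged to \<open>A t\<close>.\<close>

lemma Y_submartingale:
  assumes st: "0 \<le> s" "s \<le> t" and G: "G \<in> borel_measurable (F (ennreal s))"
    and G01: "\<And>\<omega>. \<omega> \<in> space M \<Longrightarrow> 0 \<le> G \<omega> \<and> G \<omega> \<le> 1"
  shows "(\<integral>\<^sup>+\<omega>. ennreal (G \<omega> * Y s \<omega>) \<partial>M) \<le> (\<integral>\<^sup>+\<omega>. ennreal (G \<omega> * Y t \<omega>) \<partial>M)"
proof -
  have GA: "0 \<le> G \<omega> * A s \<omega> \<and> G \<omega> * A s \<omega> \<le> exp (L * s)" if "\<omega> \<in> space M" for \<omega>
    using G01[OF that] A_bounds[OF st(1) that] mult_mono[of "G \<omega>" 1 "A s \<omega>" "exp (L * s)"]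
    by (auto simp: A_def)
  have "(\<integral>\<^sup>+\<omega>. ennreal ((G \<omega> * A s \<omega>) * exp (- \<kappa> * I s \<omega> - \<kappa>\<^sup>2 / 2 * V s \<omega>)) \<partial>M)
      = (\<integral>\<^sup>+\<omega>. ennreal ((G \<omega> * A s \<omega>) * exp (- \<kappa> * I t \<omega> - \<kappa>\<^sup>2 / 2 * V t \<omega>)) \<partial>M)"
    using G A_meas[OF st(1)] by (intro exp_martingale[OF _ _ st _ GA, symmetric]) auto
  also have "\<dots> \<le> (\<integral>\<^sup>+\<omega>. ennreal ((G \<omega> * A t \<omega>) * exp (- \<kappa> * I t \<omega> - \<kappa>\<^sup>2 / 2 * V t \<omega>)) \<partial>M)"
    using G01 A_mono[OF st] by (intro nn_integral_mono ennreal_leI mult_right_mono mult_left_mono) auto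
  finally show ?thesis
    using st G01 by (simp add: Y_weighted F_imp_M[OF G] mult_left_mono)
qed

text \<open>Under this retention the rate is 0, so \<open>A\<close> is identically 1 and the
  inequality \<open>A s \<le> A t\<close> loses nothing.\<close>

lemma Y_martingale:
  assumes const: "\<And>s \<omega>. 0 < s \<Longrightarrow> \<omega> \<in> space M \<Longrightarrow> retention p s \<omega> = ereal (1 / \<kappa>)"
    and st: "0 \<le> s" "s \<le> t" and G: "G \<in> borel_measurable (F (ennreal s))"
    and G01: "\<And>\<omega>. \<omega> \<in> space M \<Longrightarrow> 0 \<le> G \<omega> \<and> G \<omega> \<le> 1"
  shows "(\<integral>\<^sup>+\<omega>. ennreal (G \<omega> * Y s \<omega>) \<partial>M) = (\<integral>\<^sup>+\<omega>. ennreal (G \<omega> * Y t \<omega>) \<partial>M)"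
proof -
  have A1: "A u \<omega> = 1" if "\<omega> \<in> space M" for u \<omega>
  proof -
    have "time_integral \<rho> u \<omega> = time_integral (\<lambda>_ _. 0) u \<omega>"
      using const[OF _ that] by (intro time_integral_cong) (simp add: \<rho>_def rate_min)
    then show ?thesis by (simp add: A_def time_integral_def)
  qed
  have "(\<integral>\<^sup>+\<omega>. ennreal (G \<omega> * exp (- \<kappa> * I s \<omega> - \<kappa>\<^sup>2 / 2 * V s \<omega>)) \<partial>M)
      = (\<integral>\<^sup>+\<omega>. ennreal (G \<omega> * exp (- \<kappa> * I t \<omega> - \<kappa>\<^sup>2 / 2 * V t \<omega>)) \<partial>M)"
    by (rule exp_martingale[OF _ _ st G G01, symmetric])
  then show ?thesis
    using st G01 by (simp add: Y_weighted F_imp_M[OF G] A1 cong: nn_integral_cong)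
qed

text \<open>Squaring the exponential martingale with parameter \<open>\<kappa>\<close> gives the one with parameter
  \<open>2 \<kappa>\<close>, up to a bounded factor.\<close>

lemma Y_square:
  assumes T: "0 \<le> T"
  shows "\<exists>K U. square_dominated Y T K U"
proof -
  define E where "E t \<omega> = exp (- (2 * \<kappa>) * I t \<omega> - (2 * \<kappa>)\<^sup>2 / 2 * V t \<omega>)" for t \<omega>
  \<comment> \<open>The three terms come from the initial value, from \<open>A^2\<close>, and from
    the excess \<open>exp (\<kappa>^2 V)\<close> left over by squaring.\<close>
  define K where "K = exp (- (2 * \<kappa> * x) + 2 * L * T + \<kappa>\<^sup>2 * C\<^sup>2 * T)"
  have E_meas: "E t \<in> borel_measurable M" if "0 \<le> t" for t
  proof -
    note [measurable] = I_meas[OF that] V_meas[OF that]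
    show ?thesis unfolding E_def[abs_def] by measurable
  qed
  have mart: "(\<integral>\<^sup>+\<omega>. ennreal (G \<omega> * E t \<omega>) \<partial>M) = (\<integral>\<^sup>+\<omega>. ennreal (G \<omega> * E s \<omega>) \<partial>M)"
    if "0 \<le> s" "s \<le> t" "G \<in> borel_measurable (F (ennreal s))" "\<And>\<omega>. \<omega> \<in> space M \<Longrightarrow> 0 \<le> G \<omega> \<and> G \<omega> \<le> 1" for s t G
    unfolding E_def by (rule exp_martingale[OF _ _ that])
  have "(\<integral>\<^sup>+\<omega>. ennreal (1 * E T \<omega>) \<partial>M) = (\<integral>\<^sup>+\<omega>. ennreal (1 * E 0 \<omega>) \<partial>M)"
    using T by (intro mart) auto
  also have "\<dots> = (\<integral>\<^sup>+\<omega>. 1 \<partial>M)"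
  proof (rule nn_integral_cong_AE)
    have "AE \<omega> in M. I 0 \<omega> = 0"
      by (rule ito_integral_0[OF ito[folded H_def] progressive_H H_bounds])
    then show "AE \<omega> in M. ennreal (1 * E 0 \<omega>) = 1"
      by eventually_elim (simp add: E_def V_def time_integral_0)
  qed
  finally have U1: "(\<integral>\<^sup>+\<omega>. ennreal (E T \<omega>) \<partial>M) = 1" by (simp add: emeasure_space_1)
  have "(\<integral>\<^sup>+\<omega>. ennreal (G \<omega> * (Y t \<omega>)\<^sup>2) \<partial>M) \<le> ennreal K * (\<integral>\<^sup>+\<omega>. ennreal (G \<omega>) * ennreal (E T \<omega>) \<partial>M)"
    if t: "0 \<le> t" "t \<le> T" and G: "G \<in> borel_measurable (F (ennreal t))"
      and G01: "\<forall>\<omega>\<in>space M. 0 \<le> G \<omega> \<and> G \<omega> \<le> 1" for t G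
  proof -
    note [measurable] = F_imp_M[OF G] E_meas[OF t(1)] E_meas[OF T]
    have sq: "(Y t \<omega>)\<^sup>2 \<le> K * E t \<omega>" if \<omega>: "\<omega> \<in> space M" for \<omega>
    proof -
      have "time_integral \<rho> t \<omega> \<le> L * t" using A_bounds(2)[OF t(1) \<omega>] by (simp add: A_def)
      also have "\<dots> \<le> L * T" using t L_nonneg by (intro mult_left_mono)
      finally have 1: "time_integral \<rho> t \<omega> \<le> L * T" .
      have "\<kappa>\<^sup>2 * V t \<omega> \<le> \<kappa>\<^sup>2 * (C\<^sup>2 * T)"
        using V_bounds(2)[OF t(1) \<omega>] mult_left_mono[OF t(2), of "C\<^sup>2"] by (intro mult_left_mono) auto
      with 1 show ?thesis
        unfolding Y_eq[OF t(1) \<omega>] K_def E_def A_def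
        by (simp add: exp_add[symmetric] power2_eq_square algebra_simps)
    qed
    have "(\<integral>\<^sup>+\<omega>. ennreal (G \<omega> * (Y t \<omega>)\<^sup>2) \<partial>M) \<le> (\<integral>\<^sup>+\<omega>. ennreal K * ennreal (G \<omega> * E t \<omega>) \<partial>M)"
    proof (rule nn_integral_mono)
      fix \<omega> assume \<omega>: "\<omega> \<in> space M"
      have "G \<omega> * (Y t \<omega>)\<^sup>2 \<le> G \<omega> * (K * E t \<omega>)"
        using sq[OF \<omega>] G01 \<omega> by (intro mult_left_mono) auto
      then show "ennreal (G \<omega> * (Y t \<omega>)\<^sup>2) \<le> ennreal K * ennreal (G \<omega> * E t \<omega>)"
        using G01 \<omega> by (simp add: ennreal_mult[symmetric] K_def E_def ennreal_leI mult_ac)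
    qed
    also have "\<dots> = ennreal K * (\<integral>\<^sup>+\<omega>. ennreal (G \<omega> * E t \<omega>) \<partial>M)"
      by (rule nn_integral_cmult) measurable
    \<comment> \<open>The dominating variable has to be the same for all \<open>t\<close>, hence the
      move to the final time \<open>T\<close>.\<close>
    also have "(\<integral>\<^sup>+\<omega>. ennreal (G \<omega> * E t \<omega>) \<partial>M) = (\<integral>\<^sup>+\<omega>. ennreal (G \<omega> * E T \<omega>) \<partial>M)"
      using G01 by (intro mart[OF t G, symmetric]) auto
    also have "\<dots> = (\<integral>\<^sup>+\<omega>. ennreal (G \<omega>) * ennreal (E T \<omega>) \<partial>M)"
      using G01 by (intro nn_integral_cong) (simp add: ennreal_mult E_def)
    finally show ?thesis .
  qed
  then show ?thesis
    unfolding square_dominated_def using U1 E_meas[OF T] by (intro exI[of _ K] exI[of _ "\<lambda>\<omega>. ennreal (E T \<omega>)"]) auto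
qed

lemma exp_surplus: "exp_surplus M F w Z x \<kappa> r"
proof (unfold_locales)
  show "0 < \<kappa>" "0 < r" by (fact \<kappa>, fact r)
  show "continuous_on {0..} (\<lambda>t. Z t \<omega>)" if \<omega>: "\<omega> \<in> space M" for \<omega>
  proof -
    have "continuous_on {0..} (\<lambda>t. x + time_integral (\<lambda>s \<omega>. mu D (retention p s \<omega>) - \<delta>) t \<omega> + I t \<omega>)"
      using ito \<omega> continuous_time_integral[OF progressive_drift \<omega> drift_bound[OF _ \<omega>]]
      by (intro continuous_intros) (auto simp: is_ito_integral_def)
    then show ?thesis using Z_eq[OF _ \<omega>] by (subst continuous_on_cong[OF refl]) auto
  qed
  show "Z t \<in> borel_measurable M" if "0 \<le> t" for t
  proof -
    note [measurable] = I_meas[OF that] F_imp_M[OF measurable_time_integral[OF progressive_drift that]]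
    have "(\<lambda>\<omega>. x + time_integral (\<lambda>s \<omega>. mu D (retention p s \<omega>) - \<delta>) t \<omega> + I t \<omega>) \<in> borel_measurable M"
      by measurable
    then show ?thesis by (rule measurable_cong[THEN iffD1, rotated]) (simp add: Z_eq[OF that])
  qed
  have "AE \<omega> in M. I 0 \<omega> = 0"
    by (rule ito_integral_0[OF ito[folded H_def] progressive_H H_bounds])
  then show "AE \<omega> in M. Z 0 \<omega> = x"
    using AE_space by eventually_elim (simp add: Z_eq time_integral_0)
qed (use Y_submartingale Y_square in \<open>auto simp: Y_def[abs_def]\<close>)

end

section \<open>The lower bound\<close>

text \<open>The mesh is \<open>1 / Suc n\<close>, so every integer horizon is a grid point for all
  \<open>n\<close>.\<close>

definition grid :: "nat \<Rightarrow> nat \<Rightarrow> real" where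
  "grid n k = real k / real (Suc n)"

text \<open>For \<open>\<tau> = \<infinity>\<close> no grid point qualifies and the value is
  unspecified; it is used only below a finite horizon.\<close>

definition grid_ceil :: "nat \<Rightarrow> ennreal \<Rightarrow> nat" where
  "grid_ceil n \<tau> = (LEAST k. \<tau> \<le> ennreal (grid n k))"

text \<open>A time is rounded to the right end of its cell, so membership is decided by the
  information available at that grid point. Cell 0 contains only the time 0.\<close>

definition in_cell :: "nat \<Rightarrow> nat \<Rightarrow> ennreal \<Rightarrow> bool" where
  "in_cell n k \<tau> \<longleftrightarrow> \<tau> \<le> ennreal (grid n k) \<and> (\<forall>j<k. ennreal (grid n j) < \<tau>)"

lemma grid_nonneg [simp]: "0 \<le> grid n k"
  by (simp add: grid_def)

lemma grid_0 [simp]: "grid n 0 = 0"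
  by (simp add: grid_def)

lemma grid_mono: "j \<le> k \<Longrightarrow> grid n j \<le> grid n k"
  by (simp add: grid_def divide_right_mono)

lemma grid_end [simp]: "grid n (T * Suc n) = real T"
  by (simp add: grid_def field_simps)

lemma in_cell_unique: "in_cell n k \<tau> \<Longrightarrow> k = grid_ceil n \<tau>"
  unfolding in_cell_def grid_ceil_def
  by (rule Least_equality[symmetric]) (auto simp: not_less[symmetric])

lemma grid_ceil:
  assumes "0 \<le> t"
  shows "in_cell n (grid_ceil n (ennreal t)) (ennreal t)"
    "t \<le> grid n (grid_ceil n (ennreal t))" "grid n (grid_ceil n (ennreal t)) \<le> t + 1 / real (Suc n)"
proof -
  obtain k :: nat where "t * real (Suc n) \<le> real k" using real_arch_simple by blast
  then have "ennreal t \<le> ennreal (grid n k)"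
    by (intro ennreal_leI) (simp add: grid_def field_simps)
  then have 1: "ennreal t \<le> ennreal (grid n (grid_ceil n (ennreal t)))"
    unfolding grid_ceil_def by (rule LeastI)
  have 2: "ennreal (grid n j) < ennreal t" if "j < grid_ceil n (ennreal t)" for j
    using not_less_Least[OF that[unfolded grid_ceil_def]] by (simp only: not_le)
  show "in_cell n (grid_ceil n (ennreal t)) (ennreal t)"
    using 1 2 by (simp add: in_cell_def)
  show "t \<le> grid n (grid_ceil n (ennreal t))" using 1 assms by simp
  show "grid n (grid_ceil n (ennreal t)) \<le> t + 1 / real (Suc n)"
  proof (cases "grid_ceil n (ennreal t)")
    case 0
    then show ?thesis using assms by simp
  next
    case (Suc j)
    then have "grid n j < t" using 2[of j] assms by (simp add: ennreal_less_iff)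
    then show ?thesis using Suc by (simp add: grid_def add_divide_distrib)
  qed
qed

lemma grid_ceil_tendsto:
  assumes "0 \<le> t"
  shows "(\<lambda>n. grid n (grid_ceil n (ennreal t))) \<longlonglongrightarrow> t"
proof (rule tendsto_sandwich[of "\<lambda>_. t"])
  show "(\<lambda>n. t + 1 / real (Suc n)) \<longlonglongrightarrow> t"
    using tendsto_add[OF tendsto_const[of t] LIMSEQ_inverse_real_of_nat] by (simp add: inverse_eq_divide)
qed (use grid_ceil[OF assms] in \<open>simp_all add: always_eventually\<close>)

text \<open>Exactly one cell contains a given time up to the horizon, and none of these cells a
  later time. A sum over deterministic grid times thereby evaluates \<open>f\<close> at the rounded
  random time.\<close>

lemma sum_in_cell:
  fixes f :: "nat \<Rightarrow> real"
  shows "(\<Sum>k\<le>T * Suc n. f k * of_bool (in_cell n k \<tau>)) = (if \<tau> \<le> ennreal (real T) then f (grid_ceil n \<tau>) else 0)"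
proof (cases "\<tau> \<le> ennreal (real T)")
  case True
  then have "\<tau> \<noteq> top" by (auto simp: top_unique)
  then obtain t where t: "0 \<le> t" "\<tau> = ennreal t"
    by (cases \<tau>) simp_all
  have "grid_ceil n \<tau> \<le> T * Suc n"
    unfolding grid_ceil_def using True by (intro Least_le) (simp only: grid_end)
  moreover have "in_cell n k \<tau> \<longleftrightarrow> k = grid_ceil n \<tau>" for k
    using grid_ceil(1)[OF t(1), of n] in_cell_unique[of n k \<tau>] unfolding t(2) by metis
  then have "f k * of_bool (in_cell n k \<tau>) = (if k = grid_ceil n \<tau> then f k else 0)" for k
    by simp
  ultimately show ?thesis using True by simp
next
  case False
  have "\<not> in_cell n k \<tau>" if "k \<le> T * Suc n" for k
  proof
    assume "in_cell n k \<tau>"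
    then have "\<tau> \<le> ennreal (grid n k)" by (simp add: in_cell_def)
    also have "\<dots> \<le> ennreal (real T)"
      using grid_mono[OF that, of n] by (intro ennreal_leI) (simp only: grid_end)
    finally show False using False by simp
  qed
  then show ?thesis using False by simp
qed

text \<open>Links the cells with the decrements of the injection factor over one grid step; the jump
  at time 0 is treated separately.\<close>

lemma of_bool_le_grid_diff:
  "of_bool (\<tau> \<le> ennreal (grid n (Suc k))) - of_bool (\<tau> \<le> ennreal (grid n k)) = (of_bool (in_cell n (Suc k) \<tau>) :: real)"
proof -
  have le: "ennreal (grid n j) \<le> ennreal (grid n k)" if "j \<le> k" for j k
    using grid_mono[OF that] by (rule ennreal_leI)
  have "(\<forall>j<Suc k. ennreal (grid n j) < \<tau>) \<longleftrightarrow> ennreal (grid n k) < \<tau>"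
    using le_less_trans[OF le] by (meson lessI less_Suc_eq_le)
  then have "in_cell n (Suc k) \<tau> \<longleftrightarrow> \<tau> \<le> ennreal (grid n (Suc k)) \<and> ennreal (grid n k) < \<tau>"
    unfolding in_cell_def by blast
  then show ?thesis
    using le[of k "Suc k"] by (auto simp: not_less intro: order_trans)
qed

lemma of_bool_le_grid_0: "of_bool (\<tau> \<le> ennreal (grid n 0)) = (of_bool (in_cell n 0 \<tau>) :: real)"
  by (simp add: in_cell_def)

text \<open>Cauchy-Schwarz with each weight split into two square roots; the second factor is then
  the total weight.\<close>

lemma weighted_sum_square_le:
  fixes y d :: "'b \<Rightarrow> real"
  assumes "\<And>k. k \<in> S \<Longrightarrow> 0 \<le> d k" "sum d S \<le> 1"
  shows "(\<Sum>k\<in>S. y k * d k)\<^sup>2 \<le> (\<Sum>k\<in>S. d k * (y k)\<^sup>2)"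
proof -
  have "(\<Sum>k\<in>S. y k * d k)\<^sup>2 = (\<Sum>k\<in>S. (y k * sqrt (d k)) * sqrt (d k))\<^sup>2"
    using assms(1) by (intro arg_cong[where f="\<lambda>x. x\<^sup>2"] sum.cong) (auto simp: mult.assoc)
  also have "\<dots> \<le> (\<Sum>k\<in>S. (y k * sqrt (d k))\<^sup>2) * (\<Sum>k\<in>S. (sqrt (d k))\<^sup>2)"
    by (rule Cauchy_Schwarz_ineq_sum)
  also have "\<dots> = (\<Sum>k\<in>S. d k * (y k)\<^sup>2) * sum d S"
    using assms(1) by (intro arg_cong2[where f="(*)"] sum.cong) (auto simp: power_mult_distrib mult.commute)
  also have "\<dots> \<le> (\<Sum>k\<in>S. d k * (y k)\<^sup>2) * 1"
    using assms by (intro mult_left_mono sum_nonneg) auto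
  finally show ?thesis by simp
qed

section \<open>Integration by parts against the injections\<close>

locale injections = filtered_brownian_motion M F w
  for M :: "'a measure" and F :: "ennreal \<Rightarrow> 'a measure" and w :: "real \<Rightarrow> 'a \<Rightarrow> real" +
  fixes \<tau> :: "nat \<Rightarrow> 'a \<Rightarrow> ennreal" and \<xi> :: "nat \<Rightarrow> 'a \<Rightarrow> real"
  assumes stop: "\<And>i. stopping_time F (\<tau> i)"
    and tau_Suc: "\<And>i \<omega>. \<omega> \<in> space M \<Longrightarrow> \<tau> i \<omega> \<le> \<tau> (Suc i) \<omega>"
    and size_meas: "\<And>i. \<xi> i \<in> borel_measurable (filtration.pre_sigma (space M) F (\<tau> i))"
    and size_pos: "\<And>i \<omega>. \<omega> \<in> space M \<Longrightarrow> 0 < \<xi> i \<omega>"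
begin

lemma tau_mono: "\<omega> \<in> space M \<Longrightarrow> i \<le> j \<Longrightarrow> \<tau> i \<omega> \<le> \<tau> j \<omega>"
  by (rule lift_Suc_mono_le[of "\<lambda>i. \<tau> i \<omega>"]) (rule tau_Suc)

lemma tau_M: "\<tau> i \<in> borel_measurable M"
  using measurable_stopping_time[OF stop, of M] sets_F_le by simp

lemma size_M: "\<xi> i \<in> borel_measurable M"
proof -
  have "sets (filtration.pre_sigma (space M) F (\<tau> i)) \<subseteq> sets M"
  proof
    fix A assume "A \<in> sets (filtration.pre_sigma (space M) F (\<tau> i))"
    from filtration.sets_pre_sigmaD[OF filtration_F stop this, of top]
    show "A \<in> sets M" using sets_F_le by auto
  qed
  then show ?thesis
    using size_meas[of i] by (auto simp: measurable_def filtration.space_pre_sigma[OF filtration_F])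
qed

lemma stop_pred: "0 \<le> t \<Longrightarrow> Measurable.pred (F (ennreal t)) (\<lambda>\<omega>. \<tau> i \<omega> \<le> ennreal t)"
  by (rule stopping_timeD[OF stop])

text \<open>The stopped sigma-algebra controls \<open>\<xi> i\<close> on the event
  \<open>\<tau> i \<le> t\<close>; off this event the variable is constantly 0, whence the
  distinction whether \<open>0 \<in> B\<close>.\<close>

lemma size_stopped_measurable:
  "(\<lambda>\<omega>. if \<tau> i \<omega> \<le> ennreal t then \<xi> i \<omega> else 0) \<in> borel_measurable (F (ennreal t))"
proof (rule measurableI)
  fix B :: "real set" assume B: "B \<in> sets borel"
  have "\<xi> i -` B \<inter> space M \<in> sets (filtration.pre_sigma (space M) F (\<tau> i))"
    using measurable_sets[OF size_meas B, of i] by (simp add: filtration.space_pre_sigma[OF filtration_F])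
  from filtration.sets_pre_sigmaD[OF filtration_F stop this]
  have 1: "{\<omega> \<in> \<xi> i -` B \<inter> space M. \<tau> i \<omega> \<le> ennreal t} \<in> sets (F (ennreal t))" .
  have 2: "{\<omega> \<in> space M. \<tau> i \<omega> \<le> ennreal t} \<in> sets (F (ennreal t))"
    using stopping_timeD[OF stop, of i "ennreal t"] by (simp add: pred_def)
  have "(\<lambda>\<omega>. if \<tau> i \<omega> \<le> ennreal t then \<xi> i \<omega> else 0) -` B \<inter> space (F (ennreal t))
      = {\<omega> \<in> \<xi> i -` B \<inter> space M. \<tau> i \<omega> \<le> ennreal t} \<union>
        (if 0 \<in> B then space (F (ennreal t)) - {\<omega> \<in> space M. \<tau> i \<omega> \<le> ennreal t} else {})"
    by (auto split: if_splits)
  also have "\<dots> \<in> sets (F (ennreal t))" using 1 sets.compl_sets[OF 2] by auto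
  finally show "(\<lambda>\<omega>. if \<tau> i \<omega> \<le> ennreal t then \<xi> i \<omega> else 0) -` B \<inter> space (F (ennreal t)) \<in> sets (F (ennreal t))" .
qed simp

end

locale injected_surplus = exp_surplus M F w Z x \<kappa> r Y + injections M F w \<tau> \<xi>
  for M :: "'a measure" and F :: "ennreal \<Rightarrow> 'a measure" and w :: "real \<Rightarrow> 'a \<Rightarrow> real"
    and Z :: "real \<Rightarrow> 'a \<Rightarrow> real" and x \<kappa> r :: real and Y :: "real \<Rightarrow> 'a \<Rightarrow> real"
    and \<tau> :: "nat \<Rightarrow> 'a \<Rightarrow> ennreal" and \<xi> :: "nat \<Rightarrow> 'a \<Rightarrow> real"
begin

text \<open>The factor by which the first \<open>i\<close> injections multiply
  \<open>exp (- \<kappa> * Z)\<close>; it is unrelated to discounting in time.\<close>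

definition discount :: "nat \<Rightarrow> 'a \<Rightarrow> real" where
  "discount i \<omega> = exp (- \<kappa> * (\<Sum>j<i. \<xi> j \<omega>))"

definition discount_drop :: "nat \<Rightarrow> 'a \<Rightarrow> real" where
  "discount_drop i \<omega> = discount i \<omega> - discount (Suc i) \<omega>"

text \<open>The exponential of \<open>-\<kappa>\<close> times the amount injected up to time \<open>t\<close> by the first \<open>m\<close> injections.\<close>

definition decay :: "nat \<Rightarrow> real \<Rightarrow> 'a \<Rightarrow> real" where
  "decay m t \<omega> = 1 - (\<Sum>i<m. discount_drop i \<omega> * of_bool (\<tau> i \<omega> \<le> ennreal t))"

lemma drop_nonneg: "\<omega> \<in> space M \<Longrightarrow> 0 \<le> discount_drop i \<omega>"
  using size_pos[of \<omega> i] \<kappa>_pos by (simp add: discount_drop_def discount_def)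

lemma sum_drop: "(\<Sum>i<m. discount_drop i \<omega>) = 1 - discount m \<omega>"
  by (induction m) (auto simp: discount_drop_def discount_def)

lemma sum_drop_le: "(\<Sum>i<m. discount_drop i \<omega>) \<le> 1"
  unfolding sum_drop by (simp add: discount_def)

lemma sum_drop_bool:
  assumes "\<omega> \<in> space M"
  shows "0 \<le> (\<Sum>i<m. discount_drop i \<omega> * of_bool (P i))" "(\<Sum>i<m. discount_drop i \<omega> * of_bool (P i)) \<le> 1"
proof -
  show "0 \<le> (\<Sum>i<m. discount_drop i \<omega> * of_bool (P i))"
    using drop_nonneg[OF assms] by (intro sum_nonneg) auto
  have "(\<Sum>i<m. discount_drop i \<omega> * of_bool (P i)) \<le> (\<Sum>i<m. discount_drop i \<omega>)"
    using drop_nonneg[OF assms] by (intro sum_mono) auto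
  then show "(\<Sum>i<m. discount_drop i \<omega> * of_bool (P i)) \<le> 1"
    using sum_drop_le by (rule order_trans)
qed

lemma decay_bounds:
  assumes "\<omega> \<in> space M"
  shows "0 \<le> decay m t \<omega> \<and> decay m t \<omega> \<le> 1"
  using sum_drop_bool[OF assms, of "\<lambda>i. \<tau> i \<omega> \<le> ennreal t" m] by (simp add: decay_def)

text \<open>The drop alone may be unknown at \<open>t\<close>. On the event, all earlier injections
  have occurred as well, since the times are ordered, so the sizes may be replaced by their stopped
  versions.\<close>

lemma drop_measurable:
  assumes "0 \<le> t"
  shows "(\<lambda>\<omega>. discount_drop i \<omega> * of_bool (\<tau> i \<omega> \<le> ennreal t)) \<in> borel_measurable (F (ennreal t))"
proof -
  let ?\<xi> = "\<lambda>j \<omega>. if \<tau> j \<omega> \<le> ennreal t then \<xi> j \<omega> else 0"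
  note [measurable] = size_stopped_measurable[of _ t] stop_pred[OF assms]
  have "(\<lambda>\<omega>. (exp (- \<kappa> * (\<Sum>j<i. ?\<xi> j \<omega>)) - exp (- \<kappa> * (\<Sum>j<Suc i. ?\<xi> j \<omega>))) * of_bool (\<tau> i \<omega> \<le> ennreal t))
      \<in> borel_measurable (F (ennreal t))"
    unfolding of_bool_def by measurable
  moreover have "discount_drop i \<omega> * of_bool (\<tau> i \<omega> \<le> ennreal t)
      = (exp (- \<kappa> * (\<Sum>j<i. ?\<xi> j \<omega>)) - exp (- \<kappa> * (\<Sum>j<Suc i. ?\<xi> j \<omega>))) * of_bool (\<tau> i \<omega> \<le> ennreal t)"
    if "\<omega> \<in> space M" for \<omega>
  proof (cases "\<tau> i \<omega> \<le> ennreal t")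
    case True
    have "?\<xi> j \<omega> = \<xi> j \<omega>" if "j \<le> i" for j
      using order_trans[OF tau_mono[OF \<open>\<omega> \<in> space M\<close> that] True] by simp
    then show ?thesis by (simp add: discount_drop_def discount_def)
  qed simp
  ultimately show ?thesis by (rule measurable_cong[THEN iffD2, rotated]) simp
qed

lemma decay_measurable: "0 \<le> t \<Longrightarrow> decay m t \<in> borel_measurable (F (ennreal t))"
  unfolding decay_def[abs_def] by (intro borel_measurable_diff borel_measurable_sum drop_measurable) auto

lemma Y_pos: "0 < Y t \<omega>" by (simp add: Y_def)

lemma Y_meas: "0 \<le> t \<Longrightarrow> Y t \<in> borel_measurable M"
  unfolding Y_def using Z_meas[of t] by measurable

lemma Y_tendsto:
  assumes "\<omega> \<in> space M" "0 \<le> t" "s \<longlonglongrightarrow> t" "\<And>n. 0 \<le> s n"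
  shows "(\<lambda>n. Y (s n) \<omega>) \<longlonglongrightarrow> Y t \<omega>"
proof -
  have "(\<lambda>n. Z (s n) \<omega>) \<longlonglongrightarrow> Z t \<omega>"
    using continuous_on_tendsto_compose[OF Z_cont[OF assms(1)] assms(3)] assms(2,4) by simp
  then show ?thesis unfolding Y_def using assms(3) by (intro tendsto_intros)
qed

lemma Y_0: "(\<integral>\<^sup>+\<omega>. ennreal (Y 0 \<omega>) \<partial>M) = ennreal (exp (- \<kappa> * x))"
proof -
  have "(\<integral>\<^sup>+\<omega>. ennreal (Y 0 \<omega>) \<partial>M) = (\<integral>\<^sup>+\<omega>. ennreal (exp (- \<kappa> * x)) \<partial>M)"
    using Z_0 by (intro nn_integral_cong_AE) (auto simp: Y_def)
  then show ?thesis by (simp add: emeasure_space_1)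
qed

text \<open>Only the decrements of \<open>decay\<close> remain since \<open>Y\<close> is a
  submartingale.\<close>

lemma grid_integration_by_parts:
  fixes n m :: nat
  defines "t \<equiv> grid n"
  defines "d \<equiv> \<lambda>k \<omega>. \<Sum>i<m. discount_drop i \<omega> * of_bool (in_cell n k (\<tau> i \<omega>))"
  shows "(\<integral>\<^sup>+\<omega>. ennreal (Y 0 \<omega>) \<partial>M) \<le> (\<integral>\<^sup>+\<omega>. ennreal (decay m (t k) \<omega> * Y (t k) \<omega>) \<partial>M)
    + (\<Sum>j\<le>k. \<integral>\<^sup>+\<omega>. ennreal (d j \<omega> * Y (t j) \<omega>) \<partial>M)"
    and "d k \<in> borel_measurable (F (ennreal (t k)))"
proof -
  have d0: "d 0 \<omega> = 1 - decay m (t 0) \<omega>" for \<omega>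
    unfolding d_def decay_def t_def of_bool_le_grid_0 by simp
  have dS: "d (Suc k) \<omega> = decay m (t k) \<omega> - decay m (t (Suc k)) \<omega>" for k \<omega>
    unfolding d_def decay_def t_def
    unfolding of_bool_le_grid_diff[symmetric] right_diff_distrib sum_subtractf by simp
  have tpos: "0 \<le> t k" for k by (simp add: t_def)
  have d01: "0 \<le> d k \<omega>" "d k \<omega> \<le> 1" if "\<omega> \<in> space M" for k \<omega>
    using sum_drop_bool[OF that] by (auto simp: d_def)
  show d_meas: "d k \<in> borel_measurable (F (ennreal (t k)))" for k
  proof (cases k)
    case 0
    have "(\<lambda>\<omega>. 1 - decay m (t 0) \<omega>) \<in> borel_measurable (F (ennreal (t 0)))"
      using decay_measurable[OF tpos] by measurable
    moreover have "d k = (\<lambda>\<omega>. 1 - decay m (t 0) \<omega>)" using 0 d0 by (simp add: fun_eq_iff)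
    ultimately show ?thesis using 0 by simp
  next
    case (Suc j)
    have [measurable]: "decay m (t j) \<in> borel_measurable (F (ennreal (t k)))"
      by (rule F_mono[OF _ decay_measurable[OF tpos]]) (simp add: Suc t_def ennreal_leI grid_mono)
    have [measurable]: "decay m (t k) \<in> borel_measurable (F (ennreal (t k)))"
      by (rule decay_measurable[OF tpos])
    have "(\<lambda>\<omega>. decay m (t j) \<omega> - decay m (t k) \<omega>) \<in> borel_measurable (F (ennreal (t k)))"
      by measurable
    moreover have "d k = (\<lambda>\<omega>. decay m (t j) \<omega> - decay m (t k) \<omega>)" using Suc dS by (simp add: fun_eq_iff)
    ultimately show ?thesis by simp
  qed
  note [measurable] = Y_meas[OF tpos] F_imp_M[OF d_meas] F_imp_M[OF decay_measurable[OF tpos]]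
  \<comment> \<open>Applied with \<open>g\<close> the value of \<open>decay\<close> at the preceding
    grid point, and with \<open>g = 1\<close> at the start.\<close>
  have split: "(\<integral>\<^sup>+\<omega>. ennreal (g \<omega> * Y (t k) \<omega>) \<partial>M) = (\<integral>\<^sup>+\<omega>. ennreal (decay m (t k) \<omega> * Y (t k) \<omega>) \<partial>M)
      + (\<integral>\<^sup>+\<omega>. ennreal (d k \<omega> * Y (t k) \<omega>) \<partial>M)" if "\<And>\<omega>. g \<omega> = decay m (t k) \<omega> + d k \<omega>" for g k
    unfolding that using d01 decay_bounds Y_pos[THEN less_imp_le]
    by (subst nn_integral_add[symmetric]) (auto intro!: nn_integral_cong simp: distrib_right)
  show "(\<integral>\<^sup>+\<omega>. ennreal (Y 0 \<omega>) \<partial>M) \<le> (\<integral>\<^sup>+\<omega>. ennreal (decay m (t k) \<omega> * Y (t k) \<omega>) \<partial>M)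
    + (\<Sum>j\<le>k. \<integral>\<^sup>+\<omega>. ennreal (d j \<omega> * Y (t j) \<omega>) \<partial>M)"
  proof (induction k)
    case 0
    show ?case using split[of "\<lambda>_. 1" 0] d0 by (simp add: t_def)
  next
    case (Suc k)
    \<comment> \<open>\<open>decay m (t k)\<close> is known at \<open>t k\<close>, so it may serve
      as the weight while \<open>Y\<close> advances by one step.\<close>
    have "(\<integral>\<^sup>+\<omega>. ennreal (decay m (t k) \<omega> * Y (t k) \<omega>) \<partial>M) \<le> (\<integral>\<^sup>+\<omega>. ennreal (decay m (t k) \<omega> * Y (t (Suc k)) \<omega>) \<partial>M)"
      using decay_bounds by (intro Y_submartingale tpos decay_measurable) (auto simp: t_def grid_mono)
    also have "\<dots> = (\<integral>\<^sup>+\<omega>. ennreal (decay m (t (Suc k)) \<omega> * Y (t (Suc k)) \<omega>) \<partial>M)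
      + (\<integral>\<^sup>+\<omega>. ennreal (d (Suc k) \<omega> * Y (t (Suc k)) \<omega>) \<partial>M)"
      by (rule split) (simp add: dS)
    finally show ?case
      using Suc by (auto simp: add.assoc add.commute intro: order_trans add_right_mono)
  qed
qed

text \<open>Limit of the grid version as the mesh tends to 0. The sums converge by continuity of
  \<open>Y\<close>; their second moments are bounded in \<open>n\<close> because the drops sum to at
  most 1 and each cell supplies a past weight for the domination of \<open>Y^2\<close>. The variable
  \<open>h\<close> lets the cost take the place of the limit.\<close>

lemma stopped_integration_by_parts:
  fixes T m :: nat
  assumes h: "AE \<omega> in M. ennreal (\<Sum>i<m. discount_drop i \<omega> * (if \<tau> i \<omega> \<le> ennreal (real T) then Y (enn2real (\<tau> i \<omega>)) \<omega> else 0)) \<le> h \<omega>"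
  shows "ennreal (exp (- \<kappa> * x)) \<le> (\<integral>\<^sup>+\<omega>. ennreal (decay m (real T) \<omega> * Y (real T) \<omega>) \<partial>M) + (\<integral>\<^sup>+\<omega>. h \<omega> \<partial>M)"
proof -
  define d where "d n k \<omega> = (\<Sum>i<m. discount_drop i \<omega> * of_bool (in_cell n k (\<tau> i \<omega>)))" for n k \<omega>
  define N where "N n = T * Suc n" for n
  define f where "f n \<omega> = (\<Sum>k\<le>N n. Y (grid n k) \<omega> * d n k \<omega>)" for n \<omega>
  have gridN: "grid n (N n) = real T" for n unfolding N_def by (rule grid_end)
  have d_F: "d n k \<in> borel_measurable (F (ennreal (grid n k)))" for n k
    unfolding d_def[abs_def] by (rule grid_integration_by_parts(2))
  note [measurable] = F_imp_M[OF d_F] Y_meas[OF grid_nonneg]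
  have d01: "0 \<le> d n k \<omega>" "d n k \<omega> \<le> 1" if "\<omega> \<in> space M" for n k \<omega>
    using sum_drop_bool[OF that] by (auto simp: d_def)
  have f_eq: "f n \<omega> = (\<Sum>i<m. discount_drop i \<omega> * (if \<tau> i \<omega> \<le> ennreal (real T) then Y (grid n (grid_ceil n (\<tau> i \<omega>))) \<omega> else 0))" for n \<omega>
  proof -
    have "f n \<omega> = (\<Sum>i<m. \<Sum>k\<le>N n. discount_drop i \<omega> * (Y (grid n k) \<omega> * of_bool (in_cell n k (\<tau> i \<omega>))))"
      unfolding f_def d_def sum_distrib_left by (subst sum.swap) (simp add: mult_ac)
    then show ?thesis unfolding sum_distrib_left[symmetric] N_def sum_in_cell .
  qed
  have sum_d: "(\<Sum>k\<le>N n. d n k \<omega>) \<le> 1" if "\<omega> \<in> space M" for n \<omega>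
  proof -
    have "(\<Sum>k\<le>N n. d n k \<omega>) = (\<Sum>i<m. discount_drop i \<omega> * (\<Sum>k\<le>N n. 1 * of_bool (in_cell n k (\<tau> i \<omega>))))"
      unfolding d_def sum_distrib_left by (subst sum.swap) simp
    also have "\<dots> = (\<Sum>i<m. discount_drop i \<omega> * of_bool (\<tau> i \<omega> \<le> ennreal (real T)))"
      unfolding N_def sum_in_cell by (simp add: of_bool_def)
    finally show ?thesis using sum_drop_bool(2)[OF that] by simp
  qed
  have f_meas: "f n \<in> borel_measurable M" for n
    unfolding f_def[abs_def] by measurable
  have sum_eq: "(\<Sum>k\<le>N n. \<integral>\<^sup>+\<omega>. ennreal (d n k \<omega> * Y (grid n k) \<omega>) \<partial>M) = (\<integral>\<^sup>+\<omega>. ennreal (f n \<omega>) \<partial>M)" for n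
  proof -
    have "(\<Sum>k\<le>N n. \<integral>\<^sup>+\<omega>. ennreal (d n k \<omega> * Y (grid n k) \<omega>) \<partial>M)
        = (\<integral>\<^sup>+\<omega>. (\<Sum>k\<le>N n. ennreal (d n k \<omega> * Y (grid n k) \<omega>)) \<partial>M)"
      by (subst nn_integral_sum) auto
    also have "\<dots> = (\<integral>\<^sup>+\<omega>. ennreal (f n \<omega>) \<partial>M)"
      unfolding f_def using d01 Y_pos[THEN less_imp_le]
      by (intro nn_integral_cong) (simp add: sum_ennreal mult.commute)
    finally show ?thesis .
  qed
  have le: "ennreal (exp (- \<kappa> * x)) \<le> (\<integral>\<^sup>+\<omega>. ennreal (decay m (real T) \<omega> * Y (real T) \<omega>) \<partial>M) + (\<integral>\<^sup>+\<omega>. ennreal (f n \<omega>) \<partial>M)" for n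
    using grid_integration_by_parts(1)[where n=n and m=m and k="N n"]
    unfolding d_def[symmetric] sum_eq gridN Y_0 .
  have up: "limsup (\<lambda>n. \<integral>\<^sup>+\<omega>. ennreal (f n \<omega>) \<partial>M) \<le> (\<integral>\<^sup>+\<omega>. h \<omega> \<partial>M)"
  proof -
    obtain K U where U: "U \<in> borel_measurable M" "(\<integral>\<^sup>+\<omega>. U \<omega> \<partial>M) \<le> 1"
      and KU: "\<And>t G. 0 \<le> t \<Longrightarrow> t \<le> real T \<Longrightarrow> G \<in> borel_measurable (F (ennreal t)) \<Longrightarrow> (\<forall>\<omega>\<in>space M. 0 \<le> G \<omega> \<and> G \<omega> \<le> 1) \<Longrightarrow>
        (\<integral>\<^sup>+\<omega>. ennreal (G \<omega> * (Y t \<omega>)\<^sup>2) \<partial>M) \<le> ennreal K * (\<integral>\<^sup>+\<omega>. ennreal (G \<omega>) * U \<omega> \<partial>M)"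
      using Y_square[OF of_nat_0_le_iff[of T]] unfolding square_dominated_def by blast
    note [measurable] = U(1)
    show ?thesis
    proof (rule nn_integral_limsup_le_L2[OF _ f_meas])
      show "finite_measure M" by unfold_locales
      show "(\<integral>\<^sup>+\<omega>. ennreal ((f n \<omega>)\<^sup>2) \<partial>M) \<le> ennreal K" for n
      proof -
        have "(\<integral>\<^sup>+\<omega>. ennreal ((f n \<omega>)\<^sup>2) \<partial>M) \<le> (\<integral>\<^sup>+\<omega>. (\<Sum>k\<le>N n. ennreal (d n k \<omega> * (Y (grid n k) \<omega>)\<^sup>2)) \<partial>M)"
          unfolding f_def using d01 sum_d
          by (intro nn_integral_mono) (auto simp: sum_ennreal intro!: ennreal_leI weighted_sum_square_le)
        also have "\<dots> = (\<Sum>k\<le>N n. \<integral>\<^sup>+\<omega>. ennreal (d n k \<omega> * (Y (grid n k) \<omega>)\<^sup>2) \<partial>M)"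
          by (subst nn_integral_sum) auto
        \<comment> \<open>All cells are dominated by the same \<open>U\<close>, so their weights can
          be collected under one integral, where they sum to at most 1.\<close>
        also have "\<dots> \<le> (\<Sum>k\<le>N n. ennreal K * (\<integral>\<^sup>+\<omega>. ennreal (d n k \<omega>) * U \<omega> \<partial>M))"
          using d01 grid_mono[of _ "N n" n] by (intro sum_mono KU d_F) (auto simp: gridN)
        also have "\<dots> = ennreal K * (\<integral>\<^sup>+\<omega>. (\<Sum>k\<le>N n. ennreal (d n k \<omega>) * U \<omega>) \<partial>M)"
          by (subst nn_integral_sum) (auto simp: sum_distrib_left)
        also have "\<dots> \<le> ennreal K * (\<integral>\<^sup>+\<omega>. U \<omega> \<partial>M)"
        proof (intro mult_left_mono nn_integral_mono)
          fix \<omega> assume \<omega>: "\<omega> \<in> space M"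
          have "(\<Sum>k\<le>N n. ennreal (d n k \<omega>) * U \<omega>) = ennreal (\<Sum>k\<le>N n. d n k \<omega>) * U \<omega>"
            using d01[OF \<omega>] by (simp add: sum_distrib_right[symmetric] sum_ennreal)
          also have "\<dots> \<le> 1 * U \<omega>"
            using sum_d[OF \<omega>] by (intro mult_right_mono) (auto simp: ennreal_le_1)
          finally show "(\<Sum>k\<le>N n. ennreal (d n k \<omega>) * U \<omega>) \<le> U \<omega>" by simp
        qed simp
        also have "\<dots> \<le> ennreal K * 1" using U(2) by (intro mult_left_mono) auto
        finally show ?thesis by simp
      qed
      show "AE \<omega> in M. limsup (\<lambda>n. ennreal (f n \<omega>)) \<le> h \<omega>"
        using h AE_space
      proof eventually_elim
        case (elim \<omega>)
        have "(\<lambda>n. f n \<omega>) \<longlonglongrightarrow> (\<Sum>i<m. discount_drop i \<omega> * (if \<tau> i \<omega> \<le> ennreal (real T) then Y (enn2real (\<tau> i \<omega>)) \<omega> else 0))"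
          unfolding f_eq
        proof (intro tendsto_sum tendsto_mult tendsto_const)
          fix i
          show "(\<lambda>n. if \<tau> i \<omega> \<le> ennreal (real T) then Y (grid n (grid_ceil n (\<tau> i \<omega>))) \<omega> else 0)
            \<longlonglongrightarrow> (if \<tau> i \<omega> \<le> ennreal (real T) then Y (enn2real (\<tau> i \<omega>)) \<omega> else 0)"
          proof (cases "\<tau> i \<omega> \<le> ennreal (real T)")
            case True
            then have "\<tau> i \<omega> \<noteq> top" by (auto simp: top_unique)
            then obtain s where s: "0 \<le> s" "\<tau> i \<omega> = ennreal s"
              by (cases "\<tau> i \<omega>") simp_all
            then show ?thesis
              using True Y_tendsto[OF elim(2) s(1) grid_ceil_tendsto[OF s(1)]] by simp
          qed simp
        qed
        from lim_imp_Limsup[OF _ tendsto_ennrealI[OF this]] show ?case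
          using elim(1) by simp
      qed
    qed
  qed
  have "ennreal (exp (- \<kappa> * x)) \<le> limsup (\<lambda>n. (\<integral>\<^sup>+\<omega>. ennreal (decay m (real T) \<omega> * Y (real T) \<omega>) \<partial>M) + (\<integral>\<^sup>+\<omega>. ennreal (f n \<omega>) \<partial>M))"
    using le by (intro le_Limsup always_eventually allI) simp_all
  also have "\<dots> = (\<integral>\<^sup>+\<omega>. ennreal (decay m (real T) \<omega> * Y (real T) \<omega>) \<partial>M) + limsup (\<lambda>n. \<integral>\<^sup>+\<omega>. ennreal (f n \<omega>) \<partial>M)"
    by (rule Limsup_const_add) simp
  finally show ?thesis
    using add_left_mono[OF up] by (rule order_trans)
qed

end

section \<open>Nonnegative surplus and the lower bound of the cost\<close>

lemma suminf_eq_infinity_if_bounded_below: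
  fixes c :: ennreal
  assumes "0 < c" and le: "\<And>i. c \<le> f i"
  shows "(\<Sum>i. f i) = \<infinity>"
proof (rule ccontr)
  assume "(\<Sum>i. f i) \<noteq> \<infinity>"
  then obtain s where s: "0 \<le> s" "(\<Sum>i. f i) = ennreal s"
    by (cases "\<Sum>i. f i") auto
  have "of_nat n * c \<le> ennreal s" for n
  proof -
    have "of_nat n * c = (\<Sum>i<n. c)" by simp
    also have "\<dots> \<le> (\<Sum>i<n. f i)" by (intro sum_mono le)
    also have "\<dots> \<le> (\<Sum>i. f i)" by (intro sum_le_suminf) auto
    finally show ?thesis using s by simp
  qed
  note bound = this
  have "c \<noteq> top" using bound[of 1] by (auto simp: top_unique)
  then obtain c' where c': "0 < c'" "c = ennreal c'"
    using \<open>0 < c\<close> by (cases c) auto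
  obtain n :: nat where "s < real n * c'" using reals_Archimedean3[OF c'(1)] by blast
  moreover have "real n * c' \<le> s"
    using bound[of n] c' s by (simp add: ennreal_of_nat_eq_real_of_nat ennreal_mult[symmetric])
  ultimately show False by simp
qed

context injected_surplus
begin

text \<open>Admissibility speaks of fixed times, but an injection time is random. Rational times
  approach \<open>t\<close> from the left; injections from the \<open>i\<close>-th on are not yet
  counted there, and \<open>Z\<close> is continuous. At \<open>t = 0\<close> there is no left side
  and the initial value is used.\<close>

lemma surplus_left_limit_nonneg:
  assumes \<omega>: "\<omega> \<in> space M" and x: "0 \<le> Z 0 \<omega>"
    and nonneg: "\<And>q. q \<in> \<rat> \<Longrightarrow> 0 \<le> q \<Longrightarrow>
      0 \<le> ereal (Z q \<omega>) + (\<Sum>j. if \<tau> j \<omega> \<le> ennreal q then ereal (\<xi> j \<omega>) else 0)"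
    and t: "0 \<le> t" "\<tau> i \<omega> = ennreal t"
  shows "0 \<le> Z t \<omega> + (\<Sum>j<i. \<xi> j \<omega>)"
proof (cases "t = 0")
  case True
  have "0 \<le> (\<Sum>j<i. \<xi> j \<omega>)" using size_pos[OF \<omega>] by (intro sum_nonneg) (auto intro: less_imp_le)
  then show ?thesis using True x by simp
next
  case False
  then have "0 < t" using t by simp
  define S where "S = (\<Sum>j<i. \<xi> j \<omega>)"
  have q: "0 \<le> Z q \<omega> + S" if q: "q \<in> \<rat>" "0 \<le> q" "q < t" for q
  proof -
    have zero: "(if \<tau> j \<omega> \<le> ennreal q then ereal (\<xi> j \<omega>) else 0) = 0" if "j \<notin> {..<i}" for j
    proof -
      have "ennreal q < ennreal t" using q by (simp add: ennreal_less_iff)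
      also have "\<dots> \<le> \<tau> j \<omega>" using tau_mono[OF \<omega>, of i j] that t by simp
      finally show ?thesis by (simp add: not_le)
    qed
    have "(\<Sum>j. if \<tau> j \<omega> \<le> ennreal q then ereal (\<xi> j \<omega>) else 0)
        = (\<Sum>j<i. if \<tau> j \<omega> \<le> ennreal q then ereal (\<xi> j \<omega>) else 0)"
      by (rule suminf_finite) (use zero in auto)
    also have "\<dots> \<le> (\<Sum>j<i. ereal (\<xi> j \<omega>))"
      using size_pos[OF \<omega>] by (intro sum_mono) (auto intro: less_imp_le)
    finally have "(\<Sum>j. if \<tau> j \<omega> \<le> ennreal q then ereal (\<xi> j \<omega>) else 0) \<le> ereal S"
      by (simp add: S_def)
    then have "0 \<le> ereal (Z q \<omega>) + ereal S"
      using nonneg[OF q(1,2)] by (meson add_left_mono order_trans)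
    then show ?thesis by simp
  qed
  have "\<exists>q\<in>\<rat>. max 0 (t - 1 / real (Suc n)) < q \<and> q < t" for n
    using \<open>0 < t\<close> by (intro Rats_dense_in_real) auto
  then obtain s where s: "\<And>n. s n \<in> \<rat>" "\<And>n. max 0 (t - 1 / real (Suc n)) < s n" "\<And>n. s n < t"
    by metis
  have "s \<longlonglongrightarrow> t"
  proof (rule tendsto_sandwich[of "\<lambda>n. t - 1 / real (Suc n)" _ _ "\<lambda>_. t"])
    show "(\<lambda>n. t - 1 / real (Suc n)) \<longlonglongrightarrow> t"
      using tendsto_diff[OF tendsto_const[of t] LIMSEQ_inverse_real_of_nat] by (simp add: inverse_eq_divide)
    show "\<forall>\<^sub>F n in sequentially. t - 1 / real (Suc n) \<le> s n"
      using s(2) by (intro always_eventually allI) (meson less_imp_le max.strict_boundedE)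
    show "\<forall>\<^sub>F n in sequentially. s n \<le> t"
      using s(3) by (intro always_eventually allI) (rule less_imp_le)
  qed simp
  moreover have s0: "0 \<le> s n" for n using s(2)[of n] by simp
  ultimately have "(\<lambda>n. Z (s n) \<omega> + S) \<longlonglongrightarrow> Z t \<omega> + S"
    using continuous_on_tendsto_compose[OF Z_cont[OF \<omega>], of s t sequentially] t
    by (intro tendsto_intros) auto
  then show ?thesis
    unfolding S_def[symmetric]
    by (rule LIMSEQ_le_const) (use q s s0 in auto)
qed

text \<open>With finitely many injections up to \<open>t\<close>, \<open>decay m t\<close> is
  eventually constant in \<open>m\<close>, namely the exponential of \<open>- \<kappa>\<close> times
  the injected amount; nonnegativity of the surplus then leaves at most the time discount.\<close>

lemma decay_eventually:
  assumes \<omega>: "\<omega> \<in> space M" and i: "ennreal t < \<tau> i \<omega>"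
    and nonneg: "0 \<le> ereal (Z t \<omega>) + (\<Sum>j. if \<tau> j \<omega> \<le> ennreal t then ereal (\<xi> j \<omega>) else 0)"
  shows "eventually (\<lambda>m. decay m t \<omega> * Y t \<omega> \<le> exp (- r * t)) sequentially"
proof -
  define N where "N = (LEAST i. ennreal t < \<tau> i \<omega>)"
  have "ennreal t < \<tau> N \<omega>" unfolding N_def using i by (rule LeastI)
  then have before: "\<tau> j \<omega> \<le> ennreal t \<longleftrightarrow> j < N" for j
    using not_less_Least[of j "\<lambda>i. ennreal t < \<tau> i \<omega>"] tau_mono[OF \<omega>, of N j]
    unfolding N_def[symmetric] by (meson leD leI order_trans order_less_le_trans)
  have "(\<Sum>j. if \<tau> j \<omega> \<le> ennreal t then ereal (\<xi> j \<omega>) else 0) = (\<Sum>j<N. if \<tau> j \<omega> \<le> ennreal t then ereal (\<xi> j \<omega>) else 0)"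
    by (rule suminf_finite) (auto simp: before)
  also have "\<dots> = ereal (\<Sum>j<N. \<xi> j \<omega>)" by (simp add: before)
  finally have pos: "0 \<le> Z t \<omega> + (\<Sum>j<N. \<xi> j \<omega>)" using nonneg by simp
  have "decay m t \<omega> * Y t \<omega> \<le> exp (- r * t)" if "N \<le> m" for m
  proof -
    have "(\<Sum>i<m. discount_drop i \<omega> * of_bool (\<tau> i \<omega> \<le> ennreal t)) = (\<Sum>i<N. discount_drop i \<omega>)"
      using that by (intro sum.mono_neutral_cong_right) (auto simp: before)
    then have "decay m t \<omega> = discount N \<omega>" by (simp add: decay_def sum_drop)
    then have "decay m t \<omega> * Y t \<omega> = exp (- r * t - \<kappa> * (Z t \<omega> + (\<Sum>j<N. \<xi> j \<omega>)))"
      by (simp add: discount_def Y_def exp_add[symmetric] algebra_simps)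
    then show ?thesis using pos \<kappa>_pos by simp
  qed
  then show ?thesis by (auto simp: eventually_sequentially)
qed

text \<open>Just before the \<open>i\<close>-th injection the surplus is nonnegative, so the drop
  weighted by \<open>Y\<close> is at most the time discount times
  \<open>1 - exp (- \<kappa> * y)\<close>, with \<open>y\<close> the injected size, and
  \<open>inj\<close> bounds this by the cost divided by \<open>\<zeta>\<close>. The remaining term
  is at most \<open>exp (- r * T)\<close> in the limit of large \<open>m\<close>, and this
  disappears as \<open>T\<close> grows.\<close>

lemma cost_lower_bound:
  fixes K c \<zeta> :: real
  assumes x: "0 \<le> x" and K: "0 < K" and c: "0 \<le> c" and \<zeta>: "0 < \<zeta>"
    and inj: "\<And>y. 0 < y \<Longrightarrow> \<zeta> * (1 - exp (- \<kappa> * y)) \<le> K + c * y"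
    and nonneg: "\<And>t. 0 \<le> t \<Longrightarrow> AE \<omega> in M. 0 \<le> ereal (Z t \<omega>) + (\<Sum>j. if \<tau> j \<omega> \<le> ennreal t then ereal (\<xi> j \<omega>) else 0)"
  defines "tot \<equiv> \<lambda>\<omega>. \<Sum>i. if \<tau> i \<omega> < \<infinity> then ennreal (exp (- r * enn2real (\<tau> i \<omega>)) * (K + c * \<xi> i \<omega>)) else 0"
  assumes fin: "(\<integral>\<^sup>+\<omega>. tot \<omega> \<partial>M) < \<infinity>"
  shows "ennreal (\<zeta> * exp (- \<kappa> * x)) \<le> (\<integral>\<^sup>+\<omega>. tot \<omega> \<partial>M)"
proof -
  note [measurable] = tau_M size_M
  have tot_meas [measurable]: "tot \<in> borel_measurable M"
    unfolding tot_def by measurable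
  have tot_fin: "AE \<omega> in M. tot \<omega> \<noteq> \<infinity>"
    using fin by (intro nn_integral_noteq_infinite) auto
  \<comment> \<open>The exceptional null sets of the rational times are united into one, so that a
    single path can be examined at all of them.\<close>
  have rat: "AE \<omega> in M. \<forall>q\<in>{q\<in>\<rat>. 0 \<le> q}. 0 \<le> ereal (Z q \<omega>) + (\<Sum>j. if \<tau> j \<omega> \<le> ennreal q then ereal (\<xi> j \<omega>) else 0)"
  proof (subst AE_ball_countable)
    show "countable {q\<in>\<rat>. 0 \<le> (q::real)}" by (rule countable_subset[OF _ countable_rat]) auto
  qed (use nonneg in auto)
  \<comment> \<open>Division by \<open>\<zeta>\<close>, because the integration by parts concerns
    \<open>Y\<close> rather than \<open>\<zeta> * Y\<close>.\<close>
  define h where "h \<omega> = ennreal (1 / \<zeta>) * tot \<omega>" for \<omega>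
  have h_int: "(\<integral>\<^sup>+\<omega>. h \<omega> \<partial>M) = ennreal (1 / \<zeta>) * (\<integral>\<^sup>+\<omega>. tot \<omega> \<partial>M)"
    unfolding h_def by (rule nn_integral_cmult) simp
  have drops: "AE \<omega> in M. ennreal (\<Sum>i<m. discount_drop i \<omega> * (if \<tau> i \<omega> \<le> ennreal (real T) then Y (enn2real (\<tau> i \<omega>)) \<omega> else 0)) \<le> h \<omega>" for m T
    using rat Z_0 AE_space
  proof eventually_elim
    case (elim \<omega>)
    define C where "C i = (if \<tau> i \<omega> < \<infinity> then exp (- r * enn2real (\<tau> i \<omega>)) * (K + c * \<xi> i \<omega>) else 0)" for i
    have C0: "0 \<le> C i" for i
      using K c size_pos[OF elim(3), of i] by (simp add: C_def)
    have le_cost: "discount_drop i \<omega> * (if \<tau> i \<omega> \<le> ennreal (real T) then Y (enn2real (\<tau> i \<omega>)) \<omega> else 0) \<le> 1 / \<zeta> * C i" for i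
    proof (cases "\<tau> i \<omega> \<le> ennreal (real T)")
      case True
      then have nt: "\<tau> i \<omega> \<noteq> top" by (auto simp: top_unique)
      then obtain t where t: "0 \<le> t" "\<tau> i \<omega> = ennreal t" by (cases "\<tau> i \<omega>") simp_all
      have "0 \<le> Z 0 \<omega>" using elim(2) x by simp
      moreover have "0 \<le> ereal (Z q \<omega>) + (\<Sum>j. if \<tau> j \<omega> \<le> ennreal q then ereal (\<xi> j \<omega>) else 0)"
        if "q \<in> \<rat>" "0 \<le> q" for q using elim(1) that by blast
      ultimately have pos: "0 \<le> Z t \<omega> + (\<Sum>j<i. \<xi> j \<omega>)"
        using t by (intro surplus_left_limit_nonneg elim(3)) auto
      let ?e = "1 - exp (- \<kappa> * \<xi> i \<omega>)"
      have e: "0 \<le> ?e" using \<kappa>_pos size_pos[OF elim(3), of i] by simp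
      have "discount_drop i \<omega> * Y t \<omega> = exp (- r * t - \<kappa> * (Z t \<omega> + (\<Sum>j<i. \<xi> j \<omega>))) * ?e"
        by (simp add: discount_drop_def discount_def Y_def right_diff_distrib left_diff_distrib exp_add[symmetric] algebra_simps)
      also have "\<dots> \<le> exp (- r * t) * ?e"
        using pos \<kappa>_pos e by (intro mult_right_mono) auto
      also have "\<dots> \<le> exp (- r * t) * ((K + c * \<xi> i \<omega>) / \<zeta>)"
        using inj[OF size_pos[OF elim(3)], of i] \<zeta> by (intro mult_left_mono) (auto simp: field_simps)
      finally show ?thesis using t True by (simp add: C_def)
    next
      case False
      then show ?thesis using C0[of i] \<zeta> by simp
    qed
    have "ennreal (\<Sum>i<m. discount_drop i \<omega> * (if \<tau> i \<omega> \<le> ennreal (real T) then Y (enn2real (\<tau> i \<omega>)) \<omega> else 0))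
        \<le> ennreal (1 / \<zeta> * (\<Sum>i<m. C i))"
      unfolding sum_distrib_left by (intro ennreal_leI sum_mono le_cost)
    also have "\<dots> = ennreal (1 / \<zeta>) * (\<Sum>i<m. ennreal (C i))"
      using C0 \<zeta> by (subst ennreal_mult) (simp_all add: sum_nonneg sum_ennreal)
    also have "\<dots> \<le> ennreal (1 / \<zeta>) * (\<Sum>i. ennreal (C i))"
      by (intro mult_left_mono sum_le_suminf) auto
    also have "(\<Sum>i. ennreal (C i)) = tot \<omega>"
      unfolding tot_def C_def by (intro suminf_cong) simp
    finally show ?case by (simp add: h_def)
  qed
  have T_bound: "ennreal (exp (- \<kappa> * x)) \<le> ennreal (exp (- r * real T)) + (\<integral>\<^sup>+\<omega>. h \<omega> \<partial>M)" for T :: nat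
  proof -
    obtain K' U where U: "(\<integral>\<^sup>+\<omega>. U \<omega> \<partial>M) \<le> 1"
      and KU: "\<forall>t G. 0 \<le> t \<longrightarrow> t \<le> real T \<longrightarrow> G \<in> borel_measurable (F (ennreal t)) \<longrightarrow> (\<forall>\<omega>\<in>space M. 0 \<le> G \<omega> \<and> G \<omega> \<le> 1) \<longrightarrow>
        (\<integral>\<^sup>+\<omega>. ennreal (G \<omega> * (Y t \<omega>)\<^sup>2) \<partial>M) \<le> ennreal K' * (\<integral>\<^sup>+\<omega>. ennreal (G \<omega>) * U \<omega> \<partial>M)"
      using Y_square[OF of_nat_0_le_iff[of T]] unfolding square_dominated_def by blast
    have Y2: "(\<integral>\<^sup>+\<omega>. ennreal ((Y (real T) \<omega>)\<^sup>2) \<partial>M) \<le> ennreal K'"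
    proof -
      have "(\<integral>\<^sup>+\<omega>. ennreal (1 * (Y (real T) \<omega>)\<^sup>2) \<partial>M) \<le> ennreal K' * (\<integral>\<^sup>+\<omega>. ennreal 1 * U \<omega> \<partial>M)"
        by (rule KU[rule_format]) auto
      also have "\<dots> \<le> ennreal K' * 1" using U by (intro mult_left_mono) auto
      finally show ?thesis by simp
    qed
    note [measurable] = Y_meas[of "real T"] F_imp_M[OF decay_measurable[of "real T"]]
    have "limsup (\<lambda>m. \<integral>\<^sup>+\<omega>. ennreal (decay m (real T) \<omega> * Y (real T) \<omega>) \<partial>M) \<le> (\<integral>\<^sup>+\<omega>. ennreal (exp (- r * real T)) \<partial>M)"
    proof (rule nn_integral_limsup_le_L2)
      show "finite_measure M" by unfold_locales
      show "(\<lambda>\<omega>. decay m (real T) \<omega> * Y (real T) \<omega>) \<in> borel_measurable M" for m by measurable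
      show "(\<integral>\<^sup>+\<omega>. ennreal ((decay m (real T) \<omega> * Y (real T) \<omega>)\<^sup>2) \<partial>M) \<le> ennreal K'" for m
      proof (rule order_trans[OF _ Y2], intro nn_integral_mono ennreal_leI power_mono)
        fix \<omega> assume "\<omega> \<in> space M"
        note d = decay_bounds[OF this, of m "real T"]
        show "decay m (real T) \<omega> * Y (real T) \<omega> \<le> Y (real T) \<omega>"
          using d Y_pos[of "real T" \<omega>] by (simp add: mult_left_le_one_le)
        show "0 \<le> decay m (real T) \<omega> * Y (real T) \<omega>" using d Y_pos[of "real T" \<omega>] by simp
      qed
      show "AE \<omega> in M. limsup (\<lambda>m. ennreal (decay m (real T) \<omega> * Y (real T) \<omega>)) \<le> ennreal (exp (- r * real T))"
        using tot_fin nonneg[of "real T", simplified] AE_space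
      proof eventually_elim
        case (elim \<omega>)
        \<comment> \<open>Otherwise infinitely many injections occur up to \<open>T\<close>, each
          costing at least \<open>exp (- r * T) * K\<close>, which contradicts the finite total.
          This is where the fixed cost matters.\<close>
        have "\<exists>i. ennreal (real T) < \<tau> i \<omega>"
        proof (rule ccontr)
          assume "\<not> ?thesis"
          then have le: "\<tau> i \<omega> \<le> ennreal (real T)" for i by (simp add: not_less)
          have "ennreal (exp (- r * real T) * K) \<le> (if \<tau> i \<omega> < \<infinity> then ennreal (exp (- r * enn2real (\<tau> i \<omega>)) * (K + c * \<xi> i \<omega>)) else 0)" for i
          proof -
            have "\<tau> i \<omega> \<noteq> top" using le[of i] by (auto simp: top_unique)
            then obtain t where t: "0 \<le> t" "\<tau> i \<omega> = ennreal t" by (cases "\<tau> i \<omega>") simp_all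
            have "t \<le> real T" using le[of i] t by simp
            then have "exp (- r * real T) * K \<le> exp (- r * t) * (K + c * \<xi> i \<omega>)"
              using r_pos K c size_pos[OF elim(3), of i] by (intro mult_mono) auto
            then show ?thesis using t by (simp add: ennreal_leI)
          qed
          then have "tot \<omega> = \<infinity>"
            unfolding tot_def using K by (intro suminf_eq_infinity_if_bounded_below[of "ennreal (exp (- r * real T) * K)"]) auto
          then show False using elim(1) by simp
        qed
        then obtain i where "ennreal (real T) < \<tau> i \<omega>" by blast
        from decay_eventually[OF elim(3) this] elim(2)
        have "eventually (\<lambda>m. decay m (real T) \<omega> * Y (real T) \<omega> \<le> exp (- r * real T)) sequentially" by simp
        then show ?case
          by (intro Limsup_bounded) (auto elim!: eventually_mono intro: ennreal_leI)
      qed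
    qed
    then have decay_lim: "limsup (\<lambda>m. \<integral>\<^sup>+\<omega>. ennreal (decay m (real T) \<omega> * Y (real T) \<omega>) \<partial>M) \<le> ennreal (exp (- r * real T))"
      by (simp add: emeasure_space_1)
    have "ennreal (exp (- \<kappa> * x)) \<le> limsup (\<lambda>m. (\<integral>\<^sup>+\<omega>. h \<omega> \<partial>M) + (\<integral>\<^sup>+\<omega>. ennreal (decay m (real T) \<omega> * Y (real T) \<omega>) \<partial>M))"
      using stopped_integration_by_parts[OF drops]
      by (intro le_Limsup always_eventually allI) (simp_all add: add.commute)
    also have "\<dots> = (\<integral>\<^sup>+\<omega>. h \<omega> \<partial>M) + limsup (\<lambda>m. \<integral>\<^sup>+\<omega>. ennreal (decay m (real T) \<omega> * Y (real T) \<omega>) \<partial>M)"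
      by (rule Limsup_const_add) simp
    also have "\<dots> \<le> (\<integral>\<^sup>+\<omega>. h \<omega> \<partial>M) + ennreal (exp (- r * real T))"
      by (rule add_left_mono[OF decay_lim])
    finally show ?thesis by (simp add: add.commute)
  qed
  have "(\<lambda>T. exp (- r * real T)) \<longlonglongrightarrow> 0"
  proof -
    have "(\<lambda>T. (exp (- r)) ^ T) \<longlonglongrightarrow> 0" using r_pos by (intro LIMSEQ_power_zero) simp
    then show ?thesis by (simp add: exp_of_nat_mult[symmetric] mult.commute)
  qed
  then have "(\<lambda>T. ennreal (exp (- r * real T)) + (\<integral>\<^sup>+\<omega>. h \<omega> \<partial>M)) \<longlonglongrightarrow> ennreal 0 + (\<integral>\<^sup>+\<omega>. h \<omega> \<partial>M)"
    by (intro tendsto_add tendsto_ennrealI tendsto_const)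
  then have "ennreal (exp (- \<kappa> * x)) \<le> ennreal 0 + (\<integral>\<^sup>+\<omega>. h \<omega> \<partial>M)"
    by (rule LIMSEQ_le_const) (use T_bound in auto)
  then have "ennreal \<zeta> * ennreal (exp (- \<kappa> * x)) \<le> ennreal \<zeta> * (ennreal (1 / \<zeta>) * (\<integral>\<^sup>+\<omega>. tot \<omega> \<partial>M))"
    unfolding h_int by (intro mult_left_mono) auto
  also have "\<dots> = (\<integral>\<^sup>+\<omega>. tot \<omega> \<partial>M)"
    using \<zeta> by (simp add: mult.assoc[symmetric] ennreal_mult[symmetric])
  finally show ?thesis using \<zeta> by (simp add: ennreal_mult)
qed

end

section \<open>Injections at ruin\<close>

text \<open>Defined with \<open>\<le>\<close> instead of equality: this makes it antitone in the
  level for every path, and for a continuous path starting above \<open>a\<close> it is still the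
  first time at \<open>a\<close>.\<close>

definition hit :: "(real \<Rightarrow> real) \<Rightarrow> real \<Rightarrow> ennreal" where
  "hit f a = Inf {ennreal t | t. 0 \<le> t \<and> f t \<le> a}"

lemma hit_le: "0 \<le> t \<Longrightarrow> f t \<le> a \<Longrightarrow> hit f a \<le> ennreal t"
  unfolding hit_def by (rule Inf_lower) auto

lemma hit_antimono: "a \<le> b \<Longrightarrow> hit f b \<le> hit f a"
  unfolding hit_def by (rule Inf_superset_mono) auto

lemma before_hit: "0 \<le> t \<Longrightarrow> ennreal t < hit f a \<Longrightarrow> a < f t"
  using hit_le[of t f a] by (auto simp: not_le[symmetric])

lemma hit_attained:
  assumes cont: "continuous_on {0..} f" and "hit f a \<noteq> top"
  obtains t where "0 \<le> t" "hit f a = ennreal t" "f t \<le> a"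
proof -
  obtain t where t: "0 \<le> t" "hit f a = ennreal t" using assms(2) by (cases "hit f a") auto
  have "\<exists>s. 0 \<le> s \<and> f s \<le> a \<and> s < t + 1 / real (Suc n)" for n
  proof -
    have "hit f a < ennreal (t + 1 / real (Suc n))" using t by (simp add: ennreal_less_iff)
    then obtain s where "0 \<le> s" "f s \<le> a" "ennreal s < ennreal (t + 1 / real (Suc n))"
      unfolding hit_def Inf_less_iff by auto
    then show ?thesis using ennreal_less_iff by blast
  qed
  then obtain s where s: "\<And>n. 0 \<le> s n" "\<And>n. f (s n) \<le> a" "\<And>n. s n < t + 1 / real (Suc n)" by metis
  have ge: "t \<le> s n" for n using hit_le[of "s n" f a] t s(1,2)[of n] by simp
  have "s \<longlonglongrightarrow> t"
  proof (rule tendsto_sandwich[of "\<lambda>_. t"])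
    show "(\<lambda>n. t + 1 / real (Suc n)) \<longlonglongrightarrow> t"
      using tendsto_add[OF tendsto_const[of t] LIMSEQ_inverse_real_of_nat] by (simp add: inverse_eq_divide)
    show "\<forall>\<^sub>F n in sequentially. s n \<le> t + 1 / real (Suc n)"
      using s(3) by (intro always_eventually allI) (rule less_imp_le)
    show "\<forall>\<^sub>F n in sequentially. t \<le> s n" using ge by (intro always_eventually allI)
  qed simp
  then have "(\<lambda>n. f (s n)) \<longlonglongrightarrow> f t"
    using continuous_on_tendsto_compose[OF cont, of s t sequentially] t(1) s(1) by simp
  then have "f t \<le> a" by (rule LIMSEQ_le_const2) (use s(2) in auto)
  with t that show ?thesis by blast
qed

text \<open>The intermediate value theorem yields a time up to \<open>t\<close> at which the path
  equals \<open>a\<close>; by minimality this time is \<open>t\<close>.\<close>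

lemma hit_value:
  assumes cont: "continuous_on {0..} f" and start: "a \<le> f 0" and t: "0 \<le> t" "hit f a = ennreal t"
  shows "f t = a"
proof -
  have le: "f t \<le> a"
    using hit_attained[OF cont, of a] t by (metis ennreal_inj ennreal_neq_top)
  have "\<exists>s\<ge>0. s \<le> t \<and> f s = a"
    using IVT2'[of f t a 0] le start t(1) continuous_on_subset[OF cont, of "{0..t}"] by auto
  then obtain s where s: "0 \<le> s" "s \<le> t" "f s = a" by blast
  have "t \<le> s" using hit_le[of s f a] s t by simp
  with s show ?thesis by simp
qed

lemma hit_le_iff_rational:
  assumes cont: "continuous_on {0..} f" and t: "0 \<le> t"
  shows "hit f a \<le> ennreal t \<longleftrightarrow> (\<forall>n. \<exists>q\<in>{q. 0 \<le> q \<and> q \<le> t \<and> (q \<in> \<rat> \<or> q = t)}. f q < a + 1 / real (Suc n))"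
proof
  assume le: "hit f a \<le> ennreal t"
  then have "hit f a \<noteq> top" by (auto simp: top_unique)
  then obtain s where s: "0 \<le> s" "hit f a = ennreal s" "f s \<le> a" by (rule hit_attained[OF cont])
  then have "s \<le> t" using le t by simp
  show "\<forall>n. \<exists>q\<in>{q. 0 \<le> q \<and> q \<le> t \<and> (q \<in> \<rat> \<or> q = t)}. f q < a + 1 / real (Suc n)"
  proof
    fix n
    show "\<exists>q\<in>{q. 0 \<le> q \<and> q \<le> t \<and> (q \<in> \<rat> \<or> q = t)}. f q < a + 1 / real (Suc n)"
    proof (cases "s = t")
      case True
      then show ?thesis using s by (intro bexI[of _ t]) (auto intro: le_less_trans)
    next
      case False
      obtain d where d: "0 < d" "\<And>q. 0 \<le> q \<Longrightarrow> \<bar>q - s\<bar> < d \<Longrightarrow> \<bar>f q - f s\<bar> < 1 / real (Suc n)"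
        using cont[unfolded continuous_on_iff, rule_format, of s "1 / real (Suc n)"] s(1)
        by (auto simp: dist_real_def)
      obtain q where q: "q \<in> \<rat>" "s < q" "q < min t (s + d)"
        using Rats_dense_in_real[of s "min t (s + d)"] False \<open>s \<le> t\<close> d(1) by auto
      have "\<bar>f q - f s\<bar> < 1 / real (Suc n)" using q s(1) by (intro d(2)) auto
      then have "f q < a + 1 / real (Suc n)" using s(3) by linarith
      then show ?thesis using q s(1) by (intro bexI[of _ q]) auto
    qed
  qed
next
  assume *: "\<forall>n. \<exists>q\<in>{q. 0 \<le> q \<and> q \<le> t \<and> (q \<in> \<rat> \<or> q = t)}. f q < a + 1 / real (Suc n)"
  have "continuous_on {0..t} f" by (rule continuous_on_subset[OF cont]) auto
  then obtain s where s: "s \<in> {0..t}" "\<And>q. q \<in> {0..t} \<Longrightarrow> f s \<le> f q"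
    using continuous_attains_inf[of "{0..t}" f] t by auto
  have "f s \<le> a + 1 / real (Suc n)" for n
  proof -
    obtain q where "q \<in> {0..t}" "f q < a + 1 / real (Suc n)" using * by fastforce
    then show ?thesis using s(2)[of q] by linarith
  qed
  moreover have "(\<lambda>n. a + 1 / real (Suc n)) \<longlonglongrightarrow> a"
    using tendsto_add[OF tendsto_const[of a] LIMSEQ_inverse_real_of_nat] by (simp add: inverse_eq_divide)
  ultimately have "f s \<le> a" by (intro LIMSEQ_le_const) auto
  then have "hit f a \<le> ennreal s" using s(1) by (intro hit_le) auto
  also have "\<dots> \<le> ennreal t" using s(1) by (intro ennreal_leI) auto
  finally show "hit f a \<le> ennreal t" .
qed

section \<open>Ruin times of a single path\<close>

text \<open>The condition that \<open>surplus_before\<close> is 0, for a single path with constant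
  injection size.\<close>

definition ruin :: "(real \<Rightarrow> real) \<Rightarrow> real \<Rightarrow> (nat \<Rightarrow> ennreal) \<Rightarrow> real \<Rightarrow> bool" where
  "ruin f \<xi> T t \<longleftrightarrow> ereal (f t) + (\<Sum>j. if T j < ennreal t then ereal \<xi> else 0) = 0"

context
  fixes f :: "real \<Rightarrow> real" and \<xi> :: real and T :: "nat \<Rightarrow> ennreal"
  assumes cont: "continuous_on {0..} f" and start: "0 \<le> f 0" and \<xi>: "0 < \<xi>"
    and T_mono: "\<And>i. T i \<le> T (Suc i)"
begin

abbreviation "level i \<equiv> hit f (- (real i * \<xi>))"

lemma T_le: "i \<le> j \<Longrightarrow> T i \<le> T j"
  by (rule lift_Suc_mono_le[of T]) (rule T_mono)

lemma start_level: "- (real i * \<xi>) \<le> f 0"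
proof -
  have "0 \<le> real i * \<xi>" using \<xi> by simp
  then show ?thesis using start by linarith
qed

lemma level_value: "0 \<le> t \<Longrightarrow> level i = ennreal t \<Longrightarrow> f t = - (real i * \<xi>)"
  by (rule hit_value[OF cont start_level])

lemma level_less:
  assumes "level (Suc i) \<noteq> top"
  shows "level i < level (Suc i)"
proof -
  obtain t where t: "0 \<le> t" "level (Suc i) = ennreal t" using assms by (cases "level (Suc i)") auto
  have "f t = - (real (Suc i) * \<xi>)" by (rule level_value[OF t])
  then have ft: "f t < - (real i * \<xi>)" using \<xi> by (simp add: distrib_right)
  then have "level i \<le> ennreal t" using t by (intro hit_le) auto
  moreover have "level i \<noteq> ennreal t" using level_value[OF t(1), of i] ft by auto
  ultimately show ?thesis using t by simp
qed

text \<open>Further injections before \<open>t\<close> can only make \<open>f t\<close> lower at a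
  zero of the surplus.\<close>

lemma level_le_ruin:
  assumes "0 \<le> t" "ruin f \<xi> T t" "\<And>j. j < i \<Longrightarrow> T j < ennreal t"
  shows "level i \<le> ennreal t"
proof -
  have "ereal (real i * \<xi>) = (\<Sum>j<i. if T j < ennreal t then ereal \<xi> else 0)" using assms(3) by simp
  also have "\<dots> \<le> (\<Sum>j. if T j < ennreal t then ereal \<xi> else 0)"
    using \<xi> by (intro suminf_upper) auto
  finally have le: "ereal (real i * \<xi>) \<le> (\<Sum>j. if T j < ennreal t then ereal \<xi> else 0)" .
  have "ereal (f t) + ereal (real i * \<xi>) \<le> 0"
    using add_left_mono[OF le, of "ereal (f t)"] assms(2) unfolding ruin_def by simp
  then show ?thesis using assms(1) by (intro hit_le) auto
qed

lemma ruin_at_level: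
  assumes "0 \<le> t" "level i = ennreal t" "\<And>j. j < i \<Longrightarrow> T j < ennreal t" "ennreal t \<le> T i"
  shows "ruin f \<xi> T t"
proof -
  have "(\<Sum>j. if T j < ennreal t then ereal \<xi> else 0) = (\<Sum>j<i. if T j < ennreal t then ereal \<xi> else 0)"
    using order_trans[OF assms(4) T_le] by (intro suminf_finite) (auto simp: not_less leD)
  also have "\<dots> = ereal (real i * \<xi>)" using assms(3) by simp
  finally show ?thesis unfolding ruin_def using level_value[OF assms(1,2)] by simp
qed

text \<open>The ruin condition also refers to \<open>T\<close> from index \<open>i\<close> on, the
  very times being determined. The lower bound holds whatever these are. For equality,
  \<open>level i \<le> T i\<close> ensures that no injection from the \<open>i\<close>-th on
  precedes the level, so the surplus does vanish there. The guard \<open>0 < i\<close> treats the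
  first and the later times uniformly.\<close>

lemma Inf_ruin_eq_level:
  assumes prev: "\<And>j. j < i \<Longrightarrow> T j = level j"
  defines "S \<equiv> {ennreal t | t. 0 \<le> t \<and> (0 < i \<longrightarrow> T (i - 1) < ennreal t) \<and> ruin f \<xi> T t}"
  shows "level i \<le> Inf S" and "level i \<le> T i \<Longrightarrow> Inf S = level i"
proof -
  have before: "T j < ennreal t" if "0 < i \<longrightarrow> T (i - 1) < ennreal t" "j < i" for t j
    using that le_less_trans[OF T_le[of j "i - 1"]] by auto
  show 1: "level i \<le> Inf S"
    unfolding S_def using before by (intro Inf_greatest) (auto intro!: level_le_ruin)
  assume Ti: "level i \<le> T i"
  show "Inf S = level i"
  proof (cases "level i = top")
    case True
    then show ?thesis using 1 by (simp add: top_unique)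
  next
    case False
    then obtain t where t: "0 \<le> t" "level i = ennreal t" by (cases "level i") auto
    have pt: "0 < i \<longrightarrow> T (i - 1) < ennreal t"
      using prev[of "i - 1"] level_less[of "i - 1"] False t by auto
    have "ruin f \<xi> T t" using before[OF pt] Ti t by (intro ruin_at_level) auto
    then have "Inf S \<le> level i"
      unfolding t(2) using pt t(1) by (intro Inf_lower) (auto simp: S_def)
    then show ?thesis using 1 by simp
  qed
qed

text \<open>The inequality \<open>level i \<le> T i\<close> comes from the lower bound if
  \<open>T\<close> consists of ruin times, and is trivial if \<open>T\<close> consists of levels.
  The forward direction serves arbitrary policies, the backward one the existence of a
  policy.\<close>

lemma ruin_times_iff_levels:
  "(T 0 = Inf {ennreal t | t. 0 \<le> t \<and> ruin f \<xi> T t} \<and>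
    (\<forall>i. T (Suc i) = Inf {ennreal t | t. 0 \<le> t \<and> T i < ennreal t \<and> ruin f \<xi> T t})) \<longleftrightarrow> (\<forall>i. T i = level i)"
  (is "?L \<longleftrightarrow> ?R")
proof
  assume L: ?L
  show ?R
  proof
    fix i
    show "T i = level i"
    proof (induction i rule: less_induct)
      case (less i)
      have "T i = Inf {ennreal t | t. 0 \<le> t \<and> (0 < i \<longrightarrow> T (i - 1) < ennreal t) \<and> ruin f \<xi> T t}"
        using L by (cases i) auto
      then show ?case using Inf_ruin_eq_level[OF less] by simp
    qed
  qed
next
  assume R: ?R
  have "Inf {ennreal t | t. 0 \<le> t \<and> (0 < i \<longrightarrow> T (i - 1) < ennreal t) \<and> ruin f \<xi> T t} = T i" for i
    using Inf_ruin_eq_level(2)[of i] R by simp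
  from this[of 0] this[of "Suc _"] show ?L by simp
qed

text \<open>Only finitely many levels are reached up to \<open>t\<close>. If \<open>N\<close> is the
  first one not reached, the path is still above \<open>- (real N * \<xi>)\<close> and exactly
  \<open>N\<close> injections have been made.\<close>

lemma surplus_at_levels_nonneg:
  assumes "\<And>i. T i = level i" and t: "0 \<le> t"
  shows "0 \<le> ereal (f t) + (\<Sum>j. if T j \<le> ennreal t then ereal \<xi> else 0)"
proof -
  have "continuous_on {0..t} f" by (rule continuous_on_subset[OF cont]) auto
  then obtain s where s: "s \<in> {0..t}" "\<And>q. q \<in> {0..t} \<Longrightarrow> f s \<le> f q"
    using continuous_attains_inf[of "{0..t}" f] t by auto
  \<comment> \<open>This level lies below the minimum of the path on \<open>[0, t]\<close>, so it
    cannot have been reached.\<close>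
  obtain i :: nat where i: "- f s < real i * \<xi>" using reals_Archimedean3[OF \<xi>] by blast
  have "ennreal t < T i"
  proof (rule ccontr)
    assume "\<not> ?thesis"
    then have le: "level i \<le> ennreal t" using assms(1) by (simp add: not_less)
    then have "level i \<noteq> top" by (auto simp: top_unique)
    then obtain u where u: "0 \<le> u" "level i = ennreal u" by (cases "level i") auto
    then have "f u = - (real i * \<xi>)" "u \<le> t" using level_value le t by auto
    then show False using s(2)[of u] u i by auto
  qed
  define N where "N = (LEAST i. ennreal t < T i)"
  have N: "ennreal t < T N" unfolding N_def using \<open>ennreal t < T i\<close> by (rule LeastI)
  have before: "T j \<le> ennreal t \<longleftrightarrow> j < N" for j
    using not_less_Least[of j "\<lambda>i. ennreal t < T i"] T_le[of N j] N
    unfolding N_def[symmetric] by (meson leD leI order_trans order_less_le_trans)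
  have "(\<Sum>j. if T j \<le> ennreal t then ereal \<xi> else 0) = (\<Sum>j<N. if T j \<le> ennreal t then ereal \<xi> else 0)"
    by (rule suminf_finite) (auto simp: before)
  also have "\<dots> = ereal (real N * \<xi>)" by (simp add: before)
  finally show ?thesis using before_hit[OF t, of f "- (real N * \<xi>)"] N assms(1) by simp
qed

end

section \<open>Optional stopping at a level\<close>

definition discount_at :: "real \<Rightarrow> ennreal \<Rightarrow> ennreal" where
  "discount_at r t = (if t < \<infinity> then ennreal (exp (- r * enn2real t)) else 0)"

lemma measurable_discount_at [measurable]: "discount_at r \<in> borel_measurable borel"
  unfolding discount_at_def[abs_def] by measurable

text \<open>The martingale property is applied cell by cell: the weight of a cell moves
  \<open>Y\<close> from the grid point to the horizon, where all cells together give at most the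
  mean of \<open>Y\<close>. Paths not stopped by the horizon are discarded, so an inequality
  results, and Fatou's lemma preserves it. On stopped paths \<open>Y\<close> is
  \<open>exp (\<kappa> * a)\<close> times the discount.\<close>

lemma (in exp_surplus) discounted_hitting_time_le:
  assumes mart: "\<And>s t G. 0 \<le> s \<Longrightarrow> s \<le> t \<Longrightarrow> G \<in> borel_measurable (F (ennreal s)) \<Longrightarrow>
      (\<And>\<omega>. \<omega> \<in> space M \<Longrightarrow> 0 \<le> G \<omega> \<and> G \<omega> \<le> 1) \<Longrightarrow>
      (\<integral>\<^sup>+\<omega>. ennreal (G \<omega> * Y s \<omega>) \<partial>M) = (\<integral>\<^sup>+\<omega>. ennreal (G \<omega> * Y t \<omega>) \<partial>M)"
    and stop: "stopping_time F \<tau>"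
    and at_level: "AE \<omega> in M. \<tau> \<omega> < \<infinity> \<longrightarrow> Z (enn2real (\<tau> \<omega>)) \<omega> = - a"
  shows "(\<integral>\<^sup>+\<omega>. discount_at r (\<tau> \<omega>) \<partial>M)
    \<le> ennreal (exp (- \<kappa> * (x + a)))"
proof -
  have Y0: "0 \<le> Y t \<omega>" for t \<omega> by (simp add: Y_def)
  have Y_meas: "Y t \<in> borel_measurable M" if "0 \<le> t" for t
    unfolding Y_def using Z_meas[OF that] by measurable
  define G where "G n k \<omega> = (of_bool (in_cell n k (\<tau> \<omega>)) :: real)" for n k \<omega>
  have G_F: "G n k \<in> borel_measurable (F (ennreal (grid n k)))" for n k
  proof -
    have [measurable]: "Measurable.pred (F (ennreal (grid n k))) (\<lambda>\<omega>. \<tau> \<omega> \<le> ennreal (grid n k))"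
      by (rule stopping_timeD[OF stop])
    have [measurable]: "Measurable.pred (F (ennreal (grid n k))) (\<lambda>\<omega>. ennreal (grid n j) < \<tau> \<omega>)" if "j < k" for j
      using that by (intro F_mono[OF _ stopping_timeD2[OF stop]] ennreal_leI grid_mono) simp
    have "Measurable.pred (F (ennreal (grid n k))) (\<lambda>\<omega>. in_cell n k (\<tau> \<omega>))"
      unfolding in_cell_def by (intro pred_intros_logic pred_intros_countable_bounded) measurable
    then show ?thesis unfolding G_def[abs_def] of_bool_def by measurable
  qed
  have GY_meas: "(\<lambda>\<omega>. ennreal (G n k \<omega> * Y t \<omega>)) \<in> borel_measurable M" if "0 \<le> t" for n k t
    using F_imp_M[OF G_F] Y_meas[OF that] by (intro measurable_compose[OF _ measurable_ennreal] borel_measurable_times)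
  \<comment> \<open>Mesh and horizon are driven by the same index: the mesh shrinks while the
    horizon \<open>n\<close> tends to infinity.\<close>
  define g where "g n \<omega> = (\<Sum>k\<le>n * Suc n. Y (grid n k) \<omega> * G n k \<omega>)" for n \<omega>
  have g_eq: "g n \<omega> = (if \<tau> \<omega> \<le> ennreal (real n) then Y (grid n (grid_ceil n (\<tau> \<omega>))) \<omega> else 0)" for n \<omega>
    unfolding g_def G_def by (rule sum_in_cell)
  have Y0_int: "(\<integral>\<^sup>+\<omega>. ennreal (Y t \<omega>) \<partial>M) = ennreal (exp (- \<kappa> * x))" if "0 \<le> t" for t
  proof -
    have "(\<integral>\<^sup>+\<omega>. ennreal (1 * Y t \<omega>) \<partial>M) = (\<integral>\<^sup>+\<omega>. ennreal (1 * Y 0 \<omega>) \<partial>M)"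
      using that by (intro mart[symmetric]) auto
    also have "\<dots> = (\<integral>\<^sup>+\<omega>. ennreal (exp (- \<kappa> * x)) \<partial>M)"
      using Z_0 by (intro nn_integral_cong_AE) (auto simp: Y_def)
    finally show ?thesis by (simp add: emeasure_space_1)
  qed
  have g_int: "(\<integral>\<^sup>+\<omega>. ennreal (g n \<omega>) \<partial>M) \<le> ennreal (exp (- \<kappa> * x))" for n
  proof -
    have "(\<integral>\<^sup>+\<omega>. ennreal (g n \<omega>) \<partial>M) = (\<integral>\<^sup>+\<omega>. (\<Sum>k\<le>n * Suc n. ennreal (G n k \<omega> * Y (grid n k) \<omega>)) \<partial>M)"
      unfolding g_def using Y0 by (intro nn_integral_cong) (simp add: sum_ennreal G_def mult.commute)
    also have "\<dots> = (\<Sum>k\<le>n * Suc n. \<integral>\<^sup>+\<omega>. ennreal (G n k \<omega> * Y (grid n k) \<omega>) \<partial>M)"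
      by (rule nn_integral_sum) (rule GY_meas, simp)
    also have "\<dots> = (\<Sum>k\<le>n * Suc n. \<integral>\<^sup>+\<omega>. ennreal (G n k \<omega> * Y (real n) \<omega>) \<partial>M)"
    proof (intro sum.cong refl mart G_F)
      fix k assume "k \<in> {..n * Suc n}"
      then show "grid n k \<le> real n" using grid_mono[of k "n * Suc n" n] by (simp only: grid_end atMost_iff)
    qed (auto simp: G_def)
    also have "\<dots> = (\<integral>\<^sup>+\<omega>. (\<Sum>k\<le>n * Suc n. ennreal (G n k \<omega> * Y (real n) \<omega>)) \<partial>M)"
      by (rule nn_integral_sum[symmetric]) (rule GY_meas, simp)
    also have "\<dots> \<le> (\<integral>\<^sup>+\<omega>. ennreal (Y (real n) \<omega>) \<partial>M)"
    proof (rule nn_integral_mono)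
      fix \<omega>
      have "(\<Sum>k\<le>n * Suc n. Y (real n) \<omega> * G n k \<omega>) \<le> Y (real n) \<omega>"
        unfolding G_def sum_in_cell using Y0 by simp
      then show "(\<Sum>k\<le>n * Suc n. ennreal (G n k \<omega> * Y (real n) \<omega>)) \<le> ennreal (Y (real n) \<omega>)"
        using Y0 by (simp add: sum_ennreal G_def mult.commute ennreal_leI)
    qed
    finally show ?thesis by (simp add: Y0_int)
  qed
  have lim: "AE \<omega> in M. ennreal (exp (\<kappa> * a)) * discount_at r (\<tau> \<omega>)
      \<le> liminf (\<lambda>n. ennreal (g n \<omega>))"
    using at_level AE_space
  proof eventually_elim
    case (elim \<omega>)
    show ?case
    proof (cases "\<tau> \<omega> < \<infinity>")
      case True
      then obtain t where t: "0 \<le> t" "\<tau> \<omega> = ennreal t" by (cases "\<tau> \<omega>") auto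
      have "(\<lambda>n. Z (grid n (grid_ceil n (ennreal t))) \<omega>) \<longlonglongrightarrow> Z t \<omega>"
        using continuous_on_tendsto_compose[OF Z_cont[OF elim(2)] grid_ceil_tendsto[OF t(1)]] t(1) by simp
      then have "(\<lambda>n. Y (grid n (grid_ceil n (ennreal t))) \<omega>) \<longlonglongrightarrow> Y t \<omega>"
        unfolding Y_def using grid_ceil_tendsto[OF t(1)] by (intro tendsto_intros)
      moreover have "eventually (\<lambda>n. Y (grid n (grid_ceil n (ennreal t))) \<omega> = g n \<omega>) sequentially"
      proof -
        obtain N :: nat where "t \<le> real N" using real_arch_simple by blast
        then have "Y (grid n (grid_ceil n (ennreal t))) \<omega> = g n \<omega>" if "N \<le> n" for n
          using that t unfolding g_eq t(2) by (auto simp: ennreal_leI)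
        then show ?thesis by (auto simp: eventually_sequentially)
      qed
      ultimately have "(\<lambda>n. g n \<omega>) \<longlonglongrightarrow> Y t \<omega>" by (rule Lim_transform_eventually)
      then have "liminf (\<lambda>n. ennreal (g n \<omega>)) = ennreal (Y t \<omega>)"
        by (intro lim_imp_Liminf tendsto_ennrealI) auto
      moreover have "Y t \<omega> = exp (\<kappa> * a) * exp (- r * t)"
        using elim(1) True t by (simp add: Y_def exp_add[symmetric])
      ultimately show ?thesis using t by (simp add: discount_at_def ennreal_mult)
    qed (simp add: discount_at_def)
  qed
  have [measurable]: "\<tau> \<in> borel_measurable M"
    using measurable_stopping_time[OF stop, of M] sets_F_le by simp
  have "ennreal (exp (\<kappa> * a)) * (\<integral>\<^sup>+\<omega>. discount_at r (\<tau> \<omega>) \<partial>M)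
      = (\<integral>\<^sup>+\<omega>. ennreal (exp (\<kappa> * a)) * discount_at r (\<tau> \<omega>) \<partial>M)"
    by (rule nn_integral_cmult[symmetric]) measurable
  also have "\<dots> \<le> (\<integral>\<^sup>+\<omega>. liminf (\<lambda>n. ennreal (g n \<omega>)) \<partial>M)"
    using lim by (rule nn_integral_mono_AE)
  also have "\<dots> \<le> liminf (\<lambda>n. \<integral>\<^sup>+\<omega>. ennreal (g n \<omega>) \<partial>M)"
  proof (rule nn_integral_liminf)
    have "g n \<in> borel_measurable M" for n
      unfolding g_def[abs_def]
    proof (intro borel_measurable_sum)
      fix k
      show "(\<lambda>\<omega>. Y (grid n k) \<omega> * G n k \<omega>) \<in> borel_measurable M"
        by (rule borel_measurable_times[OF Y_meas[OF grid_nonneg] F_imp_M[OF G_F]])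
    qed
    then show "(\<lambda>\<omega>. ennreal (g n \<omega>)) \<in> borel_measurable M" for n
      by (rule measurable_compose[OF _ measurable_ennreal])
  qed
  also have "\<dots> \<le> limsup (\<lambda>n. \<integral>\<^sup>+\<omega>. ennreal (g n \<omega>) \<partial>M)"
    by (rule Liminf_le_Limsup) simp
  also have "\<dots> \<le> ennreal (exp (- \<kappa> * x))"
    using g_int by (intro Limsup_bounded always_eventually allI)
  finally have "ennreal (exp (- (\<kappa> * a))) * (ennreal (exp (\<kappa> * a)) *
      (\<integral>\<^sup>+\<omega>. discount_at r (\<tau> \<omega>) \<partial>M))
      \<le> ennreal (exp (- (\<kappa> * a))) * ennreal (exp (- \<kappa> * x))"
    by (rule mult_left_mono) simp
  moreover have "ennreal (exp (- (\<kappa> * a))) * ennreal (exp (\<kappa> * a)) = 1"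
    by (simp add: ennreal_mult[symmetric] exp_add[symmetric])
  moreover have "ennreal (exp (- (\<kappa> * a))) * ennreal (exp (- \<kappa> * x)) = ennreal (exp (- \<kappa> * (x + a)))"
    by (simp only: ennreal_mult[symmetric] exp_ge_zero exp_add[symmetric]) (simp add: algebra_simps)
  ultimately show ?thesis
    unfolding mult.assoc[symmetric] by simp
qed

section \<open>The injection equation\<close>

text \<open>From \<open>c / \<kappa>\<close> on, the left side is strictly decreasing; it starts
  with the value \<open>K > 0\<close> and becomes negative because the logarithm is
  sublinear.\<close>

lemma injection_equation_ex1:
  assumes "0 < K" "0 < c" "0 < \<kappa>"
  shows "\<exists>!\<zeta>. injection_equation K c \<kappa> \<zeta>"
proof -
  define k where "k = c / \<kappa>"
  have k: "0 < k" using assms by (simp add: k_def)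
  define f where "f z = K + k * ln (z / k) + k - z" for z
  have eq: "injection_equation K c \<kappa> z \<longleftrightarrow> k < z \<and> f z = 0" for z
    unfolding injection_equation_def f_def k_def using assms by (simp add: field_simps)
  have deriv: "(f has_real_derivative (k / z - 1)) (at z)" if "0 < z" for z
    unfolding f_def using that k by (auto intro!: derivative_eq_intros simp: field_simps)
  have dec: "f b < f a" if "k \<le> a" "a < b" for a b
  proof (rule DERIV_neg_imp_decreasing_open[OF that(2)])
    show "\<exists>y. (f has_real_derivative y) (at z) \<and> y < 0" if "a < z" "z < b" for z
      using deriv[of z] that \<open>k \<le> a\<close> k by (intro exI[of _ "k / z - 1"]) (auto simp: field_simps)
    show "continuous_on {a..b} f"
      using k \<open>k \<le> a\<close> deriv by (intro DERIV_atLeastAtMost_imp_continuous_on) (metis less_le_trans order_less_le_trans)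
  qed
  have pos: "0 < f k" using assms k by (simp add: f_def)
  \<comment> \<open>With \<open>ln y \<le> 2 * sqrt y - 2\<close> and
    \<open>sqrt (B * k) \<le> k + B / 4\<close>, the value \<open>f B\<close> is at most
    \<open>K + k - B / 2\<close>, which is negative for this \<open>B\<close>.\<close>
  define B where "B = 4 * (k + K)"
  have "f B \<le> 0"
  proof -
    have Bk: "0 < B / k" using k assms by (simp add: B_def)
    have "ln (sqrt (B / k)) \<le> sqrt (B / k) - 1" using Bk by (intro ln_le_minus_one) simp
    then have "ln (B / k) \<le> 2 * sqrt (B / k) - 2" using Bk by (simp add: ln_sqrt)
    then have "k * ln (B / k) \<le> k * (2 * sqrt (B / k) - 2)" using k by (intro mult_left_mono) auto
    also have "k * sqrt (B / k) = sqrt (B * k)"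
      using k by (simp add: real_sqrt_divide real_sqrt_mult field_simps)
    then have "k * (2 * sqrt (B / k) - 2) = 2 * sqrt (B * k) - 2 * k" by (simp add: algebra_simps)
    also have "sqrt (B * k) \<le> k + B / 4"
      using k assms by (intro real_le_lsqrt) (auto simp: B_def power2_eq_square algebra_simps)
    finally show ?thesis using k assms by (simp add: f_def B_def)
  qed
  then have "\<exists>z\<ge>k. z \<le> B \<and> f z = 0"
    using pos k assms deriv
    by (intro IVT2') (auto simp: B_def intro!: DERIV_atLeastAtMost_imp_continuous_on; metis less_le_trans)+
  then obtain z where z: "k \<le> z" "f z = 0" by blast
  with pos have "k < z" by (cases "z = k") auto
  show ?thesis
  proof (rule ex1I[of _ z])
    show "injection_equation K c \<kappa> z" using z \<open>k < z\<close> by (simp add: eq)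
    fix y assume "injection_equation K c \<kappa> y"
    then have y: "k < y" "f y = 0" by (auto simp: eq)
    show "y = z" using dec[of y z] dec[of z y] y z by (cases y z rule: linorder_cases) auto
  qed
qed

text \<open>\<open>\<xi>\<close> is the size at which the marginal saving
  \<open>\<zeta> * \<kappa> * exp (- \<kappa> * y)\<close> equals the marginal cost
  \<open>c\<close>; the equation for \<open>\<zeta>\<close> then says that total cost and total
  saving agree at this size.\<close>

lemma injection_equation_cost:
  assumes "0 < K" "0 < c" "0 < \<kappa>" and \<zeta>: "injection_equation K c \<kappa> \<zeta>"
  defines "\<xi> \<equiv> 1 / \<kappa> * ln (\<zeta> * \<kappa> / c)"
  shows "0 < \<zeta>" "0 < \<xi>" "K + c * \<xi> = \<zeta> * (1 - exp (- \<kappa> * \<xi>))"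
    and "\<zeta> * (1 - exp (- \<kappa> * y)) \<le> K + c * y"
proof -
  have gt: "c / \<kappa> < \<zeta>" and eq: "K + c / \<kappa> * ln (\<zeta> * \<kappa> / c) + c / \<kappa> - \<zeta> = 0"
    using \<zeta> by (auto simp: injection_equation_def)
  show z: "0 < \<zeta>" using gt assms by (meson divide_pos_pos less_trans)
  have one: "1 < \<zeta> * \<kappa> / c" using gt assms by (simp add: field_simps)
  then show "0 < \<xi>" using assms by (simp add: \<xi>_def)
  have "exp (- \<kappa> * \<xi>) = c / (\<zeta> * \<kappa>)"
    using one z assms by (simp add: \<xi>_def exp_minus field_simps)
  then show "K + c * \<xi> = \<zeta> * (1 - exp (- \<kappa> * \<xi>))"
    using eq z assms by (simp add: \<xi>_def field_simps)
  have exp_\<xi>: "exp (\<kappa> * \<xi>) = \<zeta> * \<kappa> / c"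
  proof -
    have "\<kappa> * \<xi> = ln (\<zeta> * \<kappa> / c)" using assms(3) by (simp add: \<xi>_def)
    then show ?thesis using one by (simp only: exp_ln)
  qed
  text \<open>Tangent line of \<open>exp\<close> at the optimal injection size.\<close>
  have "1 + (\<kappa> * \<xi> - \<kappa> * y) \<le> exp (\<kappa> * \<xi> - \<kappa> * y)" by (rule exp_ge_add_one_self)
  also have "\<dots> = \<zeta> * \<kappa> / c * exp (- \<kappa> * y)"
    unfolding exp_\<xi>[symmetric] by (simp add: exp_diff exp_minus divide_inverse)
  finally have "c / \<kappa> * (1 + (\<kappa> * \<xi> - \<kappa> * y)) \<le> c / \<kappa> * (\<zeta> * \<kappa> / c * exp (- \<kappa> * y))"
    using assms by (intro mult_left_mono) auto
  then have "c / \<kappa> + c * \<xi> - c * y \<le> \<zeta> * exp (- \<kappa> * y)"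
    using assms by (simp add: field_simps)
  moreover have "K + c * \<xi> + c / \<kappa> = \<zeta>" using eq by (simp add: \<xi>_def)
  ultimately show "\<zeta> * (1 - exp (- \<kappa> * y)) \<le> K + c * y" by (simp add: right_diff_distrib)
qed

section \<open>Ingredients of the constant policy\<close>

text \<open>The rational criterion involves \<open>Z\<close> at countably many times, none of them
  after \<open>t\<close>.\<close>

lemma (in filtered_brownian_motion) hit_stopping_time:
  assumes cont: "\<And>\<omega>. \<omega> \<in> space M \<Longrightarrow> continuous_on {0..} (\<lambda>t. Z t \<omega>)"
    and meas: "\<And>t. 0 \<le> t \<Longrightarrow> Z t \<in> borel_measurable (F (ennreal t))"
  shows "stopping_time F (\<lambda>\<omega>. hit (\<lambda>t. Z t \<omega>) a)"
proof (rule stopping_timeI)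
  fix t :: ennreal
  show "Measurable.pred (F t) (\<lambda>\<omega>. hit (\<lambda>t. Z t \<omega>) a \<le> t)"
  proof (cases t)
    case (real s)
    let ?Q = "{q. 0 \<le> q \<and> q \<le> s \<and> (q \<in> \<rat> \<or> q = s)}"
    have Q: "countable ?Q"
      by (rule countable_subset[of _ "insert s \<rat>"]) (auto intro: countable_rat)
    have "Measurable.pred (F t) (\<lambda>\<omega>. \<forall>n. \<exists>q\<in>?Q. Z q \<omega> < a + 1 / real (Suc n))"
    proof (intro pred_intros_countable measurable_pred_countable(2) Q)
      fix n q assume "q \<in> ?Q"
      then have [measurable]: "Z q \<in> borel_measurable (F t)"
        using real by (intro F_mono[OF _ meas]) (auto intro: ennreal_leI)
      show "Measurable.pred (F t) (\<lambda>\<omega>. Z q \<omega> < a + 1 / real (Suc n))" by measurable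
    qed
    then show ?thesis
      by (rule measurable_cong[THEN iffD1, rotated])
        (simp only: real space_F hit_le_iff_rational[OF cont])
  qed simp
qed

text \<open>The \<open>k\<close>-th approximation has the single cell \<open>(0, k]\<close>, so for
  \<open>k \<ge> t\<close> it is exact up to the null set \<open>s = 0\<close>. The increment is
  taken from \<open>w 0\<close> because \<open>w 0 = 0\<close> holds only almost surely.\<close>

lemma (in filtered_brownian_motion) is_ito_integral_const:
  "is_ito_integral M F w (\<lambda>s \<omega>. h) (\<lambda>t \<omega>. h * (w t \<omega> - w 0 \<omega>))"
  unfolding is_ito_integral_def
proof (intro conjI allI impI ballI exI)
  let ?p = "\<lambda>k i. if i = 0 then 0 else real k" and ?a = "\<lambda>(k::nat) (i::nat) (\<omega>::'a). h"
  show "(\<lambda>\<omega>. h * (w t \<omega> - w 0 \<omega>)) \<in> borel_measurable M" if "0 \<le> t" for t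
    using measurable_w[OF that] measurable_w[of 0] by measurable
  show "continuous_on {0..} (\<lambda>t. h * (w t \<omega> - w 0 \<omega>))" if "\<omega> \<in> space M" for \<omega>
    using continuous_w[OF that] by (intro continuous_intros)
  show "simple_integrand F 1 (?p k) (?a k)" for k
    by (auto simp: simple_integrand_def)
  fix t :: real assume t: "0 \<le> t"
  obtain N :: nat where N: "t \<le> real N" using real_arch_simple by blast
  have 1: "(\<integral>\<^sup>+s\<in>{0..t}. ennreal ((h - simple_value 1 (?p k) (?a k) s \<omega>)\<^sup>2) \<partial>lborel) = 0" if "N \<le> k" for k \<omega>
  proof -
    have "AE s in lborel. s \<noteq> (0::real)" by (rule AE_lborel_singleton)
    then have "AE s in lborel. ennreal ((h - simple_value 1 (?p k) (?a k) s \<omega>)\<^sup>2) * indicator {0..t} s = 0"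
      by eventually_elim (use that N in \<open>auto simp: simple_value_def indicator_def\<close>)
    then have "(\<integral>\<^sup>+s\<in>{0..t}. ennreal ((h - simple_value 1 (?p k) (?a k) s \<omega>)\<^sup>2) \<partial>lborel) = (\<integral>\<^sup>+(s::real). 0 \<partial>lborel)"
      by (rule nn_integral_cong_AE)
    then show ?thesis by simp
  qed
  have 2: "h * (w t \<omega> - w 0 \<omega>) - simple_integral w 1 (?p k) (?a k) t \<omega> = 0" if "N \<le> k" for k \<omega>
    using that N t by (simp add: simple_integral_def min_absorb2 min_absorb1)
  show "(\<lambda>k. \<integral>\<^sup>+\<omega>. (\<integral>\<^sup>+s\<in>{0..t}. ennreal ((h - simple_value 1 (?p k) (?a k) s \<omega>)\<^sup>2) \<partial>lborel) \<partial>M) \<longlonglongrightarrow> 0"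
    using 1 by (intro tendsto_eventually) (auto simp: eventually_sequentially intro!: exI[of _ N])
  show "(\<lambda>k. \<integral>\<^sup>+\<omega>. ennreal ((h * (w t \<omega> - w 0 \<omega>) - simple_integral w 1 (?p k) (?a k) t \<omega>)\<^sup>2) \<partial>M) \<longlonglongrightarrow> 0"
    using 2 by (intro tendsto_eventually) (auto simp: eventually_sequentially intro!: exI[of _ N])
qed

section \<open>The value function and optimality of injections at ruin\<close>

locale reinsurance_problem = filtered_brownian_motion M F w
  for M :: "'a measure" and F :: "ennreal \<Rightarrow> 'a measure" and w :: "real \<Rightarrow> 'a \<Rightarrow> real" +
  fixes D :: "real measure" and \<delta> r K c \<kappa> \<zeta> :: real
  assumes D: "claim_law D" and r: "0 < r" and K: "0 < K" and c: "0 < c" and \<kappa>: "0 < \<kappa>"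
    and \<kappa>_bound: "ereal (1 / \<kappa>) < support_bound D" and J0: "J D \<delta> r (1 / \<kappa>) = 0"
    and \<zeta>: "injection_equation K c \<kappa> \<zeta>"
begin

definition "\<xi> = 1 / \<kappa> * ln (\<zeta> * \<kappa> / c)"

lemmas \<zeta>_facts = injection_equation_cost[OF K c \<kappa> \<zeta>, folded \<xi>_def]

lemma controlled_diffusion_ex:
  assumes "is_control M F D p" "diffusion_part M F w D \<delta> x p Z"
  obtains I where "controlled_diffusion M F w D \<delta> r \<kappa> x p Z I"
proof -
  obtain I where "is_ito_integral M F w (\<lambda>s \<omega>. sig D (retention p s \<omega>)) I"
    "\<forall>t\<ge>0. \<forall>\<omega>\<in>space M. Z t \<omega> = x + (LBINT s=0..ereal t. mu D (retention p s \<omega>) - \<delta>) + I t \<omega>"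
    using assms(2) by (auto simp: diffusion_part_def)
  then have "controlled_diffusion M F w D \<delta> r \<kappa> x p Z I"
    using assms(1) D r \<kappa> J0 by unfold_locales auto
  then show ?thesis by (rule that)
qed

lemma injections_of_control: "is_control M F D p \<Longrightarrow> injections M F w (inj_time p) (inj_size p)"
  by unfold_locales (auto simp: is_control_def)

lemma cost_ge:
  assumes adm: "admissible M F w D \<delta> r K c \<pi>" and x: "0 \<le> x"
  shows "ennreal (\<zeta> * exp (- \<kappa> * x)) \<le> cost M r K c (\<pi> x)"
proof -
  from adm x obtain Z where ctrl: "is_control M F D (\<pi> x)" and diff: "diffusion_part M F w D \<delta> x (\<pi> x) Z"
    and nonneg: "\<And>t. 0 \<le> t \<Longrightarrow> AE \<omega> in M. 0 \<le> surplus (\<pi> x) Z t \<omega>"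
    and fin: "cost M r K c (\<pi> x) < \<infinity>"
    unfolding admissible_def by blast
  obtain I where "controlled_diffusion M F w D \<delta> r \<kappa> x (\<pi> x) Z I"
    by (rule controlled_diffusion_ex[OF ctrl diff])
  then interpret CD: controlled_diffusion M F w D \<delta> r \<kappa> x "\<pi> x" Z I .
  interpret E: exp_surplus M F w Z x \<kappa> r CD.Y
    by (rule CD.exp_surplus) (rule eq_reflection, intro ext, rule CD.Y_def)
  interpret INJ: injections M F w "inj_time (\<pi> x)" "inj_size (\<pi> x)"
    by (rule injections_of_control[OF ctrl])
  interpret S: injected_surplus M F w Z x \<kappa> r CD.Y "inj_time (\<pi> x)" "inj_size (\<pi> x)" ..
  show ?thesis
    unfolding cost_def
    using nonneg fin \<zeta>_facts c by (intro S.cost_lower_bound x K) (auto simp: surplus_def cost_def)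
qed

text \<open>The injection times are known only through the ruin property, for some version
  \<open>Z\<close> and almost every path. Identifying them with level hitting times makes the bound
  valid for every policy of this form.\<close>

lemma ruin_policy:
  assumes pol: "constant_ruin_policy M F w D \<delta> (1 / \<kappa>) \<xi> \<pi>" and x: "0 \<le> x"
  obtains Z where "is_control M F D (\<pi> x)" "diffusion_part M F w D \<delta> x (\<pi> x) Z"
    "\<forall>t\<ge>0. AE \<omega> in M. 0 \<le> surplus (\<pi> x) Z t \<omega>"
    "cost M r K c (\<pi> x) \<le> ennreal (\<zeta> * exp (- \<kappa> * x))"
proof -
  from pol x obtain Z where ctrl: "is_control M F D (\<pi> x)" and diff: "diffusion_part M F w D \<delta> x (\<pi> x) Z"
    and ret: "\<And>s \<omega>. 0 < s \<Longrightarrow> \<omega> \<in> space M \<Longrightarrow> retention (\<pi> x) s \<omega> = ereal (1 / \<kappa>)"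
    and size: "\<And>i \<omega>. \<omega> \<in> space M \<Longrightarrow> inj_size (\<pi> x) i \<omega> = \<xi>"
    and ruin: "AE \<omega> in M. injects_at_ruin (\<pi> x) Z \<omega>"
    unfolding constant_ruin_policy_def by blast
  let ?T = "\<lambda>i \<omega>. inj_time (\<pi> x) i \<omega>"
  obtain I where "controlled_diffusion M F w D \<delta> r \<kappa> x (\<pi> x) Z I"
    by (rule controlled_diffusion_ex[OF ctrl diff])
  then interpret CD: controlled_diffusion M F w D \<delta> r \<kappa> x "\<pi> x" Z I .
  interpret E: exp_surplus M F w Z x \<kappa> r CD.Y
    by (rule CD.exp_surplus) (rule eq_reflection, intro ext, rule CD.Y_def)
  interpret INJ: injections M F w "inj_time (\<pi> x)" "inj_size (\<pi> x)"
    by (rule injections_of_control[OF ctrl])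
  have levels: "AE \<omega> in M. \<forall>i. ?T i \<omega> = hit (\<lambda>t. Z t \<omega>) (- (real i * \<xi>))"
    using ruin E.Z_0 AE_space
  proof eventually_elim
    case (elim \<omega>)
    have "0 \<le> Z 0 \<omega>" using elim(2) x by simp
    from ruin_times_iff_levels[where f="\<lambda>t. Z t \<omega>" and T="\<lambda>i. ?T i \<omega>",
        OF E.Z_cont[OF elim(3)] this \<zeta>_facts(2) INJ.tau_Suc[OF elim(3)]] elim(1)
    show ?case
      unfolding injects_at_ruin_def surplus_before_def ruin_def size[OF elim(3)] by blast
  qed
  have surplus: "\<forall>t\<ge>0. AE \<omega> in M. 0 \<le> surplus (\<pi> x) Z t \<omega>"
  proof (intro allI impI)
    fix t :: real assume t: "0 \<le> t"
    show "AE \<omega> in M. 0 \<le> surplus (\<pi> x) Z t \<omega>"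
      using levels E.Z_0 AE_space
    proof eventually_elim
      case (elim \<omega>)
      have "0 \<le> Z 0 \<omega>" using elim(2) x by simp
      from surplus_at_levels_nonneg[where f="\<lambda>t. Z t \<omega>" and T="\<lambda>i. ?T i \<omega>",
          OF E.Z_cont[OF elim(3)] this \<zeta>_facts(2) INJ.tau_Suc[OF elim(3)] _ t] elim(1)
      show ?case
        unfolding surplus_def size[OF elim(3)] by blast
    qed
  qed
  have hit_bound: "(\<integral>\<^sup>+\<omega>. discount_at r (?T i \<omega>) \<partial>M)
      \<le> ennreal (exp (- \<kappa> * (x + real i * \<xi>)))" for i
  proof (rule E.discounted_hitting_time_le)
    show "stopping_time F (?T i)" by (rule INJ.stop)
    show "AE \<omega> in M. ?T i \<omega> < \<infinity> \<longrightarrow> Z (enn2real (?T i \<omega>)) \<omega> = - (real i * \<xi>)"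
      using levels E.Z_0 AE_space
    proof eventually_elim
      case (elim \<omega>)
      show ?case
      proof
        assume "?T i \<omega> < \<infinity>"
        then obtain t where t: "0 \<le> t" "?T i \<omega> = ennreal t" by (cases "?T i \<omega>") auto
        have "0 \<le> real i * \<xi>" using \<zeta>_facts(2) by simp
        then have "Z t \<omega> = - (real i * \<xi>)"
          using elim t x by (intro hit_value[OF E.Z_cont[OF elim(3)]]) auto
        then show "Z (enn2real (?T i \<omega>)) \<omega> = - (real i * \<xi>)" using t by simp
      qed
    qed
  qed (rule CD.Y_martingale[OF ret])
  note [measurable] = INJ.tau_M
  \<comment> \<open>The ratio of the bounds for consecutive injections, as the next level lies
    \<open>\<xi>\<close> deeper.\<close>
  define q where "q = exp (- \<kappa> * \<xi>)"
  have q: "0 < q" "q < 1" using \<kappa> \<zeta>_facts(2) by (auto simp: q_def)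
  have Kc: "0 \<le> K + c * \<xi>" using K c \<zeta>_facts(2) by simp
  have "cost M r K c (\<pi> x) = (\<integral>\<^sup>+\<omega>. (\<Sum>i. ennreal (K + c * \<xi>) *
      discount_at r (?T i \<omega>)) \<partial>M)"
    unfolding cost_def using size Kc
    by (intro nn_integral_cong suminf_cong) (auto simp: discount_at_def ennreal_mult[symmetric] mult.commute)
  also have "\<dots> = (\<Sum>i. ennreal (K + c * \<xi>) *
      (\<integral>\<^sup>+\<omega>. discount_at r (?T i \<omega>) \<partial>M))"
    by (subst nn_integral_suminf) (auto simp: nn_integral_cmult)
  also have "\<dots> \<le> (\<Sum>i. ennreal ((K + c * \<xi>) * exp (- \<kappa> * x) * q ^ i))"
  proof (intro suminf_le)
    fix i
    have "ennreal (K + c * \<xi>) * (\<integral>\<^sup>+\<omega>. discount_at r (?T i \<omega>) \<partial>M)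
        \<le> ennreal (K + c * \<xi>) * ennreal (exp (- \<kappa> * (x + real i * \<xi>)))"
      by (intro mult_left_mono hit_bound) simp
    also have "\<dots> = ennreal ((K + c * \<xi>) * (exp (- \<kappa> * (x + real i * \<xi>))))"
      using Kc by (simp add: ennreal_mult)
    also have "exp (- \<kappa> * (x + real i * \<xi>)) = exp (- \<kappa> * x) * q ^ i"
      unfolding q_def exp_of_nat_mult[symmetric] exp_add[symmetric] by (simp add: algebra_simps)
    finally show "ennreal (K + c * \<xi>) * (\<integral>\<^sup>+\<omega>. discount_at r (?T i \<omega>) \<partial>M)
        \<le> ennreal ((K + c * \<xi>) * exp (- \<kappa> * x) * q ^ i)" by (simp add: mult.assoc)
  qed auto
  also have "\<dots> = ennreal (\<Sum>i. (K + c * \<xi>) * exp (- \<kappa> * x) * q ^ i)"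
    using q Kc by (intro suminf_ennreal2 summable_mult summable_geometric) auto
  also have "(\<Sum>i. (K + c * \<xi>) * exp (- \<kappa> * x) * q ^ i) = (K + c * \<xi>) * exp (- \<kappa> * x) * (1 / (1 - q))"
    using q by (subst suminf_mult) (auto simp: suminf_geometric intro: summable_geometric)
  \<comment> \<open>Here \<open>K + c * \<xi> = \<zeta> * (1 - q)\<close> cancels the denominator of
    the geometric series.\<close>
  also have "\<dots> = \<zeta> * exp (- \<kappa> * x)"
    using q unfolding \<zeta>_facts(3)[folded q_def] by simp
  finally have "cost M r K c (\<pi> x) \<le> ennreal (\<zeta> * exp (- \<kappa> * x))" .
  with ctrl diff surplus show ?thesis by (rule that)
qed

lemma ruin_policy_admissible:
  assumes "constant_ruin_policy M F w D \<delta> (1 / \<kappa>) \<xi> \<pi>"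
  shows "admissible M F w D \<delta> r K c \<pi>"
  unfolding admissible_def
proof (intro allI impI)
  fix x :: real assume "0 \<le> x"
  from ruin_policy[OF assms this] obtain Z where "is_control M F D (\<pi> x)" "diffusion_part M F w D \<delta> x (\<pi> x) Z"
    "\<forall>t\<ge>0. AE \<omega> in M. 0 \<le> surplus (\<pi> x) Z t \<omega>"
    "cost M r K c (\<pi> x) \<le> ennreal (\<zeta> * exp (- \<kappa> * x))" .
  then show "is_control M F D (\<pi> x) \<and> (\<exists>Z. diffusion_part M F w D \<delta> x (\<pi> x) Z \<and>
      (\<forall>t\<ge>0. AE \<omega> in M. 0 \<le> surplus (\<pi> x) Z t \<omega>)) \<and> cost M r K c (\<pi> x) < \<infinity>"
    by (auto intro: le_less_trans)
qed

text \<open>Taking level hitting times as injection times yields stopping times at once and avoids a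
  recursion; that they are the ruin times follows path by path from the equivalence with
  levels.\<close>

lemma ruin_policy_exists: "\<exists>\<pi>. constant_ruin_policy M F w D \<delta> (1 / \<kappa>) \<xi> \<pi>"
proof -
  \<comment> \<open>Measured from \<open>w 0\<close>, the process starts exactly at \<open>x\<close>
    on every path, not just almost surely.\<close>
  define Z where "Z x t \<omega> = x + (mu D (ereal (1 / \<kappa>)) - \<delta>) * t + sig D (ereal (1 / \<kappa>)) * (w t \<omega> - w 0 \<omega>)" for x t \<omega>
  define \<pi> :: "real \<Rightarrow> 'a control" where
    "\<pi> x = \<lparr>retention = \<lambda>s \<omega>. ereal (1 / \<kappa>), inj_time = \<lambda>i \<omega>. hit (\<lambda>t. Z x t \<omega>) (- (real i * \<xi>)),
      inj_size = \<lambda>i \<omega>. \<xi>\<rparr>" for x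
  have \<xi>: "0 < \<xi>" by (rule \<zeta>_facts(2))
  have Z_cont: "continuous_on {0..} (\<lambda>t. Z x t \<omega>)" if "\<omega> \<in> space M" for x \<omega>
    unfolding Z_def using continuous_w[OF that] by (intro continuous_intros)
  have Z_meas: "Z x t \<in> borel_measurable (F (ennreal t))" if "0 \<le> t" for x t
  proof -
    have [measurable]: "w t \<in> borel_measurable (F (ennreal t))" "w 0 \<in> borel_measurable (F (ennreal t))"
      using that by (auto intro: measurable_w_F)
    show ?thesis unfolding Z_def[abs_def] by measurable
  qed
  have times_mono: "inj_time (\<pi> x) i \<omega> \<le> inj_time (\<pi> x) (Suc i) \<omega>" for x i \<omega>
    unfolding \<pi>_def using \<xi> by (simp add: distrib_right) (intro hit_antimono, simp)
  have "constant_ruin_policy M F w D \<delta> (1 / \<kappa>) \<xi> \<pi>"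
    unfolding constant_ruin_policy_def
  proof (intro allI impI conjI)
    fix x :: real assume x: "0 \<le> x"
    show "is_control M F D (\<pi> x)"
      unfolding is_control_def
    proof (intro conjI allI impI ballI times_mono)
      show "(\<lambda>(s, \<omega>). retention (\<pi> x) s \<omega>) \<in> borel_measurable (predictable_sigma M F)"
        by (simp add: \<pi>_def)
      show "retention (\<pi> x) s \<omega> \<in> {0..support_bound D}" for s \<omega>
        using \<kappa> \<kappa>_bound by (simp add: \<pi>_def)
      show "stopping_time F (inj_time (\<pi> x) i)" for i
        unfolding \<pi>_def using hit_stopping_time[of "Z x", OF Z_cont Z_meas] by simp
    qed (use \<xi> in \<open>auto simp: \<pi>_def\<close>)
    show "\<forall>\<omega>\<in>space M. retention (\<pi> x) s \<omega> = ereal (1 / \<kappa>)" for s by (simp add: \<pi>_def)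
    show "\<forall>\<omega>\<in>space M. inj_size (\<pi> x) i \<omega> = \<xi>" for i by (simp add: \<pi>_def)
    have "diffusion_part M F w D \<delta> x (\<pi> x) (Z x)"
      unfolding diffusion_part_def
    proof (intro exI conjI allI impI ballI)
      show "is_ito_integral M F w (\<lambda>s \<omega>. sig D (retention (\<pi> x) s \<omega>))
          (\<lambda>t \<omega>. sig D (ereal (1 / \<kappa>)) * (w t \<omega> - w 0 \<omega>))"
        unfolding \<pi>_def using is_ito_integral_const by simp
      fix t \<omega> assume "0 \<le> (t::real)"
      have "(LBINT s=ereal 0..ereal t. mu D (ereal (1 / \<kappa>)) - \<delta>) = (mu D (ereal (1 / \<kappa>)) - \<delta>) * t"
        using \<open>0 \<le> t\<close> by simp
      then show "Z x t \<omega> = x + (LBINT s=0..ereal t. mu D (retention (\<pi> x) s \<omega>) - \<delta>)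
          + sig D (ereal (1 / \<kappa>)) * (w t \<omega> - w 0 \<omega>)"
        by (simp add: Z_def \<pi>_def zero_ereal_def)
    qed
    moreover have "AE \<omega> in M. injects_at_ruin (\<pi> x) (Z x) \<omega>"
    proof (rule AE_I2)
      fix \<omega> assume \<omega>: "\<omega> \<in> space M"
      have "0 \<le> Z x 0 \<omega>" using x by (simp add: Z_def)
      note iff = ruin_times_iff_levels[OF Z_cont[OF \<omega>] this \<xi>, of "\<lambda>i. inj_time (\<pi> x) i \<omega>", OF times_mono]
      have size: "inj_size (\<pi> x) i \<omega> = \<xi>" for i by (simp add: \<pi>_def)
      have "\<forall>i. inj_time (\<pi> x) i \<omega> = hit (\<lambda>t. Z x t \<omega>) (- (real i * \<xi>))" by (simp add: \<pi>_def)
      with iff show "injects_at_ruin (\<pi> x) (Z x) \<omega>"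
        unfolding injects_at_ruin_def surplus_before_def ruin_def size by blast
    qed
    ultimately show "\<exists>Z. diffusion_part M F w D \<delta> x (\<pi> x) Z \<and> (AE \<omega> in M. injects_at_ruin (\<pi> x) Z \<omega>)"
      by blast
  qed
  then show ?thesis by blast
qed

lemma value_function_eq:
  assumes "0 \<le> x"
  shows "value_function M F w D \<delta> r K c x = ennreal (\<zeta> * exp (- \<kappa> * x))"
proof (rule antisym)
  obtain \<pi> where \<pi>: "constant_ruin_policy M F w D \<delta> (1 / \<kappa>) \<xi> \<pi>" using ruin_policy_exists by blast
  have "value_function M F w D \<delta> r K c x \<le> cost M r K c (\<pi> x)"
    unfolding value_function_def using ruin_policy_admissible[OF \<pi>] by (intro INF_lower) simp
  also have "\<dots> \<le> ennreal (\<zeta> * exp (- \<kappa> * x))" by (rule ruin_policy[OF \<pi> assms])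
  finally show "value_function M F w D \<delta> r K c x \<le> ennreal (\<zeta> * exp (- \<kappa> * x))" .
  show "ennreal (\<zeta> * exp (- \<kappa> * x)) \<le> value_function M F w D \<delta> r K c x"
    unfolding value_function_def using cost_ge[OF _ assms] by (intro INF_greatest) simp
qed

lemma ruin_policy_optimal:
  assumes \<pi>: "constant_ruin_policy M F w D \<delta> (1 / \<kappa>) \<xi> \<pi>"
  shows "optimal M F w D \<delta> r K c \<pi>"
  unfolding optimal_def
proof (intro conjI allI impI antisym)
  show adm: "admissible M F w D \<delta> r K c \<pi>" by (rule ruin_policy_admissible[OF \<pi>])
  fix x :: real assume x: "0 \<le> x"
  show "cost M r K c (\<pi> x) \<le> value_function M F w D \<delta> r K c x"
    unfolding value_function_eq[OF x] by (rule ruin_policy[OF \<pi> x])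
  show "value_function M F w D \<delta> r K c x \<le> cost M r K c (\<pi> x)"
    unfolding value_function_eq[OF x] by (rule cost_ge[OF adm x])
qed

end

theorem theorem5p1:
  fixes M :: "'a measure" and F :: "ennreal \<Rightarrow> 'a measure" and w :: "real \<Rightarrow> 'a \<Rightarrow> real"
    and D :: "real measure" and \<delta> r K c \<kappa> :: real
  assumes "prob_space M" and "filtration_on M F" and "brownian_motion M F w"
    and "claim_law D"
    and "\<delta> > 0" and "r > 0" and "K > 0" and "c \<ge> 1"
    and "ereal \<delta> < ereal (mu D (support_bound D)) + ereal r * support_bound D
           - ereal ((sig D (support_bound D))\<^sup>2) / (2 * support_bound D)"
    and "\<kappa> > 0" and "ereal (1 / \<kappa>) < support_bound D" and "J D \<delta> r (1 / \<kappa>) = 0"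
  shows "(\<exists>!\<zeta>. injection_equation K c \<kappa> \<zeta>) \<and>
    (\<forall>\<zeta>. injection_equation K c \<kappa> \<zeta> \<longrightarrow>
       (\<forall>x\<ge>0. value_function M F w D \<delta> r K c x = ennreal (\<zeta> * exp (- \<kappa> * x))) \<and>
       (\<exists>\<pi>. constant_ruin_policy M F w D \<delta> (1 / \<kappa>) (1 / \<kappa> * ln (\<zeta> * \<kappa> / c)) \<pi>) \<and>
       (\<forall>\<pi>. constant_ruin_policy M F w D \<delta> (1 / \<kappa>) (1 / \<kappa> * ln (\<zeta> * \<kappa> / c)) \<pi> \<longrightarrow>
            optimal M F w D \<delta> r K c \<pi>))"
proof (intro conjI[OF injection_equation_ex1] allI impI)
  show "0 < K" "0 < c" "0 < \<kappa>" using assms by auto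
  fix \<zeta> assume "injection_equation K c \<kappa> \<zeta>"
  then interpret reinsurance_problem M F w D \<delta> r K c \<kappa> \<zeta>
    using assms by (auto simp: reinsurance_problem_def filtered_brownian_motion_def
      filtered_brownian_motion_axioms_def reinsurance_problem_axioms_def)
  show "(\<forall>x\<ge>0. value_function M F w D \<delta> r K c x = ennreal (\<zeta> * exp (- \<kappa> * x))) \<and>
       (\<exists>\<pi>. constant_ruin_policy M F w D \<delta> (1 / \<kappa>) (1 / \<kappa> * ln (\<zeta> * \<kappa> / c)) \<pi>) \<and>
       (\<forall>\<pi>. constant_ruin_policy M F w D \<delta> (1 / \<kappa>) (1 / \<kappa> * ln (\<zeta> * \<kappa> / c)) \<pi> \<longrightarrow>
            optimal M F w D \<delta> r K c \<pi>)"
    using value_function_eq ruin_policy_exists ruin_policy_optimal unfolding \<xi>_def by blast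
qed

end
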